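(* Let $R$ be a commutative Noetherian local ring, and let $\overline{R}$ be the integral closure of $R$ in its total ring of fractions. If $R$ is analytically unramified and $\operatorname{pd}_R(\overline{R})<\infty$, then $R$ is normal.
   Context: A Noetherian local ring is analytically unramified if its completion is reduced. $\operatorname{pd}_R$ denotes projective dimension over $R$. *)

theory Defs
  imports "HOL-Algebra.Algebra" "HOL-Library.Extended_Nat"
begin

section \<open>Local rings, reduced rings and completion\<close>

definition local_ring :: "('a, 'b) ring_scheme \<Rightarrow> bool" where
  "local_ring R \<longleftrightarrow> cring R \<and> (\<exists>!M. maximalideal M R)"

definition max_ideal :: "('a, 'b) ring_scheme \<Rightarrow> 'a set" where
  "max_ideal R = (THE M. maximalideal M R)"

definition reduced_ring :: "('a, 'b) ring_scheme \<Rightarrow> bool" where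
  "reduced_ring R \<longleftrightarrow>
     (\<forall>x\<in>carrier R. \<forall>n::nat. x [^]\<^bsub>R\<^esub> n = \<zero>\<^bsub>R\<^esub> \<longrightarrow> x = \<zero>\<^bsub>R\<^esub>)"

abbreviation ideal_power :: "('a, 'b) ring_scheme \<Rightarrow> 'a set \<Rightarrow> nat \<Rightarrow> 'a set" where
  "ideal_power R I n \<equiv> I [^]\<^bsub>ideals_set R\<^esub> n"

text \<open>The inverse limit of the rings \<open>R Quot I^n\<close>, whose transition maps send
  a coset of the smaller ideal to the unique coset of the larger one that contains it.\<close>

definition adic_completion :: "('a, 'b) ring_scheme \<Rightarrow> 'a set \<Rightarrow> (nat \<Rightarrow> 'a set) ring" where
  "adic_completion R I =
     \<lparr> carrier = {x. \<forall>n. x n \<in> carrier (R Quot (ideal_power R I n)) \<and> x (Suc n) \<subseteq> x n},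
       monoid.mult = (\<lambda>x y n. x n \<otimes>\<^bsub>R Quot (ideal_power R I n)\<^esub> y n),
       one = (\<lambda>n. \<one>\<^bsub>R Quot (ideal_power R I n)\<^esub>),
       ring.zero = (\<lambda>n. \<zero>\<^bsub>R Quot (ideal_power R I n)\<^esub>),
       ring.add = (\<lambda>x y n. x n \<oplus>\<^bsub>R Quot (ideal_power R I n)\<^esub> y n) \<rparr>"

definition analytically_unramified :: "('a, 'b) ring_scheme \<Rightarrow> bool" where
  "analytically_unramified R \<longleftrightarrow>
     local_ring R \<and> noetherian_ring R \<and> reduced_ring (adic_completion R (max_ideal R))"


section \<open>Localization and the total ring of fractions\<close>

text \<open>Throughout, \<open>S\<close> is meant to be a multiplicative subset of the commutative ring \<open>R\<close>.\<close>

definition frac_rel :: "('a, 'b) ring_scheme \<Rightarrow> 'a set \<Rightarrow> (('a \<times> 'a) \<times> ('a \<times> 'a)) set" where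
  "frac_rel R S = {((a, s), (b, t)). a \<in> carrier R \<and> s \<in> S \<and> b \<in> carrier R \<and> t \<in> S \<and>
     (\<exists>u\<in>S. u \<otimes>\<^bsub>R\<^esub> (t \<otimes>\<^bsub>R\<^esub> a \<ominus>\<^bsub>R\<^esub> s \<otimes>\<^bsub>R\<^esub> b) = \<zero>\<^bsub>R\<^esub>)}"

definition fraction :: "('a, 'b) ring_scheme \<Rightarrow> 'a set \<Rightarrow> 'a \<Rightarrow> 'a \<Rightarrow> ('a \<times> 'a) set" where
  "fraction R S a s = frac_rel R S `` {(a, s)}"

text \<open>As for quotient rings in the library, the operations are unions over all representatives.\<close>

definition localization :: "('a, 'b) ring_scheme \<Rightarrow> 'a set \<Rightarrow> ('a \<times> 'a) set ring" where
  "localization R S =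
     \<lparr> carrier = (carrier R \<times> S) // frac_rel R S,
       monoid.mult = (\<lambda>U V. \<Union>x\<in>U. \<Union>y\<in>V. fraction R S (fst x \<otimes>\<^bsub>R\<^esub> fst y) (snd x \<otimes>\<^bsub>R\<^esub> snd y)),
       one = fraction R S \<one>\<^bsub>R\<^esub> \<one>\<^bsub>R\<^esub>,
       ring.zero = fraction R S \<zero>\<^bsub>R\<^esub> \<one>\<^bsub>R\<^esub>,
       ring.add = (\<lambda>U V. \<Union>x\<in>U. \<Union>y\<in>V.
                fraction R S (snd y \<otimes>\<^bsub>R\<^esub> fst x \<oplus>\<^bsub>R\<^esub> snd x \<otimes>\<^bsub>R\<^esub> fst y)
                  (snd x \<otimes>\<^bsub>R\<^esub> snd y)) \<rparr>"

definition nonzerodivisors :: "('a, 'b) ring_scheme \<Rightarrow> 'a set" where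
  "nonzerodivisors R =
     {s \<in> carrier R. \<forall>a\<in>carrier R. s \<otimes>\<^bsub>R\<^esub> a = \<zero>\<^bsub>R\<^esub> \<longrightarrow> a = \<zero>\<^bsub>R\<^esub>}"

definition total_fractions :: "('a, 'b) ring_scheme \<Rightarrow> ('a \<times> 'a) set ring" where
  "total_fractions R = localization R (nonzerodivisors R)"

definition to_total_fractions :: "('a, 'b) ring_scheme \<Rightarrow> 'a \<Rightarrow> ('a \<times> 'a) set" where
  "to_total_fractions R r = fraction R (nonzerodivisors R) r \<one>\<^bsub>R\<^esub>"


section \<open>Integral closure and normality\<close>

text \<open>Polynomials are coefficient lists with the leading coefficient first.\<close>

definition integral_over :: "('a, 'b) ring_scheme \<Rightarrow> 'a set \<Rightarrow> 'a \<Rightarrow> bool" where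
  "integral_over Q K x \<longleftrightarrow>
     (\<exists>p. set p \<subseteq> K \<and> p \<noteq> [] \<and> lead_coeff p = \<one>\<^bsub>Q\<^esub> \<and> ring.eval Q p x = \<zero>\<^bsub>Q\<^esub>)"

definition integral_closure :: "('a, 'b) ring_scheme \<Rightarrow> ('a \<times> 'a) set set" where
  "integral_closure R =
     {x \<in> carrier (total_fractions R).
        integral_over (total_fractions R) (to_total_fractions R ` carrier R) x}"

definition integral_closure_module :: "('a, 'b) ring_scheme \<Rightarrow> ('a, ('a \<times> 'a) set) module" where
  "integral_closure_module R =
     \<lparr> carrier = integral_closure R,
       monoid.mult = monoid.mult (total_fractions R),
       one = monoid.one (total_fractions R),
       ring.zero = ring.zero (total_fractions R),
       ring.add = ring.add (total_fractions R),
       smult = (\<lambda>r x. to_total_fractions R r \<otimes>\<^bsub>total_fractions R\<^esub> x) \<rparr>"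

text \<open>For a domain the total ring of fractions is the fraction field. A ring is normal if all its
  localizations at prime ideals are normal domains.\<close>

definition normal_domain :: "('a, 'b) ring_scheme \<Rightarrow> bool" where
  "normal_domain R \<longleftrightarrow>
     domain R \<and> integral_closure R = to_total_fractions R ` carrier R"

definition normal_ring :: "('a, 'b) ring_scheme \<Rightarrow> bool" where
  "normal_ring R \<longleftrightarrow> cring R \<and>
     (\<forall>P. primeideal P R \<longrightarrow> normal_domain (localization R (carrier R - P)))"


section \<open>Projective modules\<close>

definition mod_hom ::
  "('a, 'b) ring_scheme \<Rightarrow> ('a, 'm, 'c) module_scheme \<Rightarrow> ('a, 'n, 'd) module_scheme \<Rightarrow> ('m \<Rightarrow> 'n) set"
where
  "mod_hom R M N = {h \<in> hom (add_monoid M) (add_monoid N).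
     \<forall>r\<in>carrier R. \<forall>x\<in>carrier M. h (r \<odot>\<^bsub>M\<^esub> x) = r \<odot>\<^bsub>N\<^esub> h x}"

text \<open>The lifting property. A definition cannot quantify over types, so the test modules live in
  two fixed types, large enough for the free module on the set \<open>P\<close> and for \<open>P\<close> itself;
  \<open>projective_module_lift\<close> below gives the lifting property against modules of all types.\<close>

definition projective_module :: "('a, 'b) ring_scheme \<Rightarrow> ('a, 'p) module \<Rightarrow> bool" where
  "projective_module R P \<longleftrightarrow> module R P \<and>
     (\<forall>(N :: ('a, 'p \<Rightarrow> 'a) module) (N' :: ('a, 'p) module) g f.
        module R N \<and> module R N' \<and> g \<in> mod_hom R N N' \<and> g ` carrier N = carrier N' \<and>
        f \<in> mod_hom R P N' \<longrightarrow>
        (\<exists>h\<in>mod_hom R P N. \<forall>x\<in>carrier P. g (h x) = f x))"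

definition free_mod :: "('a, 'b) ring_scheme \<Rightarrow> 'p set \<Rightarrow> ('a, 'p \<Rightarrow> 'a) module" where
  "free_mod R B =
     \<lparr> carrier = {u. (\<forall>x. u x \<in> carrier R) \<and> finite {x. u x \<noteq> \<zero>\<^bsub>R\<^esub>} \<and> {x. u x \<noteq> \<zero>\<^bsub>R\<^esub>} \<subseteq> B},
       monoid.mult = undefined, one = undefined,
       ring.zero = (\<lambda>_. \<zero>\<^bsub>R\<^esub>),
       ring.add = (\<lambda>u v x. u x \<oplus>\<^bsub>R\<^esub> v x),
       smult = (\<lambda>r u x. r \<otimes>\<^bsub>R\<^esub> u x) \<rparr>"

definition lin_ext ::
  "('a, 'b) ring_scheme \<Rightarrow> ('a, 'n, 'd) module_scheme \<Rightarrow> ('p \<Rightarrow> 'n) \<Rightarrow> ('p \<Rightarrow> 'a) \<Rightarrow> 'n" where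
  "lin_ext R N k u = (\<Oplus>\<^bsub>N\<^esub>x\<in>{x. u x \<noteq> \<zero>\<^bsub>R\<^esub>}. u x \<odot>\<^bsub>N\<^esub> k x)"

lemma mod_homD:
  assumes "h \<in> mod_hom R M N"
  shows "x \<in> carrier M \<Longrightarrow> h x \<in> carrier N"
    "x \<in> carrier M \<Longrightarrow> y \<in> carrier M \<Longrightarrow> h (x \<oplus>\<^bsub>M\<^esub> y) = h x \<oplus>\<^bsub>N\<^esub> h y"
    "r \<in> carrier R \<Longrightarrow> x \<in> carrier M \<Longrightarrow> h (r \<odot>\<^bsub>M\<^esub> x) = r \<odot>\<^bsub>N\<^esub> h x"
  using assms by (auto simp: mod_hom_def hom_def)

lemma mod_homI:
  assumes "\<And>x. x \<in> carrier M \<Longrightarrow> h x \<in> carrier N"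
    "\<And>x y. x \<in> carrier M \<Longrightarrow> y \<in> carrier M \<Longrightarrow> h (x \<oplus>\<^bsub>M\<^esub> y) = h x \<oplus>\<^bsub>N\<^esub> h y"
    "\<And>r x. r \<in> carrier R \<Longrightarrow> x \<in> carrier M \<Longrightarrow> h (r \<odot>\<^bsub>M\<^esub> x) = r \<odot>\<^bsub>N\<^esub> h x"
  shows "h \<in> mod_hom R M N"
  using assms by (auto simp: mod_hom_def hom_def)

lemma module_free_mod:
  assumes "cring R"
  shows "module R (free_mod R B)"
proof -
  interpret cring R by fact
  have uc: "u x \<in> carrier R" if "u \<in> carrier (free_mod R B)" for u x
    using that by (simp add: free_mod_def)
  have add: "(\<lambda>x. u x \<oplus>\<^bsub>R\<^esub> v x) \<in> carrier (free_mod R B)"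
    if "u \<in> carrier (free_mod R B)" "v \<in> carrier (free_mod R B)" for u v
  proof -
    have "{x. u x \<oplus>\<^bsub>R\<^esub> v x \<noteq> \<zero>\<^bsub>R\<^esub>} \<subseteq> {x. u x \<noteq> \<zero>\<^bsub>R\<^esub>} \<union> {x. v x \<noteq> \<zero>\<^bsub>R\<^esub>}" by auto
    moreover have "finite {x. u x \<noteq> \<zero>\<^bsub>R\<^esub>}" "{x. u x \<noteq> \<zero>\<^bsub>R\<^esub>} \<subseteq> B"
      "finite {x. v x \<noteq> \<zero>\<^bsub>R\<^esub>}" "{x. v x \<noteq> \<zero>\<^bsub>R\<^esub>} \<subseteq> B"
      using that by (simp_all add: free_mod_def)
    ultimately have "finite {x. u x \<oplus>\<^bsub>R\<^esub> v x \<noteq> \<zero>\<^bsub>R\<^esub>}" "{x. u x \<oplus>\<^bsub>R\<^esub> v x \<noteq> \<zero>\<^bsub>R\<^esub>} \<subseteq> B"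
      by (blast intro: finite_subset finite_UnI)+
    then show ?thesis using uc[OF that(1)] uc[OF that(2)] that by (simp add: free_mod_def)
  qed
  have scal: "(\<lambda>x. r \<otimes>\<^bsub>R\<^esub> u x) \<in> carrier (free_mod R B)"
    if "r \<in> carrier R" "u \<in> carrier (free_mod R B)" for u r
  proof -
    have "{x. r \<otimes>\<^bsub>R\<^esub> u x \<noteq> \<zero>\<^bsub>R\<^esub>} \<subseteq> {x. u x \<noteq> \<zero>\<^bsub>R\<^esub>}"
      using that by (auto simp: uc)
    moreover have "finite {x. u x \<noteq> \<zero>\<^bsub>R\<^esub>}" "{x. u x \<noteq> \<zero>\<^bsub>R\<^esub>} \<subseteq> B"
      using that by (simp_all add: free_mod_def)
    ultimately have "finite {x. r \<otimes>\<^bsub>R\<^esub> u x \<noteq> \<zero>\<^bsub>R\<^esub>}" "{x. r \<otimes>\<^bsub>R\<^esub> u x \<noteq> \<zero>\<^bsub>R\<^esub>} \<subseteq> B"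
      by (blast intro: finite_subset)+
    then show ?thesis using uc[OF that(2)] that by (simp add: free_mod_def)
  qed
  have ops: "u \<oplus>\<^bsub>free_mod R B\<^esub> v = (\<lambda>x. u x \<oplus>\<^bsub>R\<^esub> v x)"
    "\<zero>\<^bsub>free_mod R B\<^esub> = (\<lambda>_. \<zero>\<^bsub>R\<^esub>)"
    "r \<odot>\<^bsub>free_mod R B\<^esub> u = (\<lambda>x. r \<otimes>\<^bsub>R\<^esub> u x)" for u v r
    by (simp_all add: free_mod_def)
  have zero: "(\<lambda>_. \<zero>\<^bsub>R\<^esub>) \<in> carrier (free_mod R B)" by (simp add: free_mod_def)
  show ?thesis
  proof (rule moduleI)
    show "abelian_group (free_mod R B)"
    proof (rule abelian_groupI)
      fix u v w
      assume u: "u \<in> carrier (free_mod R B)" and v: "v \<in> carrier (free_mod R B)"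
        and w: "w \<in> carrier (free_mod R B)"
      show "u \<oplus>\<^bsub>free_mod R B\<^esub> v \<in> carrier (free_mod R B)"
        unfolding ops using u v by (rule add)
      show "(u \<oplus>\<^bsub>free_mod R B\<^esub> v) \<oplus>\<^bsub>free_mod R B\<^esub> w = u \<oplus>\<^bsub>free_mod R B\<^esub> (v \<oplus>\<^bsub>free_mod R B\<^esub> w)"
        unfolding ops using uc[OF u] uc[OF v] uc[OF w] by (intro ext) (simp add: a_assoc)
      show "u \<oplus>\<^bsub>free_mod R B\<^esub> v = v \<oplus>\<^bsub>free_mod R B\<^esub> u"
        unfolding ops using uc[OF u] uc[OF v] by (intro ext) (simp add: a_comm)
    next
      show "\<zero>\<^bsub>free_mod R B\<^esub> \<in> carrier (free_mod R B)" unfolding ops by (rule zero)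
    next
      fix u assume u: "u \<in> carrier (free_mod R B)"
      show "\<zero>\<^bsub>free_mod R B\<^esub> \<oplus>\<^bsub>free_mod R B\<^esub> u = u"
        unfolding ops using uc[OF u] by (intro ext) simp
      have "(\<lambda>x. (\<ominus>\<^bsub>R\<^esub> \<one>\<^bsub>R\<^esub>) \<otimes>\<^bsub>R\<^esub> u x) \<oplus>\<^bsub>free_mod R B\<^esub> u = \<zero>\<^bsub>free_mod R B\<^esub>"
        unfolding ops using uc[OF u] by (intro ext) (simp add: l_minus l_neg)
      moreover have "(\<lambda>x. (\<ominus>\<^bsub>R\<^esub> \<one>\<^bsub>R\<^esub>) \<otimes>\<^bsub>R\<^esub> u x) \<in> carrier (free_mod R B)"
        by (rule scal) (use u in auto)
      ultimately show "\<exists>y\<in>carrier (free_mod R B). y \<oplus>\<^bsub>free_mod R B\<^esub> u = \<zero>\<^bsub>free_mod R B\<^esub>"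
        by blast
    qed
  next
    fix r u assume r: "r \<in> carrier R" and u: "u \<in> carrier (free_mod R B)"
    show "r \<odot>\<^bsub>free_mod R B\<^esub> u \<in> carrier (free_mod R B)"
      unfolding ops using r u by (rule scal)
  next
    fix r s u assume "r \<in> carrier R" "s \<in> carrier R" "u \<in> carrier (free_mod R B)"
    then show "(r \<oplus>\<^bsub>R\<^esub> s) \<odot>\<^bsub>free_mod R B\<^esub> u = r \<odot>\<^bsub>free_mod R B\<^esub> u \<oplus>\<^bsub>free_mod R B\<^esub> s \<odot>\<^bsub>free_mod R B\<^esub> u"
      unfolding ops by (intro ext) (simp add: uc l_distr)
  next
    fix r u v assume "r \<in> carrier R" "u \<in> carrier (free_mod R B)" "v \<in> carrier (free_mod R B)"
    then show "r \<odot>\<^bsub>free_mod R B\<^esub> (u \<oplus>\<^bsub>free_mod R B\<^esub> v) = r \<odot>\<^bsub>free_mod R B\<^esub> u \<oplus>\<^bsub>free_mod R B\<^esub> r \<odot>\<^bsub>free_mod R B\<^esub> v"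
      unfolding ops by (intro ext) (simp add: uc r_distr)
  next
    fix r s u assume "r \<in> carrier R" "s \<in> carrier R" "u \<in> carrier (free_mod R B)"
    then show "(r \<otimes>\<^bsub>R\<^esub> s) \<odot>\<^bsub>free_mod R B\<^esub> u = r \<odot>\<^bsub>free_mod R B\<^esub> (s \<odot>\<^bsub>free_mod R B\<^esub> u)"
      unfolding ops by (intro ext) (simp add: uc m_assoc)
  next
    fix u assume "u \<in> carrier (free_mod R B)"
    then show "\<one>\<^bsub>R\<^esub> \<odot>\<^bsub>free_mod R B\<^esub> u = u"
      unfolding ops by (intro ext) (simp add: uc)
  qed (rule assms)
qed

lemma lin_ext_superset:
  assumes "module R N" "u \<in> carrier (free_mod R B)" "k \<in> B \<rightarrow> carrier N"
    "finite A" "{x. u x \<noteq> \<zero>\<^bsub>R\<^esub>} \<subseteq> A" "A \<subseteq> B"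
  shows "lin_ext R N k u = (\<Oplus>\<^bsub>N\<^esub>x\<in>A. u x \<odot>\<^bsub>N\<^esub> k x)"
proof -
  interpret module R N by fact
  have z: "\<zero>\<^bsub>R\<^esub> \<odot>\<^bsub>N\<^esub> y = \<zero>\<^bsub>N\<^esub>" if "y \<in> carrier N" for y
    using that by (rule smult_l_null)
  have k: "k x \<in> carrier N" if "x \<in> A" for x using assms(3,6) that by auto
  have u: "u x \<in> carrier R" for x using assms(2) by (auto simp: free_mod_def)
  show ?thesis unfolding lin_ext_def
    by (rule M.add.finprod_mono_neutral_cong_left[OF assms(4,5)]) (auto simp: k u z)
qed

lemma lin_ext_mod_hom:
  assumes "module R N" "k \<in> B \<rightarrow> carrier N"
  shows "lin_ext R N k \<in> mod_hom R (free_mod R B) N"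
proof (rule mod_homI)
  interpret module R N by fact
  have ur: "u x \<in> carrier R" if "u \<in> carrier (free_mod R B)" for u x
    using that by (auto simp: free_mod_def)
  fix u assume u: "u \<in> carrier (free_mod R B)"
  let ?U = "{x. u x \<noteq> \<zero>\<^bsub>R\<^esub>}"
  have U: "finite ?U" "?U \<subseteq> B" using u by (auto simp: free_mod_def)
  have kU: "k x \<in> carrier N" if "u x \<noteq> \<zero>\<^bsub>R\<^esub>" for x using U assms(2) that by auto
  show "lin_ext R N k u \<in> carrier N"
    unfolding lin_ext_def by (rule M.finsum_closed) (auto simp: kU ur[OF u])
  {
    fix v assume v: "v \<in> carrier (free_mod R B)"
    let ?V = "{x. v x \<noteq> \<zero>\<^bsub>R\<^esub>}"
    have V: "finite ?V" "?V \<subseteq> B" using v by (auto simp: free_mod_def)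
    have kV: "k x \<in> carrier N" if "v x \<noteq> \<zero>\<^bsub>R\<^esub>" for x using V assms(2) that by auto
    have uv: "u \<oplus>\<^bsub>free_mod R B\<^esub> v \<in> carrier (free_mod R B)"
      using module_free_mod[of R B] u v R.is_cring
      by (simp add: abelian_groupE(1) module_def)
    have "lin_ext R N k (u \<oplus>\<^bsub>free_mod R B\<^esub> v) =
        (\<Oplus>\<^bsub>N\<^esub>x\<in>?U \<union> ?V. (u x \<oplus>\<^bsub>R\<^esub> v x) \<odot>\<^bsub>N\<^esub> k x)"
      by (subst lin_ext_superset[OF assms(1) uv assms(2), of "?U \<union> ?V"])
        (use U V in \<open>auto simp: free_mod_def\<close>)
    also have "\<dots> = (\<Oplus>\<^bsub>N\<^esub>x\<in>?U \<union> ?V. u x \<odot>\<^bsub>N\<^esub> k x \<oplus>\<^bsub>N\<^esub> v x \<odot>\<^bsub>N\<^esub> k x)"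
      by (rule M.finsum_cong') (auto simp: kU kV ur[OF u] ur[OF v] smult_l_distr)
    also have "\<dots> = (\<Oplus>\<^bsub>N\<^esub>x\<in>?U \<union> ?V. u x \<odot>\<^bsub>N\<^esub> k x) \<oplus>\<^bsub>N\<^esub> (\<Oplus>\<^bsub>N\<^esub>x\<in>?U \<union> ?V. v x \<odot>\<^bsub>N\<^esub> k x)"
      by (rule M.finsum_addf)
        (use U V in \<open>auto simp: kU kV ur[OF u] ur[OF v]\<close>)
    also have "(\<Oplus>\<^bsub>N\<^esub>x\<in>?U \<union> ?V. u x \<odot>\<^bsub>N\<^esub> k x) = lin_ext R N k u"
      by (rule lin_ext_superset[OF assms(1) u assms(2), symmetric]) (use U V in auto)
    also have "(\<Oplus>\<^bsub>N\<^esub>x\<in>?U \<union> ?V. v x \<odot>\<^bsub>N\<^esub> k x) = lin_ext R N k v"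
      by (rule lin_ext_superset[OF assms(1) v assms(2), symmetric]) (use U V in auto)
    finally show "lin_ext R N k (u \<oplus>\<^bsub>free_mod R B\<^esub> v) = lin_ext R N k u \<oplus>\<^bsub>N\<^esub> lin_ext R N k v" .
  }
  {
    fix r assume r: "r \<in> carrier R"
    have ru: "r \<odot>\<^bsub>free_mod R B\<^esub> u \<in> carrier (free_mod R B)"
      using module_free_mod[of R B] u r R.is_cring by (simp add: module.smult_closed)
    have "lin_ext R N k (r \<odot>\<^bsub>free_mod R B\<^esub> u) = (\<Oplus>\<^bsub>N\<^esub>x\<in>?U. (r \<otimes>\<^bsub>R\<^esub> u x) \<odot>\<^bsub>N\<^esub> k x)"
      by (subst lin_ext_superset[OF assms(1) ru assms(2), of ?U])
        (use U r in \<open>auto simp: free_mod_def\<close>)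
    also have "\<dots> = (\<Oplus>\<^bsub>N\<^esub>x\<in>?U. r \<odot>\<^bsub>N\<^esub> (u x \<odot>\<^bsub>N\<^esub> k x))"
      by (rule M.finsum_cong') (use r in \<open>auto simp: kU ur[OF u] smult_assoc1\<close>)
    also have "\<dots> = r \<odot>\<^bsub>N\<^esub> lin_ext R N k u"
      unfolding lin_ext_def
      by (rule finsum_smult_ldistr[symmetric])
        (use U r in \<open>auto simp: kU ur[OF u]\<close>)
    finally show "lin_ext R N k (r \<odot>\<^bsub>free_mod R B\<^esub> u) = r \<odot>\<^bsub>N\<^esub> lin_ext R N k u" .
  }
qed

lemma mod_hom_lin_ext:
  assumes "module R M" "module R N" "g \<in> mod_hom R M N" "k \<in> B \<rightarrow> carrier M"
    "u \<in> carrier (free_mod R B)"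
  shows "g (lin_ext R M k u) = lin_ext R N (\<lambda>x. g (k x)) u"
proof -
  interpret M: module R M by fact
  interpret N: module R N by fact
  have hom: "group_hom (add_monoid M) (add_monoid N) g"
    using assms(3) by (simp add: group_hom_def group_hom_axioms_def mod_hom_def
        M.M.a_group N.M.a_group)
  have gz: "g \<zero>\<^bsub>M\<^esub> = \<zero>\<^bsub>N\<^esub>" using group_hom.hom_one[OF hom] by simp
  have "g (\<Oplus>\<^bsub>M\<^esub>x\<in>A. u x \<odot>\<^bsub>M\<^esub> k x) = (\<Oplus>\<^bsub>N\<^esub>x\<in>A. u x \<odot>\<^bsub>N\<^esub> g (k x))"
    if "finite A" "A \<subseteq> B" for A
    using that
  proof (induction A)
    case empty
    show ?case by (simp add: gz)
  next
    case (insert x A)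
    have c: "u y \<in> carrier R" for y using assms(5) by (auto simp: free_mod_def)
    have kB: "k y \<in> carrier M" if "y \<in> insert x A" for y using that insert.prems assms(4) by auto
    have gk: "g (k y) \<in> carrier N" if "y \<in> insert x A" for y
      using kB[OF that] by (rule mod_homD(1)[OF assms(3)])
    have s: "(\<Oplus>\<^bsub>M\<^esub>x\<in>A. u x \<odot>\<^bsub>M\<^esub> k x) \<in> carrier M"
      by (rule M.M.finsum_closed) (use c kB in auto)
    show ?case
      using insert c kB gk s
      by (simp add: M.M.finsum_insert N.M.finsum_insert Pi_iff mod_homD[OF assms(3)])
  qed
  then show ?thesis using assms(5) by (simp add: lin_ext_def free_mod_def)
qed

lemma projective_module_lift:
  fixes N :: "('a, 'n, 'c) module_scheme" and N' :: "('a, 'k, 'd) module_scheme"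
  assumes P: "projective_module R P"
    and N: "module R N" and N': "module R N'"
    and g: "g \<in> mod_hom R N N'" "g ` carrier N = carrier N'"
    and f: "f \<in> mod_hom R P N'"
  shows "\<exists>h\<in>mod_hom R P N. \<forall>x\<in>carrier P. g (h x) = f x"
proof -
  have PM: "module R P" using P by (simp add: projective_module_def)
  interpret module R P by fact
  let ?F = "free_mod R (carrier P)"
  have F: "module R ?F" by (rule module_free_mod) (rule R.is_cring)
  define pr where "pr = lin_ext R P (\<lambda>x. x)"
  have pr: "pr \<in> mod_hom R ?F P" unfolding pr_def by (rule lin_ext_mod_hom[OF PM]) auto
  have surj: "pr ` carrier ?F = carrier P"
  proof
    show "pr ` carrier ?F \<subseteq> carrier P" using mod_homD(1)[OF pr] by auto
    show "carrier P \<subseteq> pr ` carrier ?F"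
    proof
      fix y assume y: "y \<in> carrier P"
      let ?u = "\<lambda>x. if x = y then \<one>\<^bsub>R\<^esub> else \<zero>\<^bsub>R\<^esub>"
      have sub: "{x. ?u x \<noteq> \<zero>\<^bsub>R\<^esub>} \<subseteq> {y}" by auto
      then have u: "?u \<in> carrier ?F"
        using y finite_subset[OF sub] by (auto simp: free_mod_def)
      have "pr ?u = (\<Oplus>\<^bsub>P\<^esub>x\<in>{y}. ?u x \<odot>\<^bsub>P\<^esub> x)"
        unfolding pr_def by (rule lin_ext_superset[OF PM u]) (use y in auto)
      also have "\<dots> = y" using y by (simp add: M.finsum_insert)
      finally show "y \<in> pr ` carrier ?F" using u by (metis imageI)
    qed
  qed
  have "(\<lambda>x. x) \<in> mod_hom R P P" by (rule mod_homI) simp_all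
  then have "\<exists>h\<in>mod_hom R P ?F. \<forall>x\<in>carrier P. pr (h x) = x"
    using P[unfolded projective_module_def, THEN conjunct2, rule_format, of ?F P pr "\<lambda>x. x"]
      F PM pr surj by simp
  then obtain s where s: "s \<in> mod_hom R P ?F" "\<forall>x\<in>carrier P. pr (s x) = x" by blast
  have "\<forall>x\<in>carrier P. \<exists>y\<in>carrier N. g y = f x"
    using mod_homD(1)[OF f] g(2)[symmetric] by (simp add: image_iff) metis
  then obtain k where k: "\<And>x. x \<in> carrier P \<Longrightarrow> k x \<in> carrier N \<and> g (k x) = f x" by metis
  have kN: "k \<in> carrier P \<rightarrow> carrier N" using k by auto
  have K: "lin_ext R N k \<in> mod_hom R ?F N" by (rule lin_ext_mod_hom[OF N kN])
  have eq: "g (lin_ext R N k u) = f (pr u)" if u: "u \<in> carrier ?F" for u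
  proof -
    interpret N': module R N' by fact
    have uP: "x \<in> carrier P" if "u x \<noteq> \<zero>\<^bsub>R\<^esub>" for x
      using u that by (auto simp: free_mod_def)
    have uR: "u x \<in> carrier R" for x using u by (simp add: free_mod_def)
    have "g (lin_ext R N k u) = lin_ext R N' (\<lambda>x. g (k x)) u"
      by (rule mod_hom_lin_ext[OF N N' g(1) kN u])
    also have "\<dots> = lin_ext R N' f u"
      unfolding lin_ext_def
      by (rule N'.M.finsum_cong') (auto simp: uP uR k mod_homD(1)[OF f])
    also have "\<dots> = f (pr u)"
      unfolding pr_def by (rule mod_hom_lin_ext[OF PM N' f _ u, symmetric]) auto
    finally show ?thesis .
  qed
  show ?thesis
  proof (rule bexI)
    show "(\<lambda>x. lin_ext R N k (s x)) \<in> mod_hom R P N"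
    proof (rule mod_homI)
      fix x y assume x: "x \<in> carrier P" and y: "y \<in> carrier P"
      show "lin_ext R N k (s x) \<in> carrier N"
        by (intro mod_homD(1)[OF K] mod_homD(1)[OF s(1)] x)
      show "lin_ext R N k (s (x \<oplus>\<^bsub>P\<^esub> y)) = lin_ext R N k (s x) \<oplus>\<^bsub>N\<^esub> lin_ext R N k (s y)"
        using mod_homD(2)[OF K] mod_homD(1)[OF s(1)] x y by (simp only: mod_homD(2)[OF s(1)])
    next
      fix r x assume r: "r \<in> carrier R" and x: "x \<in> carrier P"
      show "lin_ext R N k (s (r \<odot>\<^bsub>P\<^esub> x)) = r \<odot>\<^bsub>N\<^esub> lin_ext R N k (s x)"
        using mod_homD(3)[OF K] mod_homD(1)[OF s(1)] r x by (simp only: mod_homD(3)[OF s(1)])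
    qed
    show "\<forall>x\<in>carrier P. g (lin_ext R N k (s x)) = f x"
      using eq s mod_homD(1)[OF s(1)] by simp
  qed
qed


section \<open>Projective dimension\<close>

definition projective_resolution ::
  "('a, 'b) ring_scheme \<Rightarrow> ('a, 'm, 'c) module_scheme \<Rightarrow> (nat \<Rightarrow> ('a, 'p) module) \<Rightarrow>
     (nat \<Rightarrow> 'p \<Rightarrow> 'p) \<Rightarrow> ('p \<Rightarrow> 'm) \<Rightarrow> bool" where
  "projective_resolution R M P d e \<longleftrightarrow>
     (\<forall>i. projective_module R (P i)) \<and>
     (\<forall>i. d i \<in> mod_hom R (P (Suc i)) (P i)) \<and>
     e \<in> mod_hom R (P 0) M \<and>
     e ` carrier (P 0) = carrier M \<and>
     a_kernel (P 0) M e = d 0 ` carrier (P (Suc 0)) \<and>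
     (\<forall>i. a_kernel (P (Suc i)) (P i) (d i) = d (Suc i) ` carrier (P (Suc (Suc i))))"

text \<open>The least \<open>n\<close> such that \<open>M\<close> has a projective resolution with \<open>P i = 0\<close> for \<open>i > n\<close>, and
  \<open>\<infinity>\<close> if there is none. The type argument is the type in which the modules of the resolution live.
  It matters only through its size: every infinite type at least as large as \<open>R\<close> and \<open>M\<close> gives the
  usual projective dimension, and a smaller type can only give a larger value. A theorem
  that assumes finiteness for a free type variable thus covers all finite projective resolutions.\<close>

definition proj_dim ::
  "'p itself \<Rightarrow> ('a, 'b) ring_scheme \<Rightarrow> ('a, 'm, 'c) module_scheme \<Rightarrow> enat" where
  "proj_dim (_ :: 'p itself) R M =
     Inf {enat n | n. \<exists>(P :: nat \<Rightarrow> ('a, 'p) module) d e.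
            projective_resolution R M P d e \<and> (\<forall>i>n. carrier (P i) = {\<zero>\<^bsub>P i\<^esub>})}"

end

theory Submission
  imports Defs
begin

text \<open>Write \<open>B\<close> for the integral closure of \<open>R\<close>. By Krull's intersection theorem \<open>R\<close> embeds into its
  completion, so \<open>R\<close> is reduced.

  Suppose that \<open>B \<noteq> R\<close>. Choose \<open>x = a / b\<close> in \<open>B\<close> but not in \<open>R\<close> such that \<open>P = (bR : a)\<close> is
  maximal; then \<open>P\<close> is prime. All statements below hold up to multipliers outside \<open>P\<close>, which
  replaces localization at \<open>P\<close>. There is an ideal \<open>J\<close> containing \<open>b\<close> and, up to radical, \<open>P\<close>, with
  \<open>(J : a) = P\<close> (think of \<open>bR + P^N\<close>). If \<open>Tor_1(R/P, K) = 0\<close>, then \<open>Tor_1\<close> of \<open>K\<close> against the cokernel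
  of \<open>a : R/P \<rightarrow> R/J\<close> vanishes too, so \<open>a : K/PK \<rightarrow> K/JK\<close> is injective. Conversely, let \<open>K'\<close> be the
  kernel of a map from a projective module \<open>F\<close> onto a module \<open>K\<close> on which \<open>b\<close> is regular, and let
  \<open>a : K'/PK' \<rightarrow> K'/JK'\<close> be injective. Then \<open>v \<in> K' \<inter> PF\<close> gives \<open>a v \<in> bF \<inter> K' = bK'\<close>, hence
  \<open>v \<in> PK'\<close>, and so \<open>Tor_1(R/P, K) = 0\<close>. Descending along a finite resolution, \<open>a : B/PB \<rightarrow> B/JB\<close>
  is injective. But \<open>a = b x \<in> JB\<close>, so \<open>1 \<in> PB\<close>, which contradicts the integrality of \<open>B\<close>.

  Hence \<open>R\<close> is integrally closed in its total ring of fractions. That ring is reduced, its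
  idempotents are integral and \<open>R\<close> is local, so \<open>R\<close> is a domain, and its localizations are normal.\<close>


section \<open>Ideals and their spans in modules\<close>

text \<open>Each property of \<open>J\<close> answers one demand of the descent. With
  \<open>b \<in> J\<close>, an equation \<open>a v = b w\<close> puts \<open>a v\<close> into
  \<open>J K'\<close>. With \<open>(J : a) = P\<close>, multiplication by \<open>a\<close> embeds
  R/P into R/J at \<open>P\<close>. With \<open>P\<close> nil modulo \<open>J\<close>, the modules
  R/J and R/(J + aR) have finite length at \<open>P\<close>, so they inherit Tor vanishing from R/P;
  the ideal bR alone does not give this in general. No Tor functor occurs. For a submodule
  \<open>Z\<close> of a projective \<open>F\<close>, vanishing of Tor_1(R/I, F/Z) is spelled out as:
  elements of \<open>Z\<close> lying in \<open>I F\<close> lie in \<open>I Z\<close>, up to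
  multipliers outside \<open>P\<close>. Nakayama is not applied to \<open>B\<close> itself, for
  which no finite generation is established. A relation \<open>s \<in> P B\<close> involves finitely
  many elements \<open>Y\<close> of \<open>B\<close>, and for a common denominator \<open>d\<close>
  the module d R[Y] is an ideal of \<open>R\<close>, hence finitely generated. Socle elements,
  \<open>J\<close> and Krull's theorem all come from ideals chosen maximal for a suitable
  property.\<close>

lemma (in noetherian_ring) exists_maximal_ideal_in:
  assumes "F \<noteq> {}" "\<And>J. J \<in> F \<Longrightarrow> ideal J R"
  shows "\<exists>J\<in>F. \<forall>I\<in>F. J \<subseteq> I \<longrightarrow> I = J"
proof (rule subset_Zorn_nonempty[OF assms(1)])
  fix C assume "C \<noteq> {}" "subset.chain F C"
  then have "subset.chain {I. ideal I R} C" "C \<subseteq> F"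
    using assms(2) by (auto simp: subset.chain_def)
  \<comment> \<open>A chain of ideals in a Noetherian ring has its union as a member, so Zorn's
    lemma applies to every nonempty family of ideals.\<close>
  then show "\<Union>C \<in> F" using ideal_chain_is_trivial[OF \<open>C \<noteq> {}\<close>] by auto
qed

lemma (in cring) idealI_cring:
  assumes "J \<subseteq> carrier R" "\<zero> \<in> J" "\<And>x y. x \<in> J \<Longrightarrow> y \<in> J \<Longrightarrow> x \<oplus> y \<in> J"
    "\<And>r x. r \<in> carrier R \<Longrightarrow> x \<in> J \<Longrightarrow> r \<otimes> x \<in> J"
  shows "ideal J R"
proof (rule idealI)
  have "\<ominus> x \<in> J" if "x \<in> J" for x
    using assms(4)[of "\<ominus> \<one>" x] that assms(1) by (auto simp: l_minus)
  then show "subgroup J (add_monoid R)"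
    using assms by (auto simp: subgroup_def a_inv_def)
  fix a x assume "a \<in> J" "x \<in> carrier R"
  then show "x \<otimes> a \<in> J" "a \<otimes> x \<in> J" using assms(1,4) m_comm[of a x] by auto
qed (rule ring_axioms)

section \<open>Colon ideals and enlargement by one generator\<close>

definition colon :: "('a, 'b) ring_scheme \<Rightarrow> 'a set \<Rightarrow> 'a \<Rightarrow> 'a set" where
  "colon R J c = {r \<in> carrier R. r \<otimes>\<^bsub>R\<^esub> c \<in> J}"

definition adjoin :: "('a, 'b) ring_scheme \<Rightarrow> 'a set \<Rightarrow> 'a \<Rightarrow> 'a set" where
  "adjoin R J c = {j \<oplus>\<^bsub>R\<^esub> r \<otimes>\<^bsub>R\<^esub> c | j r. j \<in> J \<and> r \<in> carrier R}"

lemma (in cring) colon_ideal: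
  assumes "ideal J R" "c \<in> carrier R"
  shows "ideal (colon R J c) R"
proof -
  interpret J: ideal J R by fact
  show ?thesis
    by (rule idealI_cring) (use assms(2) in \<open>auto simp: colon_def l_distr m_assoc J.I_l_closed\<close>)
qed

lemma (in cring) adjoin_ideal:
  assumes "ideal J R" "c \<in> carrier R"
  shows "ideal (adjoin R J c) R"
proof -
  interpret J: ideal J R by fact
  have D: "j \<oplus> r \<otimes> c \<in> adjoin R J c" if "j \<in> J" "r \<in> carrier R" for j r
    using that unfolding adjoin_def by blast
  show ?thesis
  proof (rule idealI_cring)
    show "adjoin R J c \<subseteq> carrier R" using assms(2) by (auto simp: adjoin_def)
    show "\<zero> \<in> adjoin R J c" using D[of \<zero> \<zero>] assms(2) by simp
  next
    fix x y assume "x \<in> adjoin R J c" "y \<in> adjoin R J c"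
    then obtain j r k s where "x = j \<oplus> r \<otimes> c" "y = k \<oplus> s \<otimes> c" "j \<in> J" "k \<in> J"
      "r \<in> carrier R" "s \<in> carrier R" unfolding adjoin_def by blast
    moreover from this have "x \<oplus> y = (j \<oplus> k) \<oplus> (r \<oplus> s) \<otimes> c"
      using assms(2) J.Icarr by algebra
    ultimately show "x \<oplus> y \<in> adjoin R J c" using D[of "j \<oplus> k" "r \<oplus> s"] by simp
  next
    fix t x assume t: "t \<in> carrier R" and "x \<in> adjoin R J c"
    then obtain j r where x: "x = j \<oplus> r \<otimes> c" "j \<in> J" "r \<in> carrier R"
      unfolding adjoin_def by blast
    then have "t \<otimes> x = (t \<otimes> j) \<oplus> (t \<otimes> r) \<otimes> c"
      using assms(2) J.Icarr t by algebra
    then show "t \<otimes> x \<in> adjoin R J c" using D[of "t \<otimes> j" "t \<otimes> r"] t x J.I_l_closed by simp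
  qed
qed

lemma (in cring) subset_adjoin:
  assumes "ideal J R" "c \<in> carrier R"
  shows "J \<subseteq> adjoin R J c"
proof
  interpret J: ideal J R by fact
  fix j assume "j \<in> J"
  then show "j \<in> adjoin R J c" unfolding adjoin_def
    by (intro CollectI exI[of _ j] exI[of _ \<zero>]) (use assms(2) J.Icarr in auto)
qed

lemma (in cring) mem_adjoin:
  assumes "ideal J R" "c \<in> carrier R"
  shows "c \<in> adjoin R J c"
proof -
  interpret J: ideal J R by fact
  show ?thesis unfolding adjoin_def
    by (intro CollectI exI[of _ \<zero>] exI[of _ \<one>]) (use assms(2) J.zero_closed in auto)
qed

text \<open>This is the submodule \<open>I B\<close> of finite sums of products \<open>i x\<close>.
  Encoding it as the least set that contains zero and is closed under putting one product in front
  gives induction one summand at a time. \<open>B\<close> may be any subset; for an ideal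
  \<open>I\<close> the result is still closed under scalars, because
  \<open>r (i x) = (r i) x\<close>.\<close>

definition ideal_span :: "('a, 'm, 'd) module_scheme \<Rightarrow> 'a set \<Rightarrow> 'm set \<Rightarrow> 'm set" where
  "ideal_span M I B =
     \<Inter>{N. \<zero>\<^bsub>M\<^esub> \<in> N \<and> (\<forall>i\<in>I. \<forall>x\<in>B. \<forall>z\<in>N. i \<odot>\<^bsub>M\<^esub> x \<oplus>\<^bsub>M\<^esub> z \<in> N)}"

lemma ideal_span_null: "\<zero>\<^bsub>M\<^esub> \<in> ideal_span M I B"
  by (simp add: ideal_span_def)

lemma ideal_span_step:
  "i \<in> I \<Longrightarrow> x \<in> B \<Longrightarrow> z \<in> ideal_span M I B \<Longrightarrow> i \<odot>\<^bsub>M\<^esub> x \<oplus>\<^bsub>M\<^esub> z \<in> ideal_span M I B"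
  by (simp add: ideal_span_def)

lemma ideal_span_induct [consumes 1, case_names null step, induct set: ideal_span]:
  assumes "z \<in> ideal_span M I B" "P \<zero>\<^bsub>M\<^esub>"
    "\<And>i x z. i \<in> I \<Longrightarrow> x \<in> B \<Longrightarrow> z \<in> ideal_span M I B \<Longrightarrow> P z \<Longrightarrow> P (i \<odot>\<^bsub>M\<^esub> x \<oplus>\<^bsub>M\<^esub> z)"
  shows "P z"
proof -
  have "ideal_span M I B \<subseteq> {z \<in> ideal_span M I B. P z}"
    by (subst (1) ideal_span_def, rule Inter_lower)
      (use assms(2,3) in \<open>auto intro: ideal_span_null ideal_span_step\<close>)
  then show ?thesis using assms(1) by auto
qed

lemma ideal_span_mono:
  assumes "I \<subseteq> I'" "B \<subseteq> B'" "z \<in> ideal_span M I B"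
  shows "z \<in> ideal_span M I' B'"
  using assms(3) by induction (use assms(1,2) in \<open>auto intro: ideal_span_null ideal_span_step\<close>)

text \<open>Each summand uses one element of \<open>B\<close>. This substitutes for finite
  generation when \<open>B\<close> is the integral closure.\<close>

lemma ideal_span_finite:
  assumes "z \<in> ideal_span M I B"
  shows "\<exists>Y. finite Y \<and> Y \<subseteq> B \<and> z \<in> ideal_span M I Y"
  using assms
proof induction
  case null
  show ?case by (intro exI[of _ "{}"]) (auto intro: ideal_span_null)
next
  case (step i x z)
  then obtain Y where Y: "finite Y" "Y \<subseteq> B" "z \<in> ideal_span M I Y" by blast
  then have "i \<odot>\<^bsub>M\<^esub> x \<oplus>\<^bsub>M\<^esub> z \<in> ideal_span M I (insert x Y)"
    using step ideal_span_mono[of I I Y "insert x Y"] by (auto intro: ideal_span_step)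
  then show ?case using Y step by (intro exI[of _ "insert x Y"]) auto
qed

context module
begin

lemma ideal_span_closed:
  assumes "I \<subseteq> carrier R" "B \<subseteq> carrier M" "z \<in> ideal_span M I B"
  shows "z \<in> carrier M"
  using assms(3) by induction (use assms(1,2) in auto)

lemma ideal_span_gen:
  assumes "I \<subseteq> carrier R" "B \<subseteq> carrier M" "i \<in> I" "x \<in> B"
  shows "i \<odot>\<^bsub>M\<^esub> x \<in> ideal_span M I B"
  using ideal_span_step[OF assms(3,4) ideal_span_null[of M]] assms
  by (metis M.r_zero smult_closed subsetD)

lemma ideal_span_add:
  assumes "I \<subseteq> carrier R" "B \<subseteq> carrier M" "z \<in> ideal_span M I B" "w \<in> ideal_span M I B"
  shows "z \<oplus>\<^bsub>M\<^esub> w \<in> ideal_span M I B"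
  using assms(3)
proof induction
  case null
  show ?case using assms ideal_span_closed by simp
next
  case (step i x z)
  have "i \<odot>\<^bsub>M\<^esub> x \<in> carrier M" "z \<in> carrier M" "w \<in> carrier M"
    using step assms ideal_span_closed by auto
  then show ?case using step ideal_span_step[OF step(1,2,4)] by (simp add: M.a_assoc)
qed

lemma ideal_span_smult:
  assumes "ideal I R" "B \<subseteq> carrier M" "r \<in> carrier R" "z \<in> ideal_span M I B"
  shows "r \<odot>\<^bsub>M\<^esub> z \<in> ideal_span M I B"
  using assms(4)
proof induction
  case null
  show ?case using assms(3) by (simp add: ideal_span_null)
next
  case (step i x z)
  interpret I: ideal I R by fact
  have c: "i \<in> carrier R" "x \<in> carrier M" "z \<in> carrier M"
    using step assms(2) I.Icarr ideal_span_closed[of I B] by (auto simp: subset_iff)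
  then have "r \<odot>\<^bsub>M\<^esub> (i \<odot>\<^bsub>M\<^esub> x \<oplus>\<^bsub>M\<^esub> z) = (r \<otimes> i) \<odot>\<^bsub>M\<^esub> x \<oplus>\<^bsub>M\<^esub> r \<odot>\<^bsub>M\<^esub> z"
    using assms(3) by (simp add: smult_r_distr smult_assoc1)
  then show ?case using step ideal_span_step[of "r \<otimes> i" I x B] I.I_l_closed assms(3) by simp
qed

text \<open>The coefficients from \<open>K\<close> are absorbed, since \<open>I K\<close> lies in
  \<open>I\<close>. With \<open>K\<close> the whole ring, a set may be replaced by generators of a
  submodule that contains it.\<close>

lemma ideal_span_ideal_span:
  assumes "ideal I R" "K \<subseteq> carrier R" "Y \<subseteq> carrier M" "B \<subseteq> ideal_span M K Y" "z \<in> ideal_span M I B"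
  shows "z \<in> ideal_span M I Y"
proof -
  interpret I: ideal I R by fact
  have Icar: "I \<subseteq> carrier R" using I.Icarr by auto
  have 1: "i \<odot>\<^bsub>M\<^esub> x \<in> ideal_span M I Y" if "i \<in> I" "x \<in> ideal_span M K Y" for i x
    using that(2)
  proof induction
    case null
    show ?case using that(1) I.Icarr by (simp add: ideal_span_null)
  next
    case (step k y z)
    have c: "k \<in> carrier R" "y \<in> carrier M" "z \<in> carrier M" "i \<in> carrier R"
      using step assms(2,3) that I.Icarr ideal_span_closed[of K Y] by (auto simp: subset_iff)
    then have "i \<odot>\<^bsub>M\<^esub> (k \<odot>\<^bsub>M\<^esub> y \<oplus>\<^bsub>M\<^esub> z) = (i \<otimes> k) \<odot>\<^bsub>M\<^esub> y \<oplus>\<^bsub>M\<^esub> i \<odot>\<^bsub>M\<^esub> z"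
      by (simp add: smult_r_distr smult_assoc1)
    then show ?case using step ideal_span_step[of "i \<otimes> k" I y Y] I.I_r_closed that c by simp
  qed
  show ?thesis using assms(5)
  proof induction
    case null
    show ?case by (rule ideal_span_null)
  next
    case (step i x z)
    then show ?case using 1 assms(4) ideal_span_add[OF Icar assms(3)] by blast
  qed
qed

end

lemma mod_hom_zero:
  assumes "module R M" "module R N" "g \<in> mod_hom R M N"
  shows "g \<zero>\<^bsub>M\<^esub> = \<zero>\<^bsub>N\<^esub>"
proof -
  interpret M: module R M by fact
  interpret N: module R N by fact
  have "g (\<zero>\<^bsub>R\<^esub> \<odot>\<^bsub>M\<^esub> \<zero>\<^bsub>M\<^esub>) = \<zero>\<^bsub>R\<^esub> \<odot>\<^bsub>N\<^esub> g \<zero>\<^bsub>M\<^esub>"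
    by (rule mod_homD(3)[OF assms(3)]) auto
  then show ?thesis using mod_homD(1)[OF assms(3)] by simp
qed

lemma mod_hom_minus:
  assumes "module R M" "module R N" "g \<in> mod_hom R M N" "x \<in> carrier M" "y \<in> carrier M"
  shows "g (x \<ominus>\<^bsub>M\<^esub> y) = g x \<ominus>\<^bsub>N\<^esub> g y"
proof -
  interpret M: module R M by fact
  interpret N: module R N by fact
  have "g (x \<ominus>\<^bsub>M\<^esub> y) \<oplus>\<^bsub>N\<^esub> g y = g x"
    using mod_homD(2)[OF assms(3), of "x \<ominus>\<^bsub>M\<^esub> y" y] assms(4,5)
    by (simp add: a_minus_def M.M.a_assoc M.M.l_neg)
  moreover have "g (x \<ominus>\<^bsub>M\<^esub> y) \<in> carrier N" "g y \<in> carrier N"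
    using mod_homD(1)[OF assms(3)] assms(4,5) by auto
  ultimately show ?thesis by (metis N.M.a_assoc N.M.a_inv_closed N.M.r_neg N.M.r_zero a_minus_def)
qed

text \<open>The inclusion from right to left lifts an element of \<open>I g(B)\<close> to
  \<open>I B\<close>; it takes the place of right exactness of tensoring with R/I.\<close>

lemma ideal_span_image:
  assumes "module R M" "module R N" "g \<in> mod_hom R M N" "I \<subseteq> carrier R" "B \<subseteq> carrier M"
  shows "g ` ideal_span M I B = ideal_span N I (g ` B)"
proof -
  interpret M: module R M by fact
  interpret N: module R N by fact
  have eq: "g (i \<odot>\<^bsub>M\<^esub> x \<oplus>\<^bsub>M\<^esub> z) = i \<odot>\<^bsub>N\<^esub> g x \<oplus>\<^bsub>N\<^esub> g z" if "i \<in> I" "x \<in> B" "z \<in> ideal_span M I B" for i x z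
    using that assms(4,5) M.ideal_span_closed[OF assms(4,5) that(3)]
    by (subst mod_homD(2)[OF assms(3)]) (auto simp: mod_homD(3)[OF assms(3)] subset_iff)
  have "g z \<in> ideal_span N I (g ` B)" if "z \<in> ideal_span M I B" for z
    using that by induction (auto simp: mod_hom_zero[OF assms(1-3)] eq intro: ideal_span_null ideal_span_step)
  moreover have "w \<in> g ` ideal_span M I B" if "w \<in> ideal_span N I (g ` B)" for w
    using that
  proof induction
    case null
    show ?case using mod_hom_zero[OF assms(1-3)] ideal_span_null[of M I B] by (metis imageI)
  next
    case (step i y w)
    then obtain x z where "y = g x" "x \<in> B" "w = g z" "z \<in> ideal_span M I B" by blast
    then show ?case using eq[OF step(1)] ideal_span_step[OF step(1)] by (metis imageI)
  qed
  ultimately show ?thesis by blast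
qed

lemma (in module) ideal_span_finsum:
  assumes "I \<subseteq> carrier R" "B \<subseteq> carrier M" "finite A" "\<And>x. x \<in> A \<Longrightarrow> f x \<in> ideal_span M I B"
  shows "(\<Oplus>\<^bsub>M\<^esub>x\<in>A. f x) \<in> ideal_span M I B"
  using assms(3,4)
proof (induction A)
  case empty
  show ?case by (simp add: ideal_span_null)
next
  case (insert x A)
  have c: "f y \<in> carrier M" if "y \<in> insert x A" for y
    using insert.prems[OF that] ideal_span_closed[OF assms(1,2)] by blast
  then have "f \<in> A \<rightarrow> carrier M" by auto
  then show ?case
    using insert c ideal_span_add[OF assms(1,2)] by (simp add: M.finsum_insert)
qed


section \<open>Descent along a projective resolution\<close>

text \<open>\<open>F\<close> is a retract of the free module on its own carrier. The entries of
  \<open>s w\<close> serve as coordinates of \<open>w\<close> and take over the role of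
  flatness.\<close>

lemma projective_module_section:
  assumes "projective_module R F"
  obtains s where "s \<in> mod_hom R F (free_mod R (carrier F))"
    "\<And>w. w \<in> carrier F \<Longrightarrow> lin_ext R F (\<lambda>x. x) (s w) = w"
proof -
  have F: "module R F" using assms by (simp add: projective_module_def)
  interpret module R F by fact
  let ?L = "free_mod R (carrier F)"
  have pr: "lin_ext R F (\<lambda>x. x) \<in> mod_hom R ?L F"
    by (rule lin_ext_mod_hom[OF F]) auto
  have "y \<in> lin_ext R F (\<lambda>x. x) ` carrier ?L" if y: "y \<in> carrier F" for y
  proof -
    let ?u = "\<lambda>x. if x = y then \<one>\<^bsub>R\<^esub> else \<zero>\<^bsub>R\<^esub>"
    have sub: "{x. ?u x \<noteq> \<zero>\<^bsub>R\<^esub>} \<subseteq> {y}" by auto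
    then have u: "?u \<in> carrier ?L"
      using y finite_subset[OF sub] by (auto simp: free_mod_def)
    have "lin_ext R F (\<lambda>x. x) ?u = (\<Oplus>\<^bsub>F\<^esub>x\<in>{y}. ?u x \<odot>\<^bsub>F\<^esub> x)"
      by (rule lin_ext_superset[OF F u]) (use y in auto)
    also have "\<dots> = y" using y by (simp add: M.finsum_insert)
    finally show ?thesis using u by (metis imageI)
  qed
  then have "lin_ext R F (\<lambda>x. x) ` carrier ?L = carrier F" using mod_homD(1)[OF pr] by auto
  moreover have "(\<lambda>x. x) \<in> mod_hom R F F" by (rule mod_homI) simp_all
  ultimately show ?thesis
    using projective_module_lift[OF assms module_free_mod[OF R.is_cring] F pr] that by blast
qed

text \<open>This is the nontrivial half of the flatness identity
  \<open>(J F : c) = (J : c) F\<close>. In a free module, an element of the span of \<open>J\<close>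
  has all its coordinates in \<open>J\<close>. So every coordinate of \<open>s w\<close> lies in
  \<open>(J : c)\<close>, and \<open>w\<close> is the sum of its coordinates times elements of
  \<open>F\<close>.\<close>

lemma projective_module_colon:
  assumes F: "projective_module R F" and J: "ideal J R" and c: "c \<in> carrier R"
    and w: "w \<in> carrier F" and cw: "c \<odot>\<^bsub>F\<^esub> w \<in> ideal_span F J (carrier F)"
  shows "w \<in> ideal_span F (colon R J c) (carrier F)"
proof -
  have FM: "module R F" using F by (simp add: projective_module_def)
  interpret module R F by fact
  interpret J: ideal J R by fact
  let ?L = "free_mod R (carrier F)"
  have L: "module R ?L" by (rule module_free_mod) (rule R.is_cring)
  obtain s where s: "s \<in> mod_hom R F ?L" "\<And>w. w \<in> carrier F \<Longrightarrow> lin_ext R F (\<lambda>x. x) (s w) = w"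
    using projective_module_section[OF F] by blast
  have Jc: "J \<subseteq> carrier R" using J.Icarr by auto
  have coord: "u x \<in> J" if "u \<in> ideal_span ?L J (carrier ?L)" for u x
    using that
  proof induction
    case null
    show ?case using J.zero_closed by (simp add: free_mod_def)
  next
    case (step i u z)
    then have "i \<otimes>\<^bsub>R\<^esub> u x \<in> J" by (intro J.I_r_closed) (auto simp: free_mod_def)
    then show ?case using step J.a_closed by (simp add: free_mod_def)
  qed
  have "s (c \<odot>\<^bsub>F\<^esub> w) \<in> ideal_span ?L J (s ` carrier F)"
    using ideal_span_image[OF FM L s(1) Jc subset_refl] cw by blast
  then have "s (c \<odot>\<^bsub>F\<^esub> w) \<in> ideal_span ?L J (carrier ?L)"
    by (rule ideal_span_mono[rotated 2]) (use mod_homD(1)[OF s(1)] in auto)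
  then have "c \<otimes>\<^bsub>R\<^esub> s w x \<in> J" for x
    using coord[of "s (c \<odot>\<^bsub>F\<^esub> w)" x] mod_homD(3)[OF s(1) c w] by (simp add: free_mod_def)
  moreover have sw: "s w \<in> carrier ?L" using mod_homD(1)[OF s(1) w] .
  ultimately have "s w x \<in> colon R J c" for x
    using c by (auto simp: colon_def free_mod_def R.m_comm)
  moreover have "x \<in> carrier F" "finite {x. s w x \<noteq> \<zero>\<^bsub>R\<^esub>}" if "s w x \<noteq> \<zero>\<^bsub>R\<^esub>" for x
    using sw that by (auto simp: free_mod_def)
  moreover have "colon R J c \<subseteq> carrier R" by (auto simp: colon_def)
  moreover have "finite {x. s w x \<noteq> \<zero>\<^bsub>R\<^esub>}" using sw by (auto simp: free_mod_def)
  ultimately have "lin_ext R F (\<lambda>x. x) (s w) \<in> ideal_span F (colon R J c) (carrier F)"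
    unfolding lin_ext_def by (intro ideal_span_finsum) (auto intro: ideal_span_gen)
  then show ?thesis using s(2)[OF w] by simp
qed

text \<open>After localization at \<open>P\<close> the class of \<open>c\<close> in R/J generates a
  copy of the residue field. As for associated primes, \<open>(J : c)\<close> is taken maximal among
  the colon ideals inside \<open>P\<close>; since \<open>P\<close> is nil modulo \<open>J\<close>,
  the associated prime can only be \<open>P\<close>.\<close>

lemma (in noetherian_ring) exists_socle_element:
  assumes "primeideal P R" "ideal J R" "J \<subseteq> P" "\<And>r. r \<in> P \<Longrightarrow> \<exists>n::nat. r [^] n \<in> J"
  shows "\<exists>c\<in>carrier R. colon R J c \<subseteq> P \<and> (\<forall>r\<in>P. \<exists>s\<in>carrier R - P. s \<otimes> (r \<otimes> c) \<in> J)"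
proof -
  interpret P: primeideal P R by fact
  interpret J: ideal J R by fact
  let ?S = "{colon R J c | c. c \<in> carrier R \<and> colon R J c \<subseteq> P}"
  have "colon R J \<one> \<subseteq> P" using assms(3) by (auto simp: colon_def)
  then have "?S \<noteq> {}" using one_closed by blast
  moreover have "ideal I R" if "I \<in> ?S" for I using P.colon_ideal[OF assms(2)] that by auto
  ultimately have "\<exists>K\<in>?S. \<forall>I\<in>?S. K \<subseteq> I \<longrightarrow> I = K" by (rule exists_maximal_ideal_in)
  then obtain c where c: "c \<in> carrier R" "colon R J c \<subseteq> P"
    and "\<forall>I\<in>?S. colon R J c \<subseteq> I \<longrightarrow> I = colon R J c" by auto
  then have max: "colon R J d = colon R J c"
    if "d \<in> carrier R" "colon R J d \<subseteq> P" "colon R J c \<subseteq> colon R J d" for d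
    using that by auto
  have "\<exists>s\<in>carrier R - P. s \<otimes> (r \<otimes> c) \<in> J" if r: "r \<in> P" for r
  proof (rule ccontr)
    assume *: "\<not> ?thesis"
    have rc: "r \<in> carrier R" using r P.Icarr by auto
    from * have "colon R J (r \<otimes> c) \<subseteq> P" by (auto simp: colon_def)
    moreover have "colon R J c \<subseteq> colon R J (r \<otimes> c)"
    proof
      fix x assume "x \<in> colon R J c"
      then have "x \<in> carrier R" "x \<otimes> c \<in> J" by (auto simp: colon_def)
      moreover from this have "x \<otimes> (r \<otimes> c) = r \<otimes> (x \<otimes> c)"
        using rc c(1) by (simp add: P.m_lcomm)
      ultimately show "x \<in> colon R J (r \<otimes> c)" using J.I_l_closed rc by (simp add: colon_def)
    qed
    ultimately have eq: "colon R J (r \<otimes> c) = colon R J c" using c rc by (intro max) auto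
    have pow: "c \<in> J" if "r [^] n \<otimes> c \<in> J" for n :: nat
      using that
    proof (induction n)
      case 0
      then show ?case using c by simp
    next
      case (Suc n)
      then have "r [^] n \<in> colon R J (r \<otimes> c)"
        using rc c(1) by (simp add: colon_def m_assoc)
      then have "r [^] n \<in> colon R J c" using eq by simp
      then show ?case using Suc.IH by (simp add: colon_def)
    qed
    obtain n where "r [^] (n::nat) \<in> J" using assms(4)[OF r] by blast
    then have "c \<in> J" using pow[of n] J.I_r_closed[OF _ c(1)] by blast
    then have "\<one> \<in> colon R J c" using c(1) by (simp add: colon_def)
    then show False using P.one_imp_carrier P.I_notcarr c(2) by blast
  qed
  then show ?thesis using c by blast
qed

text \<open>The hypothesis offers a separate multiplier for each \<open>r\<close>. The sum
  \<open>z\<close> has finitely many terms, and the product of their multipliers stays outside the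
  prime \<open>P\<close>, so one multiplier serves for all of \<open>z\<close>.\<close>

lemma ideal_span_saturate:
  assumes M: "module R M" and P: "primeideal P R" and J: "ideal J R" and c: "c \<in> carrier R"
    and Z: "Z \<subseteq> carrier M"
    and s: "\<And>r. r \<in> P \<Longrightarrow> \<exists>s\<in>carrier R - P. s \<otimes>\<^bsub>R\<^esub> (r \<otimes>\<^bsub>R\<^esub> c) \<in> J"
    and z: "z \<in> ideal_span M P Z"
  shows "\<exists>s\<in>carrier R - P. s \<odot>\<^bsub>M\<^esub> (c \<odot>\<^bsub>M\<^esub> z) \<in> ideal_span M J Z"
  using z
proof induction
  interpret module R M by fact
  interpret P: primeideal P R by fact
  case null
  have "\<one>\<^bsub>R\<^esub> \<notin> P" using P.one_imp_carrier P.I_notcarr by blast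
  then show ?case using c by (intro bexI[of _ "\<one>\<^bsub>R\<^esub>"]) (auto simp: ideal_span_null)
next
  interpret module R M by fact
  interpret P: primeideal P R by fact
  interpret J: ideal J R by fact
  case (step r x z)
  have PR: "P \<subseteq> carrier R" and JR: "J \<subseteq> carrier R" using P.Icarr J.Icarr by auto
  obtain t where t: "t \<in> carrier R - P" "t \<odot>\<^bsub>M\<^esub> (c \<odot>\<^bsub>M\<^esub> z) \<in> ideal_span M J Z" using step by blast
  obtain u where u: "u \<in> carrier R - P" "u \<otimes>\<^bsub>R\<^esub> (r \<otimes>\<^bsub>R\<^esub> c) \<in> J" using s[OF step(1)] by blast
  have car: "r \<in> carrier R" "x \<in> carrier M" "z \<in> carrier M" "t \<in> carrier R" "u \<in> carrier R"
    using step PR Z ideal_span_closed[OF PR Z] t u by auto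
  have tu: "t \<otimes>\<^bsub>R\<^esub> u \<in> carrier R - P" using P.I_prime t u by auto
  have "(t \<otimes>\<^bsub>R\<^esub> u) \<odot>\<^bsub>M\<^esub> (c \<odot>\<^bsub>M\<^esub> (r \<odot>\<^bsub>M\<^esub> x \<oplus>\<^bsub>M\<^esub> z)) =
    (t \<otimes>\<^bsub>R\<^esub> (u \<otimes>\<^bsub>R\<^esub> (r \<otimes>\<^bsub>R\<^esub> c))) \<odot>\<^bsub>M\<^esub> x \<oplus>\<^bsub>M\<^esub> u \<odot>\<^bsub>M\<^esub> (t \<odot>\<^bsub>M\<^esub> (c \<odot>\<^bsub>M\<^esub> z))"
    using car c by (simp add: smult_r_distr smult_assoc1[symmetric] R.m_ac)
  also have "\<dots> \<in> ideal_span M J Z"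
  proof (rule ideal_span_add[OF JR Z])
    show "(t \<otimes>\<^bsub>R\<^esub> (u \<otimes>\<^bsub>R\<^esub> (r \<otimes>\<^bsub>R\<^esub> c))) \<odot>\<^bsub>M\<^esub> x \<in> ideal_span M J Z"
      using ideal_span_gen[OF JR Z J.I_l_closed[OF u(2)]] step(2) car by simp
    show "u \<odot>\<^bsub>M\<^esub> (t \<odot>\<^bsub>M\<^esub> (c \<odot>\<^bsub>M\<^esub> z)) \<in> ideal_span M J Z"
      by (rule ideal_span_smult[OF J Z car(5) t(2)])
  qed
  finally show ?case using tu by blast
qed

text \<open>Each product \<open>(j + r c) x\<close> splits into \<open>j x\<close> and
  \<open>c (r x)\<close>. Closure of \<open>Z\<close> under sums and scalars merges the terms of the
  second kind into a single \<open>c w\<close>.\<close>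

lemma (in module) ideal_span_adjoin:
  assumes J: "ideal J R" and c: "c \<in> carrier R" and Z: "Z \<subseteq> carrier M" "\<zero>\<^bsub>M\<^esub> \<in> Z"
    "\<And>x y. x \<in> Z \<Longrightarrow> y \<in> Z \<Longrightarrow> x \<oplus>\<^bsub>M\<^esub> y \<in> Z"
    "\<And>r x. r \<in> carrier R \<Longrightarrow> x \<in> Z \<Longrightarrow> r \<odot>\<^bsub>M\<^esub> x \<in> Z"
    and z: "z \<in> ideal_span M (adjoin R J c) Z"
  shows "\<exists>y\<in>ideal_span M J Z. \<exists>w\<in>Z. z = y \<oplus>\<^bsub>M\<^esub> c \<odot>\<^bsub>M\<^esub> w"
  using z
proof induction
  case null
  show ?case using c Z(2) by (intro bexI[of _ "\<zero>\<^bsub>M\<^esub>"]) (auto simp: ideal_span_null)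
next
  case (step i x z)
  interpret J: ideal J R by fact
  have JR: "J \<subseteq> carrier R" using J.Icarr by auto
  obtain y w where yw: "y \<in> ideal_span M J Z" "w \<in> Z" "z = y \<oplus>\<^bsub>M\<^esub> c \<odot>\<^bsub>M\<^esub> w" using step by blast
  obtain j r where i: "i = j \<oplus>\<^bsub>R\<^esub> r \<otimes>\<^bsub>R\<^esub> c" "j \<in> J" "r \<in> carrier R"
    using step(1) by (auto simp: adjoin_def)
  have car: "j \<in> carrier R" "x \<in> carrier M" "w \<in> carrier M" "y \<in> carrier M"
    using i J.Icarr step(2) Z(1) yw ideal_span_closed[OF JR Z(1)] by auto
  have "i \<odot>\<^bsub>M\<^esub> x \<oplus>\<^bsub>M\<^esub> z = (j \<odot>\<^bsub>M\<^esub> x \<oplus>\<^bsub>M\<^esub> (r \<otimes>\<^bsub>R\<^esub> c) \<odot>\<^bsub>M\<^esub> x) \<oplus>\<^bsub>M\<^esub> (y \<oplus>\<^bsub>M\<^esub> c \<odot>\<^bsub>M\<^esub> w)"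
    using car c i(3) by (simp add: i(1) yw(3) smult_l_distr)
  also have "(r \<otimes>\<^bsub>R\<^esub> c) \<odot>\<^bsub>M\<^esub> x = c \<odot>\<^bsub>M\<^esub> (r \<odot>\<^bsub>M\<^esub> x)"
    using car c i(3) by (simp add: R.m_comm[of r c] smult_assoc1)
  also have "(j \<odot>\<^bsub>M\<^esub> x \<oplus>\<^bsub>M\<^esub> c \<odot>\<^bsub>M\<^esub> (r \<odot>\<^bsub>M\<^esub> x)) \<oplus>\<^bsub>M\<^esub> (y \<oplus>\<^bsub>M\<^esub> c \<odot>\<^bsub>M\<^esub> w) =
      (j \<odot>\<^bsub>M\<^esub> x \<oplus>\<^bsub>M\<^esub> y) \<oplus>\<^bsub>M\<^esub> c \<odot>\<^bsub>M\<^esub> (r \<odot>\<^bsub>M\<^esub> x \<oplus>\<^bsub>M\<^esub> w)"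
    using car c i(3) by (simp add: smult_r_distr M.a_ac)
  finally show ?case using yw i step(2) Z ideal_span_step by meson
qed

text \<open>The assumption on \<open>P\<close> says that \<open>Tor_1(R/P, F/Z)\<close> vanishes after localization at \<open>P\<close>, and the
  conclusion says the same for \<open>R/J\<close>. The localization of \<open>R/J\<close> is filtered by copies of \<open>R/P\<close>.\<close>

lemma projective_tor_vanishing:
  assumes N: "noetherian_ring R" and P: "primeideal P R" and F: "projective_module R F"
    and Z: "Z \<subseteq> carrier F" "\<zero>\<^bsub>F\<^esub> \<in> Z" "\<And>x y. x \<in> Z \<Longrightarrow> y \<in> Z \<Longrightarrow> x \<oplus>\<^bsub>F\<^esub> y \<in> Z"
      "\<And>r x. r \<in> carrier R \<Longrightarrow> x \<in> Z \<Longrightarrow> r \<odot>\<^bsub>F\<^esub> x \<in> Z"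
    and T: "\<And>v. v \<in> Z \<Longrightarrow> v \<in> ideal_span F P (carrier F) \<Longrightarrow>
      \<exists>s\<in>carrier R - P. s \<odot>\<^bsub>F\<^esub> v \<in> ideal_span F P Z"
    and J: "ideal J R" "\<And>r. r \<in> P \<Longrightarrow> \<exists>n::nat. r [^]\<^bsub>R\<^esub> n \<in> J"
    and v: "v \<in> Z" "v \<in> ideal_span F J (carrier F)"
  shows "\<exists>s\<in>carrier R - P. s \<odot>\<^bsub>F\<^esub> v \<in> ideal_span F J Z"
proof (rule ccontr)
  assume contra: "\<not> ?thesis"
  have FM: "module R F" using F by (simp add: projective_module_def)
  interpret module R F by fact
  interpret N: noetherian_ring R by fact
  interpret P: primeideal P R by fact
  \<comment> \<open>Noetherian induction: \<open>J\<close> is taken maximal among the ideals for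
    which the claim fails, so the claim holds for \<open>J + R c\<close> with \<open>c\<close>
    outside \<open>J\<close>. That \<open>P\<close> is nil modulo the ideal passes to larger
    ideals.\<close>
  define fails where "fails J \<longleftrightarrow> ideal J R \<and> (\<forall>r\<in>P. \<exists>n::nat. r [^]\<^bsub>R\<^esub> n \<in> J) \<and>
    (\<exists>v\<in>Z. v \<in> ideal_span F J (carrier F) \<and> (\<forall>s\<in>carrier R - P. s \<odot>\<^bsub>F\<^esub> v \<notin> ideal_span F J Z))" for J
  have "fails J" unfolding fails_def using contra J v by blast
  then have "Collect fails \<noteq> {}" by blast
  moreover have "ideal I R" if "I \<in> Collect fails" for I using that by (simp add: fails_def)
  ultimately have "\<exists>K\<in>Collect fails. \<forall>I\<in>Collect fails. K \<subseteq> I \<longrightarrow> I = K"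
    by (rule N.exists_maximal_ideal_in)
  then obtain J where fJ: "fails J" and max: "\<And>I. fails I \<Longrightarrow> J \<subseteq> I \<Longrightarrow> I = J" by auto
  from fJ have J: "ideal J R" "\<And>r. r \<in> P \<Longrightarrow> \<exists>n::nat. r [^]\<^bsub>R\<^esub> n \<in> J"
    and ex: "\<exists>v\<in>Z. v \<in> ideal_span F J (carrier F) \<and> (\<forall>s\<in>carrier R - P. s \<odot>\<^bsub>F\<^esub> v \<notin> ideal_span F J Z)"
    by (simp_all add: fails_def)
  interpret J: ideal J R by fact
  have JR: "J \<subseteq> carrier R" using J.Icarr by auto
  from ex obtain v where v: "v \<in> Z" "v \<in> ideal_span F J (carrier F)"
    and bad: "\<And>s. s \<in> carrier R - P \<Longrightarrow> s \<odot>\<^bsub>F\<^esub> v \<notin> ideal_span F J Z" by blast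
  \<comment> \<open>A multiplier from \<open>J\<close> always moves \<open>v\<close> into
    \<open>J Z\<close>, so the failure of the claim leaves no element of \<open>J\<close> outside
    \<open>P\<close>.\<close>
  have JP: "J \<subseteq> P"
  proof
    fix s assume s: "s \<in> J"
    then have "s \<odot>\<^bsub>F\<^esub> v \<in> ideal_span F J Z" using ideal_span_gen[OF JR Z(1)] v by blast
    then show "s \<in> P" using bad[of s] s J.Icarr by auto
  qed
  obtain c where c: "c \<in> carrier R" "colon R J c \<subseteq> P"
    "\<And>r. r \<in> P \<Longrightarrow> \<exists>s\<in>carrier R - P. s \<otimes>\<^bsub>R\<^esub> (r \<otimes>\<^bsub>R\<^esub> c) \<in> J"
    using N.exists_socle_element[OF P J(1) JP J(2)] by blast
  let ?I = "adjoin R J c"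
  have I: "ideal ?I R" "J \<subseteq> ?I" "c \<in> ?I"
    using R.adjoin_ideal R.subset_adjoin R.mem_adjoin J(1) c(1) by auto
  have "c \<notin> J"
  proof
    assume "c \<in> J"
    then have "\<one>\<^bsub>R\<^esub> \<in> P" using c(1,2) by (auto simp: colon_def)
    then show False using P.one_imp_carrier P.I_notcarr by blast
  qed
  then have "\<not> fails ?I" using max[of ?I] I by blast
  moreover have "v \<in> ideal_span F ?I (carrier F)" using ideal_span_mono[OF I(2) subset_refl v(2)] .
  moreover have "\<exists>n::nat. r [^]\<^bsub>R\<^esub> n \<in> ?I" if "r \<in> P" for r using J(2)[OF that] I by blast
  ultimately obtain s where s: "s \<in> carrier R - P" "s \<odot>\<^bsub>F\<^esub> v \<in> ideal_span F ?I Z"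
    unfolding fails_def using I(1) v(1) by blast
  then obtain y w where yw: "y \<in> ideal_span F J Z" "w \<in> Z" "s \<odot>\<^bsub>F\<^esub> v = y \<oplus>\<^bsub>F\<^esub> c \<odot>\<^bsub>F\<^esub> w"
    using ideal_span_adjoin[OF J(1) c(1) Z] by blast
  have car: "v \<in> carrier F" "w \<in> carrier F" "y \<in> carrier F" "s \<in> carrier R"
    using v yw Z(1) s ideal_span_closed[OF JR Z(1)] by auto
  \<comment> \<open>The element \<open>c w\<close> lies in \<open>J F\<close> because
    \<open>s v\<close> and \<open>y\<close> do. The colon formula turns this into
    \<open>w \<in> P F\<close>, so that the hypothesis \<open>T\<close> about R/P applies to
    \<open>w\<close>. This handles the copy of R/P generated by \<open>c\<close>.\<close>
  have "c \<odot>\<^bsub>F\<^esub> w = s \<odot>\<^bsub>F\<^esub> v \<oplus>\<^bsub>F\<^esub> (\<ominus>\<^bsub>R\<^esub> \<one>\<^bsub>R\<^esub>) \<odot>\<^bsub>F\<^esub> y"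
    using car c(1) by (simp add: yw(3) smult_l_minus M.a_comm[of y] M.a_assoc M.r_neg)
  also have "\<dots> \<in> ideal_span F J (carrier F)"
    using ideal_span_mono[OF subset_refl Z(1) yw(1)] v(2) car
    by (intro ideal_span_add[OF JR] ideal_span_smult[OF J(1)]) auto
  finally have "w \<in> ideal_span F (colon R J c) (carrier F)"
    by (rule projective_module_colon[OF F J(1) c(1) car(2)])
  then have "w \<in> ideal_span F P (carrier F)" by (rule ideal_span_mono[OF c(2) subset_refl])
  then obtain t where t: "t \<in> carrier R - P" "t \<odot>\<^bsub>F\<^esub> w \<in> ideal_span F P Z" using T[OF yw(2)] by blast
  obtain u where u: "u \<in> carrier R - P" "u \<odot>\<^bsub>F\<^esub> (c \<odot>\<^bsub>F\<^esub> (t \<odot>\<^bsub>F\<^esub> w)) \<in> ideal_span F J Z"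
    using ideal_span_saturate[OF FM P J(1) c(1) Z(1) c(3) t(2)] by blast
  \<comment> \<open>\<open>s\<close> comes from the claim for \<open>J + R c\<close>,
    \<open>t\<close> from the hypothesis on R/P applied to \<open>w\<close>, and \<open>u\<close>
    from pushing \<open>c (t w)\<close> into \<open>J Z\<close>.\<close>
  have uts: "u \<otimes>\<^bsub>R\<^esub> t \<otimes>\<^bsub>R\<^esub> s \<in> carrier R - P"
    using P.I_prime[of u t] P.I_prime[of "u \<otimes>\<^bsub>R\<^esub> t" s] t(1) u(1) s(1) by auto
  have "(u \<otimes>\<^bsub>R\<^esub> t \<otimes>\<^bsub>R\<^esub> s) \<odot>\<^bsub>F\<^esub> v = (u \<otimes>\<^bsub>R\<^esub> t) \<odot>\<^bsub>F\<^esub> (y \<oplus>\<^bsub>F\<^esub> c \<odot>\<^bsub>F\<^esub> w)"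
    using t u car by (simp add: yw(3)[symmetric] smult_assoc1)
  also have "\<dots> = (u \<otimes>\<^bsub>R\<^esub> t) \<odot>\<^bsub>F\<^esub> y \<oplus>\<^bsub>F\<^esub> u \<odot>\<^bsub>F\<^esub> (c \<odot>\<^bsub>F\<^esub> (t \<odot>\<^bsub>F\<^esub> w))"
    using t u car c(1) by (simp add: smult_r_distr smult_assoc1[symmetric] R.m_ac)
  also have "\<dots> \<in> ideal_span F J Z"
    using ideal_span_smult[OF J(1) Z(1) _ yw(1), of "u \<otimes>\<^bsub>R\<^esub> t"] t u(1)
    by (intro ideal_span_add[OF JR Z(1) _ u(2)]) auto
  finally show False using bad[OF uts] by blast
qed

lemma mod_hom_kernel_closed:
  assumes "module R M" "module R N" "g \<in> mod_hom R M N"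
  defines "Z \<equiv> a_kernel M N g"
  shows "Z \<subseteq> carrier M" "\<zero>\<^bsub>M\<^esub> \<in> Z" "\<And>x y. x \<in> Z \<Longrightarrow> y \<in> Z \<Longrightarrow> x \<oplus>\<^bsub>M\<^esub> y \<in> Z"
    "\<And>r x. r \<in> carrier R \<Longrightarrow> x \<in> Z \<Longrightarrow> r \<odot>\<^bsub>M\<^esub> x \<in> Z"
proof -
  interpret M: module R M by fact
  interpret N: module R N by fact
  show "Z \<subseteq> carrier M" "\<zero>\<^bsub>M\<^esub> \<in> Z" "\<And>x y. x \<in> Z \<Longrightarrow> y \<in> Z \<Longrightarrow> x \<oplus>\<^bsub>M\<^esub> y \<in> Z"
    "\<And>r x. r \<in> carrier R \<Longrightarrow> x \<in> Z \<Longrightarrow> r \<odot>\<^bsub>M\<^esub> x \<in> Z"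
    unfolding Z_def a_kernel_def kernel_def
    using mod_hom_zero[OF assms(1-3)] by (auto simp: mod_homD[OF assms(3)])
qed

text \<open>This is the colon formula for the zero ideal, as \<open>(0 : b) = 0\<close> for a
  nonzerodivisor \<open>b\<close>.\<close>

lemma projective_module_regular:
  assumes F: "projective_module R F" and b: "b \<in> nonzerodivisors R"
    and w: "w \<in> carrier F" "b \<odot>\<^bsub>F\<^esub> w = \<zero>\<^bsub>F\<^esub>"
  shows "w = \<zero>\<^bsub>F\<^esub>"
proof -
  have FM: "module R F" using F by (simp add: projective_module_def)
  interpret module R F by fact
  have bR: "b \<in> carrier R" using b by (simp add: nonzerodivisors_def)
  have "b \<odot>\<^bsub>F\<^esub> w \<in> ideal_span F {\<zero>\<^bsub>R\<^esub>} (carrier F)" using w ideal_span_null[of F] by simp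
  from projective_module_colon[OF F R.zeroideal bR w(1) this]
  have "w \<in> ideal_span F {\<zero>\<^bsub>R\<^esub>} (carrier F)"
    by (rule ideal_span_mono[rotated 2]) (use b in \<open>auto simp: colon_def nonzerodivisors_def R.m_comm\<close>)
  then show ?thesis by induction auto
qed

text \<open>Here \<open>a / b\<close> stands for the integral element \<open>x\<close>.
  \<open>P_socle\<close> says that \<open>P a\<close> lies in bR; as \<open>b \<in> J\<close>, this
  gives \<open>P \<subseteq> (J : a)\<close>, and \<open>colon_J\<close> makes it an equality.
  \<open>P_socle\<close> speaks of bR rather than \<open>J\<close> because the descent has to divide
  by the regular element \<open>b\<close>. \<open>J_nil\<close> makes R/J a module of finite length
  at \<open>P\<close>.\<close>

locale socle_ideal = noetherian_ring R + primeideal P R for R (structure) and P +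
  fixes a b J
  assumes a_carrier: "a \<in> carrier R" and b_regular: "b \<in> nonzerodivisors R"
    and P_socle: "r \<in> P \<Longrightarrow> \<exists>y\<in>carrier R. r \<otimes> a = y \<otimes> b"
    and J_ideal: "ideal J R" and b_mem: "b \<in> J" and colon_J: "colon R J a \<subseteq> P"
    and J_nil: "r \<in> P \<Longrightarrow> \<exists>n::nat. r [^] n \<in> J"
begin

lemma b_carrier: "b \<in> carrier R"
  using b_regular by (simp add: nonzerodivisors_def)

lemma P_sub: "P \<subseteq> carrier R" using Icarr by auto
lemma J_sub: "J \<subseteq> carrier R" using J_ideal by (meson ideal.Icarr subsetI)

lemma socle_smult:
  assumes M: "module R M" and v: "v \<in> ideal_span M P (carrier M)"
  shows "\<exists>w\<in>carrier M. a \<odot>\<^bsub>M\<^esub> v = b \<odot>\<^bsub>M\<^esub> w"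
  using v
proof induction
  interpret M: module R M by fact
  case null
  show ?case using a_carrier b_carrier by (intro bexI[of _ "\<zero>\<^bsub>M\<^esub>"]) auto
next
  interpret M: module R M by fact
  case (step r x z)
  then obtain w y where w: "w \<in> carrier M" "a \<odot>\<^bsub>M\<^esub> z = b \<odot>\<^bsub>M\<^esub> w"
    and y: "y \<in> carrier R" "r \<otimes> a = y \<otimes> b" using P_socle by blast
  have car: "r \<in> carrier R" "z \<in> carrier M" "x \<in> carrier M"
    using step P_sub M.ideal_span_closed[OF P_sub subset_refl] by auto
  have "a \<odot>\<^bsub>M\<^esub> (r \<odot>\<^bsub>M\<^esub> x) = b \<odot>\<^bsub>M\<^esub> (y \<odot>\<^bsub>M\<^esub> x)"
    using car y a_carrier b_carrier
    by (simp add: M.smult_assoc1[symmetric] m_comm[of a] m_comm[of b])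
  then have "a \<odot>\<^bsub>M\<^esub> (r \<odot>\<^bsub>M\<^esub> x \<oplus>\<^bsub>M\<^esub> z) = b \<odot>\<^bsub>M\<^esub> (y \<odot>\<^bsub>M\<^esub> x \<oplus>\<^bsub>M\<^esub> w)"
    using car y w a_carrier b_carrier by (simp add: M.smult_r_distr)
  then show ?case using car y w by blast
qed

text \<open>The condition that \<open>a v \<in> J X\<close> forces \<open>s v \<in> P X\<close> for some \<open>s\<close> outside \<open>P\<close> says that
  multiplication by \<open>a\<close> embeds \<open>X / P X\<close> into \<open>X / J X\<close> after localization at \<open>P\<close>.\<close>

lemma tor_vanishing_imp_image_embeds:
  assumes F: "projective_module R F" and M: "module R M" and g: "g \<in> mod_hom R F M"
    and T: "\<And>v. v \<in> a_kernel F M g \<Longrightarrow> v \<in> ideal_span F P (carrier F) \<Longrightarrow>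
      \<exists>s\<in>carrier R - P. s \<odot>\<^bsub>F\<^esub> v \<in> ideal_span F P (a_kernel F M g)"
    and v: "v \<in> g ` carrier F" "a \<odot>\<^bsub>M\<^esub> v \<in> ideal_span M J (g ` carrier F)"
  shows "\<exists>s\<in>carrier R - P. s \<odot>\<^bsub>M\<^esub> v \<in> ideal_span M P (g ` carrier F)"
proof -
  have FM: "module R F" using F by (simp add: projective_module_def)
  interpret F: module R F by fact
  interpret M: module R M by fact
  interpret J: ideal J R by (rule J_ideal)
  let ?Z = "a_kernel F M g"
  note Z = mod_hom_kernel_closed[OF FM M g]
  obtain f where f: "f \<in> carrier F" "v = g f" using v by blast
  obtain y where y: "y \<in> ideal_span F J (carrier F)" "a \<odot>\<^bsub>M\<^esub> v = g y"
    using v(2) ideal_span_image[OF FM M g J_sub subset_refl] by blast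
  have yF: "y \<in> carrier F" using F.ideal_span_closed[OF J_sub subset_refl y(1)] .
  \<comment> \<open>\<open>f\<close> is a preimage of \<open>v\<close>, and \<open>y\<close> is a
    preimage of \<open>a v\<close> inside \<open>J F\<close>. Their combination
    \<open>a f - y\<close> lies both in the kernel and in \<open>(J + a R) F\<close>, so the Tor
    vanishing for R/(J + aR), the cokernel of \<open>a : R/P \<rightarrow> R/J\<close>, applies to
    it.\<close>
  let ?u = "a \<odot>\<^bsub>F\<^esub> f \<ominus>\<^bsub>F\<^esub> y"
  let ?I = "adjoin R J a"
  have uF: "?u \<in> carrier F" using f yF a_carrier by simp
  have "g ?u = g (a \<odot>\<^bsub>F\<^esub> f) \<ominus>\<^bsub>M\<^esub> g y"
    using f yF a_carrier by (intro mod_hom_minus[OF FM M g]) auto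
  also have "\<dots> = \<zero>\<^bsub>M\<^esub>"
    using f y yF mod_homD(3)[OF g a_carrier f(1)] mod_homD(1)[OF g yF]
    by (simp add: a_minus_def M.M.r_neg)
  finally have uZ: "?u \<in> ?Z" using uF by (simp add: a_kernel_def kernel_def)
  have I: "ideal ?I R" "J \<subseteq> ?I" "a \<in> ?I"
    using adjoin_ideal subset_adjoin mem_adjoin J_ideal a_carrier by auto
  have IR: "?I \<subseteq> carrier R" using I(1) by (meson ideal.Icarr subsetI)
  have "?u = a \<odot>\<^bsub>F\<^esub> f \<oplus>\<^bsub>F\<^esub> (\<ominus> \<one>) \<odot>\<^bsub>F\<^esub> y"
    using yF by (simp add: a_minus_def F.smult_l_minus)
  also have "\<dots> \<in> ideal_span F ?I (carrier F)"
    using ideal_span_mono[OF I(2) subset_refl y(1)] f I(3)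
    by (intro F.ideal_span_add[OF IR] F.ideal_span_gen[OF IR] F.ideal_span_smult[OF I(1)]) auto
  finally have "?u \<in> ideal_span F ?I (carrier F)" .
  moreover have "\<exists>n::nat. r [^] n \<in> ?I" if "r \<in> P" for r using J_nil[OF that] I(2) by blast
  ultimately obtain s where s: "s \<in> carrier R - P" "s \<odot>\<^bsub>F\<^esub> ?u \<in> ideal_span F ?I ?Z"
    using projective_tor_vanishing[OF noetherian_ring_axioms primeideal_axioms F Z T I(1) _ uZ]
    by blast
  obtain z w where zw: "z \<in> ideal_span F J ?Z" "w \<in> ?Z" "s \<odot>\<^bsub>F\<^esub> ?u = z \<oplus>\<^bsub>F\<^esub> a \<odot>\<^bsub>F\<^esub> w"
    using F.ideal_span_adjoin[OF J_ideal a_carrier Z s(2)] by blast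
  have zJ: "z \<in> ideal_span F J (carrier F)" using ideal_span_mono[OF subset_refl Z(1) zw(1)] .
  have car: "z \<in> carrier F" "w \<in> carrier F" "s \<in> carrier R"
    using F.ideal_span_closed[OF J_sub subset_refl zJ] zw(2) Z(1) s by auto
  \<comment> \<open>From \<open>s u = z + a w\<close> follows \<open>a (s f - w) = s y + z\<close>,
    an element of \<open>J F\<close>. Since \<open>(J : a) \<subseteq> P\<close>, the colon formula
    gives \<open>s f - w \<in> P F\<close>, and \<open>g\<close> sends \<open>s f - w\<close> to
    \<open>s v\<close> because \<open>w\<close> is in the kernel.\<close>
  let ?k = "s \<odot>\<^bsub>F\<^esub> f \<ominus>\<^bsub>F\<^esub> w"
  have k: "?k \<in> carrier F" using car f by simp
  have "a \<odot>\<^bsub>F\<^esub> ?k = s \<odot>\<^bsub>F\<^esub> (a \<odot>\<^bsub>F\<^esub> f) \<ominus>\<^bsub>F\<^esub> a \<odot>\<^bsub>F\<^esub> w"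
    using car f a_carrier
    by (simp add: a_minus_def F.smult_r_distr F.smult_r_minus F.smult_assoc1[symmetric] m_comm)
  also have "s \<odot>\<^bsub>F\<^esub> (a \<odot>\<^bsub>F\<^esub> f) = s \<odot>\<^bsub>F\<^esub> ?u \<oplus>\<^bsub>F\<^esub> s \<odot>\<^bsub>F\<^esub> y"
    using car f yF a_carrier
    by (simp add: a_minus_def F.smult_r_distr F.smult_r_minus F.M.a_assoc F.M.l_neg)
  also have "(s \<odot>\<^bsub>F\<^esub> ?u \<oplus>\<^bsub>F\<^esub> s \<odot>\<^bsub>F\<^esub> y) \<ominus>\<^bsub>F\<^esub> a \<odot>\<^bsub>F\<^esub> w = s \<odot>\<^bsub>F\<^esub> y \<oplus>\<^bsub>F\<^esub> z"
  proof -
    have "z \<oplus>\<^bsub>F\<^esub> A \<oplus>\<^bsub>F\<^esub> Y \<ominus>\<^bsub>F\<^esub> A = Y \<oplus>\<^bsub>F\<^esub> z" if "A \<in> carrier F" "Y \<in> carrier F" for A Y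
    proof -
      have "z \<oplus>\<^bsub>F\<^esub> A \<oplus>\<^bsub>F\<^esub> Y \<ominus>\<^bsub>F\<^esub> A = (Y \<oplus>\<^bsub>F\<^esub> z) \<oplus>\<^bsub>F\<^esub> (A \<ominus>\<^bsub>F\<^esub> A)"
        using that car by (simp add: a_minus_def F.M.a_ac)
      then show ?thesis using that car by (simp add: a_minus_def F.M.r_neg)
    qed
    then show ?thesis unfolding zw(3) using car yF a_carrier by simp
  qed
  also have "\<dots> \<in> ideal_span F J (carrier F)"
    by (intro F.ideal_span_add[OF J_sub] F.ideal_span_smult[OF J_ideal] zJ y(1) car) auto
  finally have "?k \<in> ideal_span F (colon R J a) (carrier F)"
    by (rule projective_module_colon[OF F J_ideal a_carrier k])
  then have "?k \<in> ideal_span F P (carrier F)" by (rule ideal_span_mono[OF colon_J subset_refl])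
  then have "g ?k \<in> ideal_span M P (g ` carrier F)"
    using ideal_span_image[OF FM M g P_sub subset_refl] by blast
  moreover have "g ?k = g (s \<odot>\<^bsub>F\<^esub> f) \<ominus>\<^bsub>M\<^esub> g w"
    using f car by (intro mod_hom_minus[OF FM M g]) auto
  moreover have "g w = \<zero>\<^bsub>M\<^esub>" using zw(2) by (simp add: a_kernel_def kernel_def)
  moreover have "g (s \<odot>\<^bsub>F\<^esub> f) = s \<odot>\<^bsub>M\<^esub> v" using mod_homD(3)[OF g car(3) f(1)] f(2) by simp
  moreover have "v \<in> carrier M" using mod_homD(1)[OF g f(1)] f(2) by simp
  moreover have neg0: "\<ominus>\<^bsub>M\<^esub> \<zero>\<^bsub>M\<^esub> = \<zero>\<^bsub>M\<^esub>"
    by (metis M.M.r_neg M.M.l_zero M.M.zero_closed M.M.a_inv_closed)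
  ultimately have "s \<odot>\<^bsub>M\<^esub> v \<in> ideal_span M P (g ` carrier F)"
    using car neg0 by (simp add: a_minus_def)
  then show ?thesis using s(1) by blast
qed

lemma kernel_embeds_imp_tor_vanishing:
  assumes F: "module R F" and M: "module R M" and g: "g \<in> mod_hom R F M"
    and reg: "\<And>m. m \<in> carrier M \<Longrightarrow> b \<odot>\<^bsub>M\<^esub> m = \<zero>\<^bsub>M\<^esub> \<Longrightarrow> m = \<zero>\<^bsub>M\<^esub>"
    and inj: "\<And>v. v \<in> a_kernel F M g \<Longrightarrow> a \<odot>\<^bsub>F\<^esub> v \<in> ideal_span F J (a_kernel F M g) \<Longrightarrow>
      \<exists>s\<in>carrier R - P. s \<odot>\<^bsub>F\<^esub> v \<in> ideal_span F P (a_kernel F M g)"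
    and v: "v \<in> a_kernel F M g" "v \<in> ideal_span F P (carrier F)"
  shows "\<exists>s\<in>carrier R - P. s \<odot>\<^bsub>F\<^esub> v \<in> ideal_span F P (a_kernel F M g)"
proof (rule inj[OF v(1)])
  interpret F: module R F by fact
  note Z = mod_hom_kernel_closed[OF F M g]
  \<comment> \<open>A priori \<open>w\<close> is only an element of \<open>F\<close>. Regularity of
    \<open>b\<close> on \<open>M\<close> puts it into the kernel, as
    \<open>b g(w) = g(a v) = 0\<close>; then \<open>b w\<close> lies in \<open>J\<close> times the
    kernel because \<open>b \<in> J\<close>.\<close>
  obtain w where w: "w \<in> carrier F" "a \<odot>\<^bsub>F\<^esub> v = b \<odot>\<^bsub>F\<^esub> w" using socle_smult[OF F v(2)] by blast
  have "a \<odot>\<^bsub>F\<^esub> v \<in> a_kernel F M g" using Z(4)[OF a_carrier v(1)] .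
  then have "b \<odot>\<^bsub>M\<^esub> g w = \<zero>\<^bsub>M\<^esub>"
    using w mod_homD(3)[OF g b_carrier w(1)] by (simp add: a_kernel_def kernel_def)
  then have "w \<in> a_kernel F M g"
    using reg mod_homD(1)[OF g w(1)] w(1) by (simp add: a_kernel_def kernel_def)
  then show "a \<odot>\<^bsub>F\<^esub> v \<in> ideal_span F J (a_kernel F M g)"
    using F.ideal_span_gen[OF J_sub Z(1) b_mem] w(2) by simp
qed

text \<open>The induction runs downwards in \<open>i\<close>. The image of \<open>d (Suc i)\<close>
  is the kernel of \<open>d i\<close>; its embedding gives Tor vanishing for the image of
  \<open>d i\<close>, and that gives the embedding for the image of \<open>d i\<close>. Here
  \<open>b\<close> is regular on \<open>F i\<close> since \<open>F i\<close> is projective. The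
  conclusion concerns the image of \<open>e\<close>, which may be a proper part of \<open>M\<close>:
  in the application \<open>M\<close> is the total ring of fractions.\<close>

lemma finite_resolution_embeds:
  fixes F :: "nat \<Rightarrow> ('a, 'p) module"
  assumes F: "\<And>i. projective_module R (F i)" and d: "\<And>i. d i \<in> mod_hom R (F (Suc i)) (F i)"
    and M: "module R M" and e: "e \<in> mod_hom R (F 0) M"
    and ex0: "a_kernel (F 0) M e = d 0 ` carrier (F (Suc 0))"
    and ex: "\<And>i. a_kernel (F (Suc i)) (F i) (d i) = d (Suc i) ` carrier (F (Suc (Suc i)))"
    and fin: "\<And>i. i > n \<Longrightarrow> carrier (F i) = {\<zero>\<^bsub>F i\<^esub>}"
    and reg: "\<And>m. m \<in> carrier M \<Longrightarrow> b \<odot>\<^bsub>M\<^esub> m = \<zero>\<^bsub>M\<^esub> \<Longrightarrow> m = \<zero>\<^bsub>M\<^esub>"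
    and v: "v \<in> e ` carrier (F 0)" "a \<odot>\<^bsub>M\<^esub> v \<in> ideal_span M J (e ` carrier (F 0))"
  shows "\<exists>s\<in>carrier R - P. s \<odot>\<^bsub>M\<^esub> v \<in> ideal_span M P (e ` carrier (F 0))"
proof -
  have FM: "module R (F i)" for i using F by (simp add: projective_module_def)
  have one: "\<one> \<in> carrier R - P" using one_imp_carrier I_notcarr by blast
  have emb: "\<exists>s\<in>carrier R - P. s \<odot>\<^bsub>F i\<^esub> v \<in> ideal_span (F i) P (d i ` carrier (F (Suc i)))"
    if "v \<in> d i ` carrier (F (Suc i))" "a \<odot>\<^bsub>F i\<^esub> v \<in> ideal_span (F i) J (d i ` carrier (F (Suc i)))"
    for i v
    using that
  proof (induction "n - i" arbitrary: i v)
    case 0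
    interpret Fi: module R "F i" by (rule FM)
    \<comment> \<open>\<open>n - i = 0\<close> means that \<open>Suc i\<close> exceeds
      \<open>n\<close>, so \<open>F (Suc i)\<close> is the zero module.\<close>
    have "v = \<zero>\<^bsub>F i\<^esub>"
      using 0 fin[of "Suc i"] mod_hom_zero[OF FM FM d] by auto
    then show ?case using one by (intro bexI[of _ \<one>]) (auto simp: ideal_span_null)
  next
    case (Suc k)
    have reg: "m = \<zero>\<^bsub>F i\<^esub>" if "m \<in> carrier (F i)" "b \<odot>\<^bsub>F i\<^esub> m = \<zero>\<^bsub>F i\<^esub>" for m
      using projective_module_regular[OF F b_regular that] .
    have k: "k = n - Suc i" using Suc(2) by simp
    show ?case
    proof (rule tor_vanishing_imp_image_embeds[OF F FM d _ Suc.prems])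
      fix v assume v: "v \<in> a_kernel (F (Suc i)) (F i) (d i)"
        "v \<in> ideal_span (F (Suc i)) P (carrier (F (Suc i)))"
      show "\<exists>s\<in>carrier R - P.
          s \<odot>\<^bsub>F (Suc i)\<^esub> v \<in> ideal_span (F (Suc i)) P (a_kernel (F (Suc i)) (F i) (d i))"
        by (rule kernel_embeds_imp_tor_vanishing[OF FM FM d reg
              Suc.hyps(1)[OF k, folded ex] v])
    qed
  qed
  show ?thesis
  proof (rule tor_vanishing_imp_image_embeds[OF F M e _ v])
    fix v assume v: "v \<in> a_kernel (F 0) M e" "v \<in> ideal_span (F 0) P (carrier (F 0))"
    show "\<exists>s\<in>carrier R - P. s \<odot>\<^bsub>F 0\<^esub> v \<in> ideal_span (F 0) P (a_kernel (F 0) M e)"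
    proof (rule kernel_embeds_imp_tor_vanishing[OF FM M e reg _ v])
      fix v assume "v \<in> a_kernel (F 0) M e" "a \<odot>\<^bsub>F 0\<^esub> v \<in> ideal_span (F 0) J (a_kernel (F 0) M e)"
      then show "\<exists>s\<in>carrier R - P. s \<odot>\<^bsub>F 0\<^esub> v \<in> ideal_span (F 0) P (a_kernel (F 0) M e)"
        unfolding ex0 by (rule emb)
    qed
  qed
qed

end

text \<open>An ideal \<open>B + P^N\<close> with \<open>N\<close> large would serve, by Krull's
  intersection theorem in the localization at \<open>P\<close>. An ideal \<open>J\<close> maximal
  among those that contain \<open>B\<close> and satisfy \<open>(J : a) \<subseteq> P\<close> serves
  as well, and this route yields Krull's theorem for local rings later.\<close>

lemma (in noetherian_ring) exists_nil_ideal: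
  assumes "primeideal P R" and a: "a \<in> carrier R" and B: "ideal B R"
    and soc: "\<forall>r\<in>P. r \<otimes> a \<in> B" and colon_B: "colon R B a \<subseteq> P"
  shows "\<exists>J. ideal J R \<and> B \<subseteq> J \<and> colon R J a \<subseteq> P \<and> (\<forall>r\<in>P. \<exists>n::nat. r [^] n \<in> J)"
proof -
  interpret P: primeideal P R by fact
  have PR: "P \<subseteq> carrier R" using P.Icarr by auto
  define good where "good J \<longleftrightarrow> ideal J R \<and> B \<subseteq> J \<and> colon R J a \<subseteq> P" for J
  have "good B" unfolding good_def using B colon_B by simp
  then have "Collect good \<noteq> {}" by blast
  moreover have "ideal J R" if "J \<in> Collect good" for J using that by (simp add: good_def)
  ultimately have "\<exists>K\<in>Collect good. \<forall>I\<in>Collect good. K \<subseteq> I \<longrightarrow> I = K"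
    by (rule exists_maximal_ideal_in)
  then obtain J where gJ: "good J" and max: "\<And>I. good I \<Longrightarrow> J \<subseteq> I \<Longrightarrow> I = J" by auto
  then have J: "ideal J R" "B \<subseteq> J" "colon R J a \<subseteq> P" by (simp_all add: good_def)
  interpret J: ideal J R by fact
  have "\<exists>n::nat. r [^] n \<in> J" if r: "r \<in> P" for r
  proof -
    have rR: "r \<in> carrier R" using r PR by auto
    have ra: "r \<otimes> a \<in> J" using soc r J(2) by blast
    \<comment> \<open>The ascending chain \<open>(J : r^n)\<close> becomes stationary, so for a
      suitable \<open>n\<close> membership of \<open>y r^(n+1)\<close> in \<open>J\<close> implies
      that of \<open>y r^n\<close>. With this \<open>n\<close>, the ideal \<open>J + r^n R\<close>
      satisfies the same conditions as \<open>J\<close> and so equals \<open>J\<close>.\<close>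
    let ?C = "range (\<lambda>n::nat. colon R J (r [^] n))"
    have id: "ideal I R" if "I \<in> ?C" for I using P.colon_ideal[OF J(1)] rR that by auto
    have "?C \<noteq> {}" by blast
    then have "\<exists>K\<in>?C. \<forall>I\<in>?C. K \<subseteq> I \<longrightarrow> I = K" using id by (rule exists_maximal_ideal_in)
    then obtain n :: nat where n: "\<forall>I\<in>?C. colon R J (r [^] n) \<subseteq> I \<longrightarrow> I = colon R J (r [^] n)"
      by (elim bexE imageE) simp
    have "x \<in> colon R J (r [^] Suc n)" if "x \<in> colon R J (r [^] n)" for x
    proof -
      have "x \<in> carrier R" "x \<otimes> r [^] n \<in> J" using that by (auto simp: colon_def)
      then show ?thesis
        using rR J.I_r_closed[of "x \<otimes> r [^] n" r] by (simp add: colon_def m_assoc)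
    qed
    then have sub: "colon R J (r [^] n) \<subseteq> colon R J (r [^] Suc n)" by blast
    have eq: "colon R J (r [^] Suc n) = colon R J (r [^] n)"
      by (rule bspec[OF n, THEN mp, OF rangeI sub])
    have rn: "r [^] n \<in> carrier R" using rR by simp
    let ?I = "adjoin R J (r [^] n)"
    have I: "ideal ?I R" "J \<subseteq> ?I" "r [^] n \<in> ?I"
      using P.adjoin_ideal[OF J(1) rn] P.subset_adjoin[OF J(1) rn] P.mem_adjoin[OF J(1) rn] .
    have "colon R ?I a \<subseteq> P"
    proof
      fix s assume "s \<in> colon R ?I a"
      then obtain j y where s: "s \<in> carrier R" "s \<otimes> a = j \<oplus> y \<otimes> r [^] n" "j \<in> J" "y \<in> carrier R"
        by (auto simp: colon_def adjoin_def)
      have jR: "j \<in> carrier R" using s(3) J.Icarr by simp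
      \<comment> \<open>Multiplying \<open>s a = j + y r^n\<close> by \<open>r\<close> brings in
        \<open>r a\<close>, which lies in \<open>J\<close>. Hence \<open>y r^(n+1) \<in> J\<close>,
        and by the choice of \<open>n\<close> already \<open>y r^n \<in> J\<close>.\<close>
      have "y \<otimes> r [^] Suc n = s \<otimes> (r \<otimes> a) \<ominus> r \<otimes> j"
      proof -
        have "s \<otimes> (r \<otimes> a) = r \<otimes> (s \<otimes> a)" using s(1) rR a by (rule P.m_lcomm)
        also have "\<dots> = r \<otimes> j \<oplus> y \<otimes> r [^] Suc n"
          unfolding s(2) using s(4) jR rR rn by (simp add: r_distr P.m_ac)
        finally have eq: "s \<otimes> (r \<otimes> a) = r \<otimes> j \<oplus> y \<otimes> r [^] Suc n" .
        have "Y = A \<oplus> Y \<ominus> A" if "A \<in> carrier R" "Y \<in> carrier R" for A Y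
          using that by algebra
        then show ?thesis unfolding eq using s(4) jR rR by simp
      qed
      also have "\<dots> \<in> J"
        using J.I_l_closed[OF ra s(1)] J.I_l_closed[OF s(3) rR]
        by (simp add: a_minus_def J.a_closed J.a_inv_closed)
      finally have "y \<in> colon R J (r [^] n)" using eq s(4) by (auto simp: colon_def)
      then have "s \<otimes> a \<in> J" using s(2,3) J.a_closed by (simp add: colon_def)
      then show "s \<in> P" using J(3) s(1) by (auto simp: colon_def)
    qed
    then have "good ?I" using I J(2) by (auto simp: good_def)
    then show ?thesis using max[of ?I] I by blast
  qed
  then show ?thesis using J by blast
qed

lemma (in noetherian_ring) exists_socle_ideal:
  assumes "primeideal P R" and a: "a \<in> carrier R" and b: "b \<in> nonzerodivisors R"
    and P: "\<And>r. r \<in> carrier R \<Longrightarrow> r \<in> P \<longleftrightarrow> (\<exists>y\<in>carrier R. r \<otimes> a = y \<otimes> b)"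
  shows "\<exists>J. socle_ideal R P a b J"
proof -
  interpret P: primeideal P R by fact
  have bR: "b \<in> carrier R" using b by (simp add: nonzerodivisors_def)
  have soc: "\<exists>y\<in>carrier R. r \<otimes> a = y \<otimes> b" if "r \<in> P" for r
    using P[OF P.Icarr[OF that]] that by simp
  have mem: "\<forall>r\<in>P. r \<otimes> a \<in> PIdl b"
  proof
    fix r assume "r \<in> P"
    then show "r \<otimes> a \<in> PIdl b" using soc[of r] by (auto simp: cgenideal_def)
  qed
  have "colon R (PIdl b) a \<subseteq> P"
  proof
    fix r assume "r \<in> colon R (PIdl b) a"
    then have "r \<in> carrier R" "\<exists>y\<in>carrier R. r \<otimes> a = y \<otimes> b"
      by (auto simp: colon_def cgenideal_def)
    then show "r \<in> P" using P by blast
  qed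
  from exists_nil_ideal[OF assms(1) a P.cgenideal_ideal[OF bR] mem this]
  obtain J where J: "ideal J R" "PIdl b \<subseteq> J" "colon R J a \<subseteq> P"
    "\<forall>r\<in>P. \<exists>n::nat. r [^] n \<in> J" by (elim exE conjE)
  have bJ: "b \<in> J" using J(2) cgenideal_self[OF bR] by blast
  have "socle_ideal R P a b J"
    by (intro socle_ideal.intro socle_ideal_axioms.intro noetherian_ring_axioms assms(1) a b J(1,3) bJ soc)
      (assumption, erule bspec[OF J(4)])
  then show ?thesis by blast
qed

text \<open>Nakayama's lemma at \<open>P\<close>, with \<open>t\<close> clearing the denominators.
  Generators are eliminated one at a time instead of forming a determinant: the relation for
  \<open>y\<close> has a coefficient \<open>s - p\<close> outside \<open>P\<close>, so it expresses
  a multiple of \<open>y\<close> by the other generators with coefficients in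
  \<open>P\<close>.\<close>

lemma (in module) prime_nakayama:
  assumes P: "primeideal P R" and Y: "finite Y" "Y \<subseteq> carrier M"
    and s: "\<And>y. y \<in> Y \<Longrightarrow> \<exists>s\<in>carrier R - P. s \<odot>\<^bsub>M\<^esub> y \<in> ideal_span M P Y"
  shows "\<exists>t\<in>carrier R - P. \<forall>y\<in>Y. t \<odot>\<^bsub>M\<^esub> y = \<zero>\<^bsub>M\<^esub>"
  using Y s
proof (induction Y)
  case empty
  interpret P: primeideal P R by fact
  show ?case using P.one_imp_carrier P.I_notcarr by blast
next
  case (insert y Y)
  interpret P: primeideal P R by fact
  have PR: "P \<subseteq> carrier R" using P.Icarr by auto
  have Y: "Y \<subseteq> carrier M" "y \<in> carrier M" using insert.prems by auto
  have Padd: "p \<oplus>\<^bsub>R\<^esub> q \<in> P" if "p \<in> P" "q \<in> P" for p q using that by (rule P.a_closed)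
  have split: "\<exists>p\<in>P. \<exists>w\<in>ideal_span M P Y. z = p \<odot>\<^bsub>M\<^esub> y \<oplus>\<^bsub>M\<^esub> w"
    if "z \<in> ideal_span M P (Set.insert y Y)" for z
    using that
  proof induction
    case null
    show ?case using Y P.zero_closed
      by (intro bexI[of _ "\<zero>\<^bsub>R\<^esub>"] bexI[of _ "\<zero>\<^bsub>M\<^esub>"]) (auto simp: ideal_span_null)
  next
    case (step q x z)
    from step(4) obtain p w
      where pw: "p \<in> P" "w \<in> ideal_span M P Y" "z = p \<odot>\<^bsub>M\<^esub> y \<oplus>\<^bsub>M\<^esub> w" by (elim bexE)
    have car: "p \<in> carrier R" "q \<in> carrier R" "w \<in> carrier M" "x \<in> carrier M"
      using pw step PR Y ideal_span_closed[OF PR Y(1)] by auto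
    show ?case
    proof (cases "x = y")
      case True
      have "q \<odot>\<^bsub>M\<^esub> x \<oplus>\<^bsub>M\<^esub> z = (q \<oplus>\<^bsub>R\<^esub> p) \<odot>\<^bsub>M\<^esub> y \<oplus>\<^bsub>M\<^esub> w"
          using car Y by (simp add: pw(3) True smult_l_distr M.a_assoc)
      then show ?thesis using pw(2) Padd[OF step(1) pw(1)] by (intro bexI)
    next
      case False
      then have "x \<in> Y" using step by simp
      then have "q \<odot>\<^bsub>M\<^esub> x \<oplus>\<^bsub>M\<^esub> w \<in> ideal_span M P Y" using step(1) pw(2) by (intro ideal_span_step)
      moreover have "q \<odot>\<^bsub>M\<^esub> x \<oplus>\<^bsub>M\<^esub> z = p \<odot>\<^bsub>M\<^esub> y \<oplus>\<^bsub>M\<^esub> (q \<odot>\<^bsub>M\<^esub> x \<oplus>\<^bsub>M\<^esub> w)"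
        using car Y by (simp add: pw(3) M.a_lcomm)
      ultimately show ?thesis using pw(1) by (intro bexI)
    qed
  qed
  obtain s where s: "s \<in> carrier R - P" "s \<odot>\<^bsub>M\<^esub> y \<in> ideal_span M P (Set.insert y Y)"
    using insert.prems(2)[OF insertI1] by blast
  obtain p z where pz: "p \<in> P" "z \<in> ideal_span M P Y" "s \<odot>\<^bsub>M\<^esub> y = p \<odot>\<^bsub>M\<^esub> y \<oplus>\<^bsub>M\<^esub> z"
    using split[OF s(2)] by (elim bexE)
  let ?c = "s \<ominus>\<^bsub>R\<^esub> p"
  have car: "s \<in> carrier R" "p \<in> carrier R" "z \<in> carrier M" "?c \<in> carrier R"
    using s pz PR ideal_span_closed[OF PR Y(1)] by auto
  have "?c \<notin> P"
  proof
    assume "?c \<in> P"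
    then have "?c \<oplus>\<^bsub>R\<^esub> p \<in> P" using pz(1) by (rule Padd)
    moreover have "?c \<oplus>\<^bsub>R\<^esub> p = s" using car(1,2) by algebra
    ultimately show False using s by simp
  qed
  then have c: "?c \<in> carrier R - P" using car by simp
  have "?c \<odot>\<^bsub>M\<^esub> y = s \<odot>\<^bsub>M\<^esub> y \<ominus>\<^bsub>M\<^esub> p \<odot>\<^bsub>M\<^esub> y"
    using car Y by (simp add: a_minus_def smult_l_distr smult_l_minus)
  then have cy: "?c \<odot>\<^bsub>M\<^esub> y = z"
    using car Y by (simp add: pz(3) a_minus_def M.a_comm[of _ z] M.a_assoc M.r_neg)
  \<comment> \<open>Multiplying the relation for \<open>x\<close> by \<open>?c\<close> replaces its
    term in \<open>y\<close> by \<open>q z\<close>, so the remaining generators satisfy the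
    hypothesis by themselves.\<close>
  have "\<exists>s\<in>carrier R - P. s \<odot>\<^bsub>M\<^esub> x \<in> ideal_span M P Y" if x: "x \<in> Y" for x
  proof -
    obtain u where u: "u \<in> carrier R - P" "u \<odot>\<^bsub>M\<^esub> x \<in> ideal_span M P (Set.insert y Y)"
      using insert.prems(2)[OF insertI2[OF x]] by blast
    obtain q w where qw: "q \<in> P" "w \<in> ideal_span M P Y" "u \<odot>\<^bsub>M\<^esub> x = q \<odot>\<^bsub>M\<^esub> y \<oplus>\<^bsub>M\<^esub> w"
      using split[OF u(2)] by (elim bexE)
    have car': "u \<in> carrier R" "q \<in> carrier R" "w \<in> carrier M" "x \<in> carrier M"
      using u qw PR ideal_span_closed[OF PR Y(1)] x Y by auto
    have "(?c \<otimes>\<^bsub>R\<^esub> u) \<odot>\<^bsub>M\<^esub> x = (?c \<otimes>\<^bsub>R\<^esub> q) \<odot>\<^bsub>M\<^esub> y \<oplus>\<^bsub>M\<^esub> ?c \<odot>\<^bsub>M\<^esub> w"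
      using car' car(4) Y by (simp add: smult_assoc1 qw(3) smult_r_distr)
    also have "(?c \<otimes>\<^bsub>R\<^esub> q) \<odot>\<^bsub>M\<^esub> y = q \<odot>\<^bsub>M\<^esub> z"
      using car' car(4) Y R.m_comm[of ?c q] by (simp add: smult_assoc1 cy)
    also have "q \<odot>\<^bsub>M\<^esub> z \<oplus>\<^bsub>M\<^esub> ?c \<odot>\<^bsub>M\<^esub> w \<in> ideal_span M P Y"
      using car car' pz qw
      by (intro ideal_span_add[OF PR Y(1)] ideal_span_smult[OF P.ideal_axioms Y(1)]) auto
    finally have "(?c \<otimes>\<^bsub>R\<^esub> u) \<odot>\<^bsub>M\<^esub> x \<in> ideal_span M P Y" .
    moreover have "?c \<otimes>\<^bsub>R\<^esub> u \<in> carrier R - P" using P.I_prime[of ?c u] c u by auto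
    ultimately show ?thesis by blast
  qed
  then obtain t where t: "t \<in> carrier R - P" "\<And>x. x \<in> Y \<Longrightarrow> t \<odot>\<^bsub>M\<^esub> x = \<zero>\<^bsub>M\<^esub>"
    using insert.IH[OF Y(1)] by blast
  \<comment> \<open>\<open>t\<close> kills \<open>Y\<close>, hence also \<open>z\<close>, which is
    \<open>?c\<close> times \<open>y\<close>. So the product of \<open>t\<close> and
    \<open>?c\<close> kills \<open>y\<close> too.\<close>
  have "t \<odot>\<^bsub>M\<^esub> z = \<zero>\<^bsub>M\<^esub>"
    using pz(2)
  proof induction
    case null
    show ?case using t by simp
  next
    case (step q x w)
    have car': "q \<in> carrier R" "w \<in> carrier M" "x \<in> carrier M" "t \<in> carrier R"
      using step PR ideal_span_closed[OF PR Y(1)] Y t by auto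
    have "t \<odot>\<^bsub>M\<^esub> (q \<odot>\<^bsub>M\<^esub> x) = q \<odot>\<^bsub>M\<^esub> (t \<odot>\<^bsub>M\<^esub> x)"
      using car' by (simp add: smult_assoc1[symmetric] R.m_comm)
    then show ?case using car' step t by (simp add: smult_r_distr)
  qed
  then have "(t \<otimes>\<^bsub>R\<^esub> ?c) \<odot>\<^bsub>M\<^esub> y = \<zero>\<^bsub>M\<^esub>" using t car Y by (simp add: smult_assoc1 cy)
  moreover have "(t \<otimes>\<^bsub>R\<^esub> ?c) \<odot>\<^bsub>M\<^esub> x = \<zero>\<^bsub>M\<^esub>" if "x \<in> Y" for x
  proof -
    have "x \<in> carrier M" using that Y by auto
    then have "(t \<otimes>\<^bsub>R\<^esub> ?c) \<odot>\<^bsub>M\<^esub> x = ?c \<odot>\<^bsub>M\<^esub> (t \<odot>\<^bsub>M\<^esub> x)"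
      using t car R.m_comm[of t ?c] by (simp add: smult_assoc1)
    then show ?thesis using t(2)[OF that] car by simp
  qed
  moreover have "t \<otimes>\<^bsub>R\<^esub> ?c \<in> carrier R - P" using P.I_prime[of t ?c] c t by auto
  ultimately show ?case by blast
qed


section \<open>Localization\<close>

locale mult_subset = cring R for R (structure) +
  fixes S
  assumes S_carrier: "S \<subseteq> carrier R" and one_S: "\<one> \<in> S"
    and mult_S: "s \<in> S \<Longrightarrow> t \<in> S \<Longrightarrow> s \<otimes> t \<in> S"
begin

lemma S_closed: "s \<in> S \<Longrightarrow> s \<in> carrier R" using S_carrier by auto

lemma equiv_frac_rel: "equiv (carrier R \<times> S) (frac_rel R S)"
proof (rule equivI)
  show "refl_on (carrier R \<times> S) (frac_rel R S)"
    by (auto simp: refl_on_def frac_rel_def intro!: bexI[OF _ one_S] dest: S_closed)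
  show "sym (frac_rel R S)"
  proof (rule symI)
    fix x y assume "(x, y) \<in> frac_rel R S"
    then obtain a s b t u where x: "x = (a, s)" "y = (b, t)" "a \<in> carrier R" "b \<in> carrier R"
      "s \<in> S" "t \<in> S" "u \<in> S" "u \<otimes> (t \<otimes> a \<ominus> s \<otimes> b) = \<zero>" by (auto simp: frac_rel_def)
    have c: "s \<in> carrier R" "t \<in> carrier R" "u \<in> carrier R" using x S_closed by auto
    have "u \<otimes> (s \<otimes> b \<ominus> t \<otimes> a) = \<ominus> (u \<otimes> (t \<otimes> a \<ominus> s \<otimes> b))" using x(3,4) c by algebra
    then have "u \<otimes> (s \<otimes> b \<ominus> t \<otimes> a) = \<zero>" using x(8) by simp
    then show "(y, x) \<in> frac_rel R S" using x by (auto simp: frac_rel_def)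
  qed
  show "trans (frac_rel R S)"
  proof (rule transI)
    fix x y z assume "(x, y) \<in> frac_rel R S" "(y, z) \<in> frac_rel R S"
    then obtain a s b t u c r v where x: "x = (a, s)" "y = (b, t)" "z = (c, r)"
      "a \<in> carrier R" "b \<in> carrier R" "c \<in> carrier R"
      "s \<in> S" "t \<in> S" "r \<in> S" "u \<in> S" "v \<in> S"
      "u \<otimes> (t \<otimes> a \<ominus> s \<otimes> b) = \<zero>" "v \<otimes> (r \<otimes> b \<ominus> t \<otimes> c) = \<zero>"
      by (auto simp: frac_rel_def)
    have car: "s \<in> carrier R" "t \<in> carrier R" "u \<in> carrier R" "r \<in> carrier R" "v \<in> carrier R"
      using x S_closed by auto
    \<comment> \<open>The middle denominator \<open>t\<close> joins the multipliers \<open>u\<close>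
      and \<open>v\<close>: it may be a zero divisor, so it cannot simply be cancelled.\<close>
    have "(u \<otimes> v \<otimes> t) \<otimes> (r \<otimes> a \<ominus> s \<otimes> c) =
      (v \<otimes> r) \<otimes> (u \<otimes> (t \<otimes> a \<ominus> s \<otimes> b)) \<oplus> (u \<otimes> s) \<otimes> (v \<otimes> (r \<otimes> b \<ominus> t \<otimes> c))"
      using x(4-6) car by algebra
    also have "\<dots> = \<zero>" using x car by simp
    finally have "(u \<otimes> v \<otimes> t) \<otimes> (r \<otimes> a \<ominus> s \<otimes> c) = \<zero>" .
    moreover have "u \<otimes> v \<otimes> t \<in> S" using x mult_S by simp
    ultimately show "(x, z) \<in> frac_rel R S" using x by (auto simp: frac_rel_def)
  qed
  show "frac_rel R S \<subseteq> (carrier R \<times> S) \<times> (carrier R \<times> S)" by (auto simp: frac_rel_def)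
qed

lemma fraction_eq_iff:
  assumes "a \<in> carrier R" "s \<in> S" "b \<in> carrier R" "t \<in> S"
  shows "fraction R S a s = fraction R S b t \<longleftrightarrow> (\<exists>u\<in>S. u \<otimes> (t \<otimes> a) = u \<otimes> (s \<otimes> b))"
proof -
  have "fraction R S a s = fraction R S b t \<longleftrightarrow> ((a, s), (b, t)) \<in> frac_rel R S"
    unfolding fraction_def by (rule eq_equiv_class_iff[OF equiv_frac_rel]) (use assms in auto)
  also have "\<dots> \<longleftrightarrow> (\<exists>u\<in>S. u \<otimes> (t \<otimes> a \<ominus> s \<otimes> b) = \<zero>)"
    using assms by (auto simp: frac_rel_def)
  also have "\<dots> \<longleftrightarrow> (\<exists>u\<in>S. u \<otimes> (t \<otimes> a) = u \<otimes> (s \<otimes> b))"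
  proof (rule bex_cong[OF refl])
    fix u assume u: "u \<in> S"
    have c: "s \<in> carrier R" "t \<in> carrier R" "u \<in> carrier R" using assms u S_closed by auto
    have "u \<otimes> (t \<otimes> a \<ominus> s \<otimes> b) = u \<otimes> (t \<otimes> a) \<ominus> u \<otimes> (s \<otimes> b)"
      using assms(1,3) c by algebra
    then show "u \<otimes> (t \<otimes> a \<ominus> s \<otimes> b) = \<zero> \<longleftrightarrow> u \<otimes> (t \<otimes> a) = u \<otimes> (s \<otimes> b)"
      using assms(1,3) c by (simp add: r_right_minus_eq)
  qed
  finally show ?thesis .
qed

lemma fraction_eqI:
  assumes "a \<in> carrier R" "s \<in> S" "b \<in> carrier R" "t \<in> S" "t \<otimes> a = s \<otimes> b"
  shows "fraction R S a s = fraction R S b t"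
  using assms one_S by (subst fraction_eq_iff) auto

abbreviation L where "L \<equiv> localization R S"

lemma fraction_closed [simp]:
  "a \<in> carrier R \<Longrightarrow> s \<in> S \<Longrightarrow> fraction R S a s \<in> carrier L"
  by (auto simp: localization_def fraction_def intro: quotientI)

lemma fraction_cases:
  assumes "x \<in> carrier L"
  obtains a s where "a \<in> carrier R" "s \<in> S" "x = fraction R S a s"
  using assms by (auto simp: localization_def fraction_def elim!: quotientE)

lemma fraction_mult:
  assumes "a \<in> carrier R" "s \<in> S" "b \<in> carrier R" "t \<in> S"
  shows "fraction R S a s \<otimes>\<^bsub>L\<^esub> fraction R S b t = fraction R S (a \<otimes> b) (s \<otimes> t)"
proof -
  define f where "f x y = fraction R S (fst x \<otimes> fst y) (snd x \<otimes> snd y)" for x y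
  \<comment> \<open>Commutativity reduces the independence of representatives to one of the two
    arguments.\<close>
  have "congruent2 (frac_rel R S) (frac_rel R S) f"
  proof (rule congruent2_commuteI[OF equiv_frac_rel])
    fix y z assume "y \<in> carrier R \<times> S" "z \<in> carrier R \<times> S"
    then show "f y z = f z y" by (auto simp: f_def m_comm S_closed)
  next
    fix y z w assume "(y, z) \<in> frac_rel R S" and w: "w \<in> carrier R \<times> S"
    then obtain a s b t where yz: "y = (a, s)" "z = (b, t)" "a \<in> carrier R" "b \<in> carrier R"
      "s \<in> S" "t \<in> S" "fraction R S a s = fraction R S b t"
      using eq_equiv_class_iff[OF equiv_frac_rel, of y z]
      by (cases y, cases z) (auto simp: frac_rel_def fraction_def)
    then obtain u where u: "u \<in> S" "u \<otimes> (t \<otimes> a) = u \<otimes> (s \<otimes> b)"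
      using fraction_eq_iff by blast
    obtain c r where w: "w = (c, r)" "c \<in> carrier R" "r \<in> S" using w by auto
    have car: "s \<in> carrier R" "t \<in> carrier R" "u \<in> carrier R" "r \<in> carrier R"
      using yz u w S_closed by auto
    have "u \<otimes> ((r \<otimes> t) \<otimes> (c \<otimes> a)) = (r \<otimes> c) \<otimes> (u \<otimes> (t \<otimes> a))"
      using yz(3,4) w(2) car by algebra
    also have "\<dots> = u \<otimes> ((r \<otimes> s) \<otimes> (c \<otimes> b))"
      unfolding u(2) using yz(3,4) w(2) car by algebra
    finally show "f w y = f w z"
      using yz w u(1) by (auto simp: f_def fraction_eq_iff mult_S)
  qed
  from UN_equiv_class2[OF equiv_frac_rel equiv_frac_rel this, of "(a, s)" "(b, t)"] assms
  show ?thesis by (simp add: localization_def fraction_def f_def)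
qed

lemma fraction_add:
  assumes "a \<in> carrier R" "s \<in> S" "b \<in> carrier R" "t \<in> S"
  shows "fraction R S a s \<oplus>\<^bsub>L\<^esub> fraction R S b t = fraction R S (t \<otimes> a \<oplus> s \<otimes> b) (s \<otimes> t)"
proof -
  define f where "f x y = fraction R S (snd y \<otimes> fst x \<oplus> snd x \<otimes> fst y) (snd x \<otimes> snd y)" for x y
  have "congruent2 (frac_rel R S) (frac_rel R S) f"
  proof (rule congruent2_commuteI[OF equiv_frac_rel])
    fix y z assume "y \<in> carrier R \<times> S" "z \<in> carrier R \<times> S"
    then show "f y z = f z y" by (auto simp: f_def m_comm a_comm S_closed)
  next
    fix y z w assume "(y, z) \<in> frac_rel R S" and w: "w \<in> carrier R \<times> S"
    then obtain a s b t where yz: "y = (a, s)" "z = (b, t)" "a \<in> carrier R" "b \<in> carrier R"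
      "s \<in> S" "t \<in> S" "fraction R S a s = fraction R S b t"
      using eq_equiv_class_iff[OF equiv_frac_rel, of y z]
      by (cases y, cases z) (auto simp: frac_rel_def fraction_def)
    then obtain u where u: "u \<in> S" "u \<otimes> (t \<otimes> a) = u \<otimes> (s \<otimes> b)"
      using fraction_eq_iff by blast
    obtain c r where w: "w = (c, r)" "c \<in> carrier R" "r \<in> S" using w by auto
    have car: "s \<in> carrier R" "t \<in> carrier R" "u \<in> carrier R" "r \<in> carrier R"
      using yz u w S_closed by auto
    have "u \<otimes> ((r \<otimes> t) \<otimes> (s \<otimes> c \<oplus> r \<otimes> a)) =
        u \<otimes> (r \<otimes> t \<otimes> s \<otimes> c) \<oplus> (r \<otimes> r) \<otimes> (u \<otimes> (t \<otimes> a))"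
      using yz(3,4) w(2) car by algebra
    also have "\<dots> = u \<otimes> ((r \<otimes> s) \<otimes> (t \<otimes> c \<oplus> r \<otimes> b))"
      unfolding u(2) using yz(3,4) w(2) car by algebra
    finally show "f w y = f w z"
      using yz w u(1) by (auto simp: f_def fraction_eq_iff mult_S S_closed)
  qed
  from UN_equiv_class2[OF equiv_frac_rel equiv_frac_rel this, of "(a, s)" "(b, t)"] assms
  show ?thesis by (simp add: localization_def fraction_def f_def)
qed

lemma localization_zero: "\<zero>\<^bsub>L\<^esub> = fraction R S \<zero> \<one>"
  and localization_one: "\<one>\<^bsub>L\<^esub> = fraction R S \<one> \<one>"
  by (simp_all add: localization_def)

lemma cring_localization: "cring L"
proof (rule cringI)
  show "abelian_group L"
  proof (rule abelian_groupI)
    fix x y assume x: "x \<in> carrier L" and y: "y \<in> carrier L"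
    obtain a s where a: "a \<in> carrier R" "s \<in> S" "x = fraction R S a s" by (rule fraction_cases[OF x])
    obtain b t where b: "b \<in> carrier R" "t \<in> S" "y = fraction R S b t" by (rule fraction_cases[OF y])
    show "x \<oplus>\<^bsub>L\<^esub> y \<in> carrier L" using a b by (simp add: fraction_add mult_S S_closed)
    show "x \<oplus>\<^bsub>L\<^esub> y = y \<oplus>\<^bsub>L\<^esub> x"
      using a b by (simp add: fraction_add S_closed m_comm a_comm)
    fix z assume z: "z \<in> carrier L"
    obtain c r where c: "c \<in> carrier R" "r \<in> S" "z = fraction R S c r" by (rule fraction_cases[OF z])
    have car: "s \<in> carrier R" "t \<in> carrier R" "r \<in> carrier R" using a b c S_closed by auto
    have "r \<otimes> (t \<otimes> a \<oplus> s \<otimes> b) \<oplus> s \<otimes> t \<otimes> c = t \<otimes> r \<otimes> a \<oplus> s \<otimes> (r \<otimes> b \<oplus> t \<otimes> c)"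
      using a(1) b(1) c(1) car by algebra
    then show "(x \<oplus>\<^bsub>L\<^esub> y) \<oplus>\<^bsub>L\<^esub> z = x \<oplus>\<^bsub>L\<^esub> (y \<oplus>\<^bsub>L\<^esub> z)"
      using a b c car by (simp add: fraction_add mult_S m_assoc)
  next
    show "\<zero>\<^bsub>L\<^esub> \<in> carrier L" by (simp add: localization_zero one_S)
  next
    fix x assume x: "x \<in> carrier L"
    obtain a s where a: "a \<in> carrier R" "s \<in> S" "x = fraction R S a s" by (rule fraction_cases[OF x])
    show "\<zero>\<^bsub>L\<^esub> \<oplus>\<^bsub>L\<^esub> x = x"
      using a by (simp add: localization_zero fraction_add one_S S_closed)
    have s: "s \<in> carrier R" using a S_closed by auto
    have "s \<otimes> \<ominus> a \<oplus> s \<otimes> a = \<zero>" using a(1) s by algebra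
    then have "fraction R S (\<ominus> a) s \<oplus>\<^bsub>L\<^esub> x = \<zero>\<^bsub>L\<^esub>"
      using a s by (simp add: fraction_add localization_zero)
        (rule fraction_eqI, auto simp: one_S mult_S)
    moreover have "fraction R S (\<ominus> a) s \<in> carrier L" using a by simp
    ultimately show "\<exists>y\<in>carrier L. y \<oplus>\<^bsub>L\<^esub> x = \<zero>\<^bsub>L\<^esub>" by blast
  qed
next
  show "Group.comm_monoid L"
  proof (rule comm_monoidI)
    fix x y assume x: "x \<in> carrier L" and y: "y \<in> carrier L"
    obtain a s where a: "a \<in> carrier R" "s \<in> S" "x = fraction R S a s" by (rule fraction_cases[OF x])
    obtain b t where b: "b \<in> carrier R" "t \<in> S" "y = fraction R S b t" by (rule fraction_cases[OF y])
    show "x \<otimes>\<^bsub>L\<^esub> y \<in> carrier L" using a b by (simp add: fraction_mult mult_S)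
    show "x \<otimes>\<^bsub>L\<^esub> y = y \<otimes>\<^bsub>L\<^esub> x" using a b by (simp add: fraction_mult S_closed m_comm)
    fix z assume z: "z \<in> carrier L"
    obtain c r where c: "c \<in> carrier R" "r \<in> S" "z = fraction R S c r" by (rule fraction_cases[OF z])
    show "(x \<otimes>\<^bsub>L\<^esub> y) \<otimes>\<^bsub>L\<^esub> z = x \<otimes>\<^bsub>L\<^esub> (y \<otimes>\<^bsub>L\<^esub> z)"
      using a b c by (simp add: fraction_mult mult_S S_closed m_assoc)
  next
    show "\<one>\<^bsub>L\<^esub> \<in> carrier L" by (simp add: localization_one one_S)
  next
    fix x assume x: "x \<in> carrier L"
    obtain a s where a: "a \<in> carrier R" "s \<in> S" "x = fraction R S a s" by (rule fraction_cases[OF x])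
    show "\<one>\<^bsub>L\<^esub> \<otimes>\<^bsub>L\<^esub> x = x"
      using a by (simp add: localization_one fraction_mult one_S S_closed)
  qed
next
  fix x y z assume x: "x \<in> carrier L" and y: "y \<in> carrier L" and z: "z \<in> carrier L"
  obtain a s where a: "a \<in> carrier R" "s \<in> S" "x = fraction R S a s" by (rule fraction_cases[OF x])
  obtain b t where b: "b \<in> carrier R" "t \<in> S" "y = fraction R S b t" by (rule fraction_cases[OF y])
  obtain c r where c: "c \<in> carrier R" "r \<in> S" "z = fraction R S c r" by (rule fraction_cases[OF z])
  have car: "s \<in> carrier R" "t \<in> carrier R" "r \<in> carrier R" using a b c S_closed by auto
  \<comment> \<open>The two sides arrive with the denominators \<open>s t r\<close> and
    \<open>(s r) (t r)\<close>, so they are compared by cross-multiplication.\<close>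
  have "(s \<otimes> r \<otimes> (t \<otimes> r)) \<otimes> ((t \<otimes> a \<oplus> s \<otimes> b) \<otimes> c) =
      (s \<otimes> t \<otimes> r) \<otimes> (t \<otimes> r \<otimes> (a \<otimes> c) \<oplus> s \<otimes> r \<otimes> (b \<otimes> c))"
    using a(1) b(1) c(1) car by algebra
  then show "(x \<oplus>\<^bsub>L\<^esub> y) \<otimes>\<^bsub>L\<^esub> z = x \<otimes>\<^bsub>L\<^esub> z \<oplus>\<^bsub>L\<^esub> y \<otimes>\<^bsub>L\<^esub> z"
    using a b c car by (simp add: fraction_mult fraction_add mult_S) (rule fraction_eqI, auto simp: mult_S)
qed

lemma fraction_one_hom: "ring_hom_cring R L (\<lambda>r. fraction R S r \<one>)"
proof -
  interpret L: cring L by (rule cring_localization)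
  show ?thesis
    by (intro ring_hom_cring.intro ring_hom_cring_axioms.intro is_cring cring_localization)
      (auto intro!: ring_hom_memI simp: one_S fraction_mult fraction_add localization_one)
qed

end


section \<open>The total ring of fractions\<close>

text \<open>This is an ambient module that shares its operations with the integral closure. Kernels
  and spans are computed in it, so the argument does not depend on integral elements being closed
  under addition.\<close>

definition total_fractions_module :: "('a, 'b) ring_scheme \<Rightarrow> ('a, ('a \<times> 'a) set) module" where
  "total_fractions_module R = integral_closure_module R\<lparr>carrier := carrier (total_fractions R)\<rparr>"

lemma total_fractions_module_simps:
  "carrier (total_fractions_module R) = carrier (total_fractions R)"
  "\<zero>\<^bsub>total_fractions_module R\<^esub> = \<zero>\<^bsub>total_fractions R\<^esub>"
  "x \<oplus>\<^bsub>total_fractions_module R\<^esub> y = x \<oplus>\<^bsub>total_fractions R\<^esub> y"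
  "r \<odot>\<^bsub>total_fractions_module R\<^esub> y = to_total_fractions R r \<otimes>\<^bsub>total_fractions R\<^esub> y"
  by (simp_all add: total_fractions_module_def integral_closure_module_def)

lemma nonzerodivisorsD:
  assumes "b \<in> nonzerodivisors R"
  shows "b \<in> carrier R" "x \<in> carrier R \<Longrightarrow> b \<otimes>\<^bsub>R\<^esub> x = \<zero>\<^bsub>R\<^esub> \<Longrightarrow> x = \<zero>\<^bsub>R\<^esub>"
  using assms by (auto simp: nonzerodivisors_def)

lemma nonzerodivisorsI:
  assumes "b \<in> carrier R" "\<And>x. x \<in> carrier R \<Longrightarrow> b \<otimes>\<^bsub>R\<^esub> x = \<zero>\<^bsub>R\<^esub> \<Longrightarrow> x = \<zero>\<^bsub>R\<^esub>"
  shows "b \<in> nonzerodivisors R"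
  using assms by (auto simp: nonzerodivisors_def)

lemma (in cring) mult_subset_nonzerodivisors: "mult_subset R (nonzerodivisors R)"
proof (rule mult_subset.intro[OF is_cring mult_subset_axioms.intro])
  show "nonzerodivisors R \<subseteq> carrier R" by (rule subsetI) (rule nonzerodivisorsD(1))
  show "\<one> \<in> nonzerodivisors R" by (rule nonzerodivisorsI) auto
  fix s t assume st: "s \<in> nonzerodivisors R" "t \<in> nonzerodivisors R"
  note c = nonzerodivisorsD(1)[OF st(1)] nonzerodivisorsD(1)[OF st(2)]
  show "s \<otimes> t \<in> nonzerodivisors R"
  proof (rule nonzerodivisorsI)
    show "s \<otimes> t \<in> carrier R" using c by simp
    fix x assume x: "x \<in> carrier R" "s \<otimes> t \<otimes> x = \<zero>"
    then have "s \<otimes> (t \<otimes> x) = \<zero>" using c by (simp add: m_assoc)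
    then have "t \<otimes> x = \<zero>" using nonzerodivisorsD(2)[OF st(1) m_closed[OF c(2) x(1)]] by simp
    then show "x = \<zero>" using nonzerodivisorsD(2)[OF st(2) x(1)] by simp
  qed
qed

lemma (in cring) nonzerodivisors_pow:
  assumes "b \<in> nonzerodivisors R"
  shows "b [^] (n::nat) \<in> nonzerodivisors R"
proof -
  interpret N: mult_subset R "nonzerodivisors R" by (rule mult_subset_nonzerodivisors)
  show ?thesis by (induction n) (simp_all add: N.one_S N.mult_S assms)
qed

context cring
begin

abbreviation (input) Q where "Q \<equiv> total_fractions R"
abbreviation (input) \<tau> where "\<tau> \<equiv> to_total_fractions R"

lemma cring_total_fractions: "cring Q"
  unfolding total_fractions_def
  by (rule mult_subset.cring_localization[OF mult_subset_nonzerodivisors])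

lemma total_fractions_hom: "ring_hom_cring R Q \<tau>"
  unfolding total_fractions_def to_total_fractions_def
  by (rule mult_subset.fraction_one_hom[OF mult_subset_nonzerodivisors])

lemma nonzerodivisor_cancel:
  assumes "b \<in> nonzerodivisors R" "x \<in> carrier R" "y \<in> carrier R" "b \<otimes> x = b \<otimes> y"
  shows "x = y"
proof -
  have b: "b \<in> carrier R" using assms(1) by (rule nonzerodivisorsD(1))
  have "b \<otimes> (x \<ominus> y) = b \<otimes> x \<ominus> b \<otimes> y" using assms(2,3) b by algebra
  then have "b \<otimes> (x \<ominus> y) = \<zero>" using assms b by (simp add: r_right_minus_eq)
  then have "x \<ominus> y = \<zero>" using nonzerodivisorsD(2)[OF assms(1) minus_closed[OF assms(2,3)]] by simp
  then show ?thesis using assms by (simp add: r_right_minus_eq)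
qed

lemma to_total_fractions_inj: "inj_on \<tau> (carrier R)"
proof (rule inj_onI)
  interpret N: mult_subset R "nonzerodivisors R" by (rule mult_subset_nonzerodivisors)
  fix x y assume "x \<in> carrier R" "y \<in> carrier R" "\<tau> x = \<tau> y"
  then show "x = y"
    using N.one_S nonzerodivisor_cancel[of _ x y]
    by (auto simp: to_total_fractions_def N.fraction_eq_iff)
qed

lemma total_fractions_cases:
  assumes "x \<in> carrier Q"
  obtains a b where "a \<in> carrier R" "b \<in> nonzerodivisors R" "\<tau> b \<otimes>\<^bsub>Q\<^esub> x = \<tau> a"
    "x = fraction R (nonzerodivisors R) a b"
proof -
  interpret N: mult_subset R "nonzerodivisors R" by (rule mult_subset_nonzerodivisors)
  obtain a b where ab: "a \<in> carrier R" "b \<in> nonzerodivisors R" "x = fraction R (nonzerodivisors R) a b"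
    using N.fraction_cases assms unfolding total_fractions_def by blast
  then have "\<tau> b \<otimes>\<^bsub>Q\<^esub> x = \<tau> a"
    unfolding total_fractions_def to_total_fractions_def
    by (simp add: N.fraction_mult N.one_S N.S_closed) (rule N.fraction_eqI, auto simp: N.one_S N.S_closed)
  then show ?thesis using ab that by blast
qed

lemma total_fractions_regular:
  assumes b: "b \<in> nonzerodivisors R" and x: "x \<in> carrier Q" and eq: "\<tau> b \<otimes>\<^bsub>Q\<^esub> x = \<zero>\<^bsub>Q\<^esub>"
  shows "x = \<zero>\<^bsub>Q\<^esub>"
proof -
  interpret N: mult_subset R "nonzerodivisors R" by (rule mult_subset_nonzerodivisors)
  obtain c s where c: "c \<in> carrier R" "s \<in> nonzerodivisors R" "x = fraction R (nonzerodivisors R) c s"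
    by (rule total_fractions_cases[OF x])
  have bR: "b \<in> carrier R" "s \<in> carrier R" using nonzerodivisorsD(1)[OF b] nonzerodivisorsD(1)[OF c(2)] .
  have "fraction R (nonzerodivisors R) (b \<otimes> c) s = fraction R (nonzerodivisors R) \<zero> \<one>"
    using eq c(1,2) b bR unfolding total_fractions_def to_total_fractions_def c(3)
    by (simp add: N.fraction_mult N.one_S N.localization_zero)
  then obtain u where u: "u \<in> nonzerodivisors R" "u \<otimes> (\<one> \<otimes> (b \<otimes> c)) = u \<otimes> (s \<otimes> \<zero>)"
    using N.fraction_eq_iff[of "b \<otimes> c" s \<zero> \<one>] c(1,2) bR N.one_S by blast
  then have u2: "u \<otimes> (b \<otimes> c) = u \<otimes> \<zero>" using bR c(1) by simp
  then have "b \<otimes> c = \<zero>" 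
    using bR c(1) by (intro nonzerodivisor_cancel[OF u(1) _ _ u2]) auto
  then have "c = \<zero>" using nonzerodivisorsD(2)[OF b c(1)] by simp
  then have "x = fraction R (nonzerodivisors R) \<zero> \<one>"
    unfolding c(3) using c(2) bR by (intro N.fraction_eqI) (auto simp: N.one_S)
  then show ?thesis by (simp add: total_fractions_def N.localization_zero)
qed

lemma total_fractions_cancel:
  assumes "b \<in> nonzerodivisors R" "x \<in> carrier Q" "y \<in> carrier Q" "\<tau> b \<otimes>\<^bsub>Q\<^esub> x = \<tau> b \<otimes>\<^bsub>Q\<^esub> y"
  shows "x = y"
proof -
  interpret h: ring_hom_cring R Q \<tau> by (rule total_fractions_hom)
  have b: "\<tau> b \<in> carrier Q" by (rule h.hom_closed[OF nonzerodivisorsD(1)[OF assms(1)]])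
  have "\<tau> b \<otimes>\<^bsub>Q\<^esub> (x \<ominus>\<^bsub>Q\<^esub> y) = \<tau> b \<otimes>\<^bsub>Q\<^esub> x \<ominus>\<^bsub>Q\<^esub> \<tau> b \<otimes>\<^bsub>Q\<^esub> y"
    using assms(2,3) b by (simp add: a_minus_def h.S.r_distr h.S.r_minus)
  also have "\<dots> = \<zero>\<^bsub>Q\<^esub>" unfolding assms(4) using assms(3) b by simp
  finally have "x \<ominus>\<^bsub>Q\<^esub> y = \<zero>\<^bsub>Q\<^esub>"
    by (rule total_fractions_regular[OF assms(1) h.S.minus_closed[OF assms(2,3)]])
  then show ?thesis using h.S.r_right_minus_eq[OF assms(2,3)] by simp
qed

lemma total_fractions_subring: "subring (\<tau> ` carrier R) Q"
proof -
  interpret h: ring_hom_cring R Q \<tau> by (rule total_fractions_hom)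
  have "ring_hom_ring R Q \<tau>" by (rule ring_hom_ringI2[OF ring_axioms h.S.ring_axioms h.homh])
  from ring_hom_ring.img_is_subring[OF this carrier_is_subring] show ?thesis .
qed

lemma module_total_fractions: "module R (total_fractions_module R)"
proof -
  interpret h: ring_hom_cring R Q \<tau> by (rule total_fractions_hom)
  have "abelian_group (total_fractions_module R)"
  proof (rule abelian_groupI, unfold total_fractions_module_simps)
    fix x assume x: "x \<in> carrier Q"
    show "\<exists>y\<in>carrier Q. y \<oplus>\<^bsub>Q\<^esub> x = \<zero>\<^bsub>Q\<^esub>"
      using h.S.l_neg[OF x] h.S.a_inv_closed[OF x] by (rule bexI)
  qed (simp_all add: h.S.a_assoc h.S.a_comm h.S.a_lcomm)
  then show ?thesis
    by (rule moduleI[OF is_cring])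
      (auto simp: total_fractions_module_simps h.S.l_distr h.S.r_distr h.S.m_assoc)
qed

end


section \<open>Integral closure\<close>

lemma (in cring) eval_mult_power_mem:
  assumes A: "subring A R" and x: "x \<in> carrier R" and g: "g \<in> carrier R" and cs: "set cs \<subseteq> A"
    and pow: "\<And>i. i < length cs \<Longrightarrow> g \<otimes> x [^] (i + j) \<in> A"
  shows "g \<otimes> (eval cs x \<otimes> x [^] (j::nat)) \<in> A"
  using cs pow
proof (induction cs)
  case Nil
  then show ?case using g x subringE(2)[OF A] by simp
next
  case (Cons c cs)
  have AR: "A \<subseteq> carrier R" using subringE(1)[OF A] .
  have c: "c \<in> A" "c \<in> carrier R" "set cs \<subseteq> carrier R" using Cons.prems AR by auto
  have e: "eval cs x \<in> carrier R" using eval_in_carrier c(3) x by blast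
  have "g \<otimes> (eval (c # cs) x \<otimes> x [^] j) =
      c \<otimes> (g \<otimes> x [^] (length cs + j)) \<oplus> g \<otimes> (eval cs x \<otimes> x [^] j)"
    using c(2) e x g by (simp add: l_distr r_distr m_ac nat_pow_mult[symmetric])
  then show ?case
    using Cons.IH Cons.prems subringE(6,7)[OF A] c(1) by simp
qed

text \<open>For \<open>n\<close> the degree of the monic equation, \<open>b^n\<close> is a common
  denominator of all powers of \<open>x\<close>. If \<open>k < n\<close>, there are enough factors
  \<open>b\<close> to turn \<open>x^k\<close> into \<open>(b x)^k\<close>. From degree
  \<open>n\<close> on, the equation rewrites \<open>x^k\<close> in lower powers, which strong
  induction covers.\<close>

lemma (in cring) integral_power_mem:
  assumes A: "subring A R" and x: "x \<in> carrier R" and b: "b \<in> A" "b \<otimes> x \<in> A"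
    and int: "integral_over R A x"
  obtains n where "\<And>k. b [^] (n::nat) \<otimes> x [^] (k::nat) \<in> A"
proof -
  have AR: "A \<subseteq> carrier R" using subringE(1)[OF A] .
  have powA: "y [^] (m::nat) \<in> A" if "y \<in> A" for y m
    using that subringE(3,6)[OF A] by (induction m) auto
  have bR: "b \<in> carrier R" using b AR by auto
  obtain p where p: "set p \<subseteq> A" "p \<noteq> []" "hd p = \<one>" "eval p x = \<zero>"
    using int by (auto simp: integral_over_def)
  then obtain cs where cs: "p = \<one> # cs" by (cases p) auto
  define n where "n = length cs"
  have csA: "set cs \<subseteq> A" using p(1) cs by simp
  have e: "eval cs x \<in> carrier R" using eval_in_carrier[of cs x] csA AR x by blast
  have "x [^] n \<oplus> eval cs x = \<zero>" using p(4) x by (simp add: cs n_def)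
  then have xn: "x [^] n = \<ominus> eval cs x" using minus_equality[of "x [^] n" "eval cs x"] x e by simp
  have "b [^] n \<otimes> x [^] (k::nat) \<in> A" for k
  proof (induction k rule: less_induct)
    case (less k)
    show ?case
    proof (cases "k < n")
      case True
      then have n: "n = (n - k) + k" by simp
      have "b [^] n \<otimes> x [^] k = b [^] (n - k) \<otimes> (b \<otimes> x) [^] k"
        by (subst n) (use x bR in \<open>simp add: nat_pow_mult[symmetric] nat_pow_distrib m_assoc del: le_add_diff_inverse2\<close>)
      then show ?thesis using powA b subringE(6)[OF A] by simp
    next
      case False
      define j where "j = k - n"
      then have k: "k = n + j" using False by simp
      have "b [^] n \<otimes> (eval cs x \<otimes> x [^] j) \<in> A"
        by (rule eval_mult_power_mem[OF A x _ csA]) (use bR less k in \<open>auto simp: n_def\<close>)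
      then have "\<ominus> (b [^] n \<otimes> (eval cs x \<otimes> x [^] j)) \<in> A" using subringE(5)[OF A] by simp
      also have "\<ominus> (b [^] n \<otimes> (eval cs x \<otimes> x [^] j)) = b [^] n \<otimes> x [^] k"
        using x e bR by (simp add: k nat_pow_mult[symmetric] xn l_minus r_minus)
      finally show ?thesis .
    qed
  qed
  then show ?thesis using that by blast
qed

context cring
begin

lemma image_subset_integral_closure: "\<tau> ` carrier R \<subseteq> integral_closure R"
proof
  interpret h: ring_hom_cring R Q \<tau> by (rule total_fractions_hom)
  fix x assume "x \<in> \<tau> ` carrier R"
  then obtain r where r: "r \<in> carrier R" "x = \<tau> r" by blast
  have "h.S.eval [\<one>\<^bsub>Q\<^esub>, \<tau> (\<ominus> r)] x = \<zero>\<^bsub>Q\<^esub>" using r by (simp add: h.S.r_neg)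
  moreover have "\<one>\<^bsub>Q\<^esub> \<in> \<tau> ` carrier R" using h.hom_one one_closed by (metis imageI)
  ultimately have "integral_over Q (\<tau> ` carrier R) x"
    unfolding integral_over_def using r(1)
    by (intro exI[of _ "[\<one>\<^bsub>Q\<^esub>, \<tau> (\<ominus> r)]"]) (simp del: h.hom_a_inv)
  then show "x \<in> integral_closure R" using r by (simp add: integral_closure_def)
qed

lemma integral_closure_denominator:
  assumes "x \<in> integral_closure R"
  shows "\<exists>d\<in>nonzerodivisors R. \<forall>k::nat. \<tau> d \<otimes>\<^bsub>Q\<^esub> x [^]\<^bsub>Q\<^esub> k \<in> \<tau> ` carrier R"
proof -
  interpret h: ring_hom_cring R Q \<tau> by (rule total_fractions_hom)
  interpret N: mult_subset R "nonzerodivisors R" by (rule mult_subset_nonzerodivisors)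
  have x: "x \<in> carrier Q" "integral_over Q (\<tau> ` carrier R) x"
    using assms by (auto simp: integral_closure_def)
  obtain a b where ab: "a \<in> carrier R" "b \<in> nonzerodivisors R" "\<tau> b \<otimes>\<^bsub>Q\<^esub> x = \<tau> a"
    by (rule total_fractions_cases[OF x(1)])
  obtain n where n: "\<And>k. \<tau> b [^]\<^bsub>Q\<^esub> (n::nat) \<otimes>\<^bsub>Q\<^esub> x [^]\<^bsub>Q\<^esub> (k::nat) \<in> \<tau> ` carrier R"
    using h.S.integral_power_mem[OF total_fractions_subring x(1) _ _ x(2), of "\<tau> b"] ab
      nonzerodivisorsD(1)[OF ab(2)] by (metis imageI)
  have "b [^] n \<in> nonzerodivisors R" by (rule nonzerodivisors_pow[OF ab(2)])
  moreover have "\<tau> b [^]\<^bsub>Q\<^esub> n = \<tau> (b [^] n)"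
    using nonzerodivisorsD(1)[OF ab(2)] by (induction n) auto
  ultimately show ?thesis using n by (intro bexI[of _ "b [^] n"]) auto
qed

text \<open>\<open>W\<close> stands for the monomials in the elements of \<open>Y\<close>, so its
  span contains R[Y], and \<open>d\<close> times this span is an ideal inside \<open>R\<close>.
  Integrality enters through a common denominator for the powers of each element; these denominators
  are multiplied over \<open>Y\<close>.\<close>

lemma integral_closure_common_denominator:
  assumes "finite Y" "Y \<subseteq> integral_closure R"
  shows "\<exists>d\<in>nonzerodivisors R. \<exists>W\<subseteq>carrier Q. \<one>\<^bsub>Q\<^esub> \<in> W \<and> (\<forall>x\<in>Y. \<forall>w\<in>W. x \<otimes>\<^bsub>Q\<^esub> w \<in> W) \<and>
    (\<forall>w\<in>W. \<tau> d \<otimes>\<^bsub>Q\<^esub> w \<in> \<tau> ` carrier R)"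
  using assms
proof (induction Y)
  case empty
  interpret h: ring_hom_cring R Q \<tau> by (rule total_fractions_hom)
  interpret N: mult_subset R "nonzerodivisors R" by (rule mult_subset_nonzerodivisors)
  show ?case
    by (intro bexI[OF _ N.one_S] exI[of _ "{\<one>\<^bsub>Q\<^esub>}"]) (auto simp: image_iff intro!: bexI[of _ \<one>])
next
  case (insert y Y)
  interpret h: ring_hom_cring R Q \<tau> by (rule total_fractions_hom)
  interpret N: mult_subset R "nonzerodivisors R" by (rule mult_subset_nonzerodivisors)
  obtain d W where d: "d \<in> nonzerodivisors R" "W \<subseteq> carrier Q" "\<one>\<^bsub>Q\<^esub> \<in> W"
    "\<And>x w. x \<in> Y \<Longrightarrow> w \<in> W \<Longrightarrow> x \<otimes>\<^bsub>Q\<^esub> w \<in> W" "\<And>w. w \<in> W \<Longrightarrow> \<tau> d \<otimes>\<^bsub>Q\<^esub> w \<in> \<tau> ` carrier R"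
    using insert by auto
  obtain c where c: "c \<in> nonzerodivisors R" "\<And>k::nat. \<tau> c \<otimes>\<^bsub>Q\<^esub> y [^]\<^bsub>Q\<^esub> k \<in> \<tau> ` carrier R"
    using integral_closure_denominator[of y] insert.prems by auto
  \<comment> \<open>New monomials are old ones times a power of \<open>y\<close>. As
    \<open>c\<close> clears all powers of \<open>y\<close> and \<open>d\<close> all old monomials,
    \<open>c d\<close> clears the products.\<close>
  let ?W = "{y [^]\<^bsub>Q\<^esub> k \<otimes>\<^bsub>Q\<^esub> w | k w. w \<in> W \<and> k \<in> (UNIV :: nat set)}"
  have cdR: "c \<in> carrier R" "d \<in> carrier R"
    using nonzerodivisorsD(1)[OF c(1)] nonzerodivisorsD(1)[OF d(1)] .
  have car: "y \<in> carrier Q" "\<And>x. x \<in> Y \<Longrightarrow> x \<in> carrier Q" "\<tau> c \<in> carrier Q" "\<tau> d \<in> carrier Q"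
    using insert.prems cdR by (auto simp: integral_closure_def)
  have wQ: "w \<in> carrier Q" if "w \<in> W" for w using that d(2) by auto
  show ?case
  proof (intro bexI[of _ "c \<otimes> d"] exI[of _ ?W] conjI ballI)
    show "?W \<subseteq> carrier Q" using car d(2) by auto
    show "\<one>\<^bsub>Q\<^esub> \<in> ?W" using d(3) by (auto intro!: exI[of _ "0::nat"] exI[of _ "\<one>\<^bsub>Q\<^esub>"])
    show "c \<otimes> d \<in> nonzerodivisors R" using c d N.mult_S by simp
  next
    fix x w assume x: "x \<in> Set.insert y Y" and "w \<in> ?W"
    then obtain k u where w: "w = y [^]\<^bsub>Q\<^esub> (k::nat) \<otimes>\<^bsub>Q\<^esub> u" "u \<in> W" by blast
    have uQ: "u \<in> carrier Q" using w(2) wQ by simp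
    show "x \<otimes>\<^bsub>Q\<^esub> w \<in> ?W"
    proof (cases "x = y")
      case True
      then have "x \<otimes>\<^bsub>Q\<^esub> w = y [^]\<^bsub>Q\<^esub> (Suc k) \<otimes>\<^bsub>Q\<^esub> u"
        using car uQ by (simp add: w(1) h.S.m_ac)
      then show ?thesis using w(2) by blast
    next
      case False
      then have "x \<in> Y" using x by simp
      then have "x \<otimes>\<^bsub>Q\<^esub> u \<in> W" "x \<otimes>\<^bsub>Q\<^esub> w = y [^]\<^bsub>Q\<^esub> k \<otimes>\<^bsub>Q\<^esub> (x \<otimes>\<^bsub>Q\<^esub> u)"
        using d(4) car uQ w(2) by (simp_all add: w(1) h.S.m_lcomm)
      then show ?thesis by blast
    qed
  next
    fix w assume "w \<in> ?W"
    then obtain k u where w: "w = y [^]\<^bsub>Q\<^esub> (k::nat) \<otimes>\<^bsub>Q\<^esub> u" "u \<in> W" by blast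
    have uQ: "u \<in> carrier Q" using w(2) wQ by simp
    have "\<tau> (c \<otimes> d) \<otimes>\<^bsub>Q\<^esub> w = (\<tau> c \<otimes>\<^bsub>Q\<^esub> y [^]\<^bsub>Q\<^esub> k) \<otimes>\<^bsub>Q\<^esub> (\<tau> d \<otimes>\<^bsub>Q\<^esub> u)"
      using car uQ cdR by (simp add: w(1) h.S.m_ac)
    also have "\<dots> \<in> \<tau> ` carrier R"
      using subringE(6)[OF total_fractions_subring c(2) d(5)[OF w(2)]] .
    finally show "\<tau> (c \<otimes> d) \<otimes>\<^bsub>Q\<^esub> w \<in> \<tau> ` carrier R" .
  qed
qed

end

text \<open>Only a finite set \<open>Y\<close> of integral elements is involved, and
  \<open>d\<close> times the span of \<open>W\<close> is an ideal of a Noetherian ring, hence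
  finitely generated. If \<open>s\<close> were outside \<open>P\<close>, multiplication by
  \<open>s\<close> would send this ideal into \<open>P\<close> times itself. By Nakayama some
  \<open>t\<close> outside \<open>P\<close> would kill it, and it contains the regular element
  \<open>d\<close>.\<close>

lemma (in cring) integral_closure_lying_over:
  assumes N: "noetherian_ring R" and P: "primeideal P R" and s: "s \<in> carrier R"
    and mem: "\<tau> s \<in> ideal_span (total_fractions_module R) P (integral_closure R)"
  shows "s \<in> P"
proof (rule ccontr)
  assume sP: "s \<notin> P"
  let ?M = "total_fractions_module R"
  interpret h: ring_hom_cring R Q \<tau> by (rule total_fractions_hom)
  interpret M: module R ?M by (rule module_total_fractions)
  interpret N: noetherian_ring R by fact
  interpret P: primeideal P R by fact
  note simps = total_fractions_module_simps
  have PR: "P \<subseteq> carrier R" using P.Icarr by auto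
  obtain Y where Y: "finite Y" "Y \<subseteq> integral_closure R" "\<tau> s \<in> ideal_span ?M P Y"
    using ideal_span_finite[OF mem] by blast
  have YQ: "Y \<subseteq> carrier Q" using Y(2) by (auto simp: integral_closure_def)
  obtain d W where d: "d \<in> nonzerodivisors R" and W: "W \<subseteq> carrier Q" "\<one>\<^bsub>Q\<^esub> \<in> W"
    "\<forall>x\<in>Y. \<forall>w\<in>W. x \<otimes>\<^bsub>Q\<^esub> w \<in> W" "\<forall>w\<in>W. \<tau> d \<otimes>\<^bsub>Q\<^esub> w \<in> \<tau> ` carrier R"
    using integral_closure_common_denominator[OF Y(1,2)] by (elim bexE exE conjE)
  have dR: "d \<in> carrier R" using nonzerodivisorsD(1)[OF d] .
  \<comment> \<open>\<open>V\<close> spans the ideal of \<open>R\<close>, embedded in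
    \<open>Q\<close>, to which Nakayama is applied. \<open>I\<close> is this ideal itself, as a
    subset of \<open>R\<close>, and \<open>A\<close> a finite set of generators of it.\<close>
  define V where "V = (\<lambda>w. \<tau> d \<otimes>\<^bsub>Q\<^esub> w) ` W"
  have VQ: "V \<subseteq> carrier ?M" using W(1) dR by (auto simp: V_def simps)
  have VR: "V \<subseteq> \<tau> ` carrier R" using W(4) by (auto simp: V_def)
  have preimage: "ideal {r \<in> carrier R. \<tau> r \<in> ideal_span ?M (carrier R) B} R"
    if B: "B \<subseteq> carrier ?M" for B
  proof (rule idealI_cring)
    let ?I = "{r \<in> carrier R. \<tau> r \<in> ideal_span ?M (carrier R) B}"
    show "\<zero> \<in> ?I" using ideal_span_null[of ?M] by (simp add: simps)
    show "x \<oplus> y \<in> ?I" if "x \<in> ?I" "y \<in> ?I" for x y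
      using that M.ideal_span_add[OF subset_refl B, of "\<tau> x" "\<tau> y"] by (simp add: simps)
    show "r \<otimes> x \<in> ?I" if "r \<in> carrier R" "x \<in> ?I" for r x
      using that M.ideal_span_smult[OF oneideal B, of r "\<tau> x"] by (simp add: simps)
  qed auto
  define I where "I = {r \<in> carrier R. \<tau> r \<in> ideal_span ?M (carrier R) V}"
  have "ideal I R" unfolding I_def by (rule preimage[OF VQ])
  then obtain A where A: "A \<subseteq> carrier R" "finite A" "I = Idl A"
    using N.finetely_gen by blast
  have AI: "A \<subseteq> I" using genideal_self[OF A(1)] A(3) by simp
  let ?A = "\<tau> ` A"
  have AQ: "?A \<subseteq> carrier ?M" using A(1) by (auto simp: simps)
  define K where "K = {r \<in> carrier R. \<tau> r \<in> ideal_span ?M (carrier R) ?A}"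
  have "ideal K R" unfolding K_def by (rule preimage[OF AQ])
  moreover have "A \<subseteq> K"
  proof
    fix r assume r: "r \<in> A"
    then have rR: "r \<in> carrier R" using A(1) by auto
    have "\<one> \<odot>\<^bsub>?M\<^esub> \<tau> r \<in> ideal_span ?M (carrier R) ?A"
      using M.ideal_span_gen[OF subset_refl AQ one_closed] r by blast
    then show "r \<in> K" using rR by (simp add: K_def simps)
  qed
  ultimately have IK: "I \<subseteq> K" using genideal_minimal A(3) by simp
  have V_A: "V \<subseteq> ideal_span ?M (carrier R) ?A"
  proof
    fix v assume v: "v \<in> V"
    then obtain r where r: "r \<in> carrier R" "v = \<tau> r" using VR by blast
    have "\<one> \<odot>\<^bsub>?M\<^esub> v \<in> ideal_span ?M (carrier R) V"
      using M.ideal_span_gen[OF subset_refl VQ one_closed v] .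
    then have "r \<in> I" using r by (simp add: I_def simps)
    then show "v \<in> ideal_span ?M (carrier R) ?A" using IK r(2) by (auto simp: K_def)
  qed
  \<comment> \<open>A summand \<open>p x\<close> of \<open>z\<close> sends \<open>d w\<close> to
    \<open>p (d (x w))\<close>, and \<open>x w\<close> is again in \<open>W\<close>. For
    \<open>z = \<tau> s\<close> this says that \<open>s\<close> maps \<open>V\<close> into
    \<open>P\<close> times the span of \<open>V\<close>.\<close>
  have mult: "z \<otimes>\<^bsub>Q\<^esub> (\<tau> d \<otimes>\<^bsub>Q\<^esub> w) \<in> ideal_span ?M P V" if "z \<in> ideal_span ?M P Y" "w \<in> W" for z w
    using that(1)
  proof induction
    case null
    show ?case using that(2) W(1) dR ideal_span_null[of ?M] by (auto simp: simps)
  next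
    case (step p x z)
    have c: "\<tau> p \<in> carrier Q" "x \<in> carrier Q" "w \<in> carrier Q" "z \<in> carrier Q" "\<tau> d \<in> carrier Q"
      using step(1,2) PR YQ that(2) W(1) dR M.ideal_span_closed[OF PR _ step(3)] by (auto simp: simps)
    have "(p \<odot>\<^bsub>?M\<^esub> x \<oplus>\<^bsub>?M\<^esub> z) \<otimes>\<^bsub>Q\<^esub> (\<tau> d \<otimes>\<^bsub>Q\<^esub> w) =
        p \<odot>\<^bsub>?M\<^esub> (\<tau> d \<otimes>\<^bsub>Q\<^esub> (x \<otimes>\<^bsub>Q\<^esub> w)) \<oplus>\<^bsub>?M\<^esub> z \<otimes>\<^bsub>Q\<^esub> (\<tau> d \<otimes>\<^bsub>Q\<^esub> w)"
    proof -
      have "(\<tau> p \<otimes>\<^bsub>Q\<^esub> x) \<otimes>\<^bsub>Q\<^esub> (\<tau> d \<otimes>\<^bsub>Q\<^esub> w) = \<tau> p \<otimes>\<^bsub>Q\<^esub> (\<tau> d \<otimes>\<^bsub>Q\<^esub> (x \<otimes>\<^bsub>Q\<^esub> w))"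
        using c by (simp add: h.S.m_ac)
      then show ?thesis using c by (simp add: simps h.S.l_distr)
    qed
    moreover have "\<tau> d \<otimes>\<^bsub>Q\<^esub> (x \<otimes>\<^bsub>Q\<^esub> w) \<in> V"
      using W(3) step(2) that(2) by (auto simp: V_def)
    ultimately show ?case using ideal_span_step[OF step(1) _ step(4)] by simp
  qed
  have sz: "s \<odot>\<^bsub>?M\<^esub> z \<in> ideal_span ?M P ?A" if "z \<in> ideal_span ?M (carrier R) V" for z
    using that
  proof induction
    case null
    show ?case using s ideal_span_null[of ?M] by (simp add: M.smult_r_null)
  next
    case (step r v z)
    obtain w where w: "w \<in> W" "v = \<tau> d \<otimes>\<^bsub>Q\<^esub> w" using step(2) by (auto simp: V_def)
    have "\<tau> s \<otimes>\<^bsub>Q\<^esub> v \<in> ideal_span ?M P V" unfolding w(2) by (rule mult[OF Y(3) w(1)])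
    then have sv: "s \<odot>\<^bsub>?M\<^esub> v \<in> ideal_span ?M P ?A"
      using M.ideal_span_ideal_span[OF P.ideal_axioms subset_refl AQ V_A] by (simp add: simps)
    have v: "v \<in> carrier ?M" "z \<in> carrier ?M"
      using step(2) VQ M.ideal_span_closed[OF subset_refl VQ step(3)] by auto
    have "s \<odot>\<^bsub>?M\<^esub> (r \<odot>\<^bsub>?M\<^esub> v \<oplus>\<^bsub>?M\<^esub> z) = r \<odot>\<^bsub>?M\<^esub> (s \<odot>\<^bsub>?M\<^esub> v) \<oplus>\<^bsub>?M\<^esub> s \<odot>\<^bsub>?M\<^esub> z"
      using v s step(1) by (simp add: M.smult_r_distr M.smult_assoc1[symmetric] m_comm)
    then show ?case
      using M.ideal_span_add[OF PR AQ M.ideal_span_smult[OF P.ideal_axioms AQ step(1) sv] step(4)] by simp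
  qed
  have "\<exists>t\<in>carrier R - P. t \<odot>\<^bsub>?M\<^esub> y \<in> ideal_span ?M P ?A" if y: "y \<in> ?A" for y
  proof -
    have "y \<in> ideal_span ?M (carrier R) V" using y AI by (auto simp: I_def)
    then have "s \<odot>\<^bsub>?M\<^esub> y \<in> ideal_span ?M P ?A" by (rule sz)
    then show ?thesis using s sP by (intro bexI[of _ s]) simp_all
  qed
  then have "\<exists>t\<in>carrier R - P. \<forall>y\<in>?A. t \<odot>\<^bsub>?M\<^esub> y = \<zero>\<^bsub>?M\<^esub>"
    by (intro M.prime_nakayama[OF P finite_imageI[OF A(2)] AQ])
  then obtain t where t: "t \<in> carrier R - P" "\<forall>y\<in>?A. t \<odot>\<^bsub>?M\<^esub> y = \<zero>\<^bsub>?M\<^esub>" by (elim bexE)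
  have tz: "t \<odot>\<^bsub>?M\<^esub> z = \<zero>\<^bsub>?M\<^esub>" if "z \<in> ideal_span ?M (carrier R) ?A" for z
    using that
  proof induction
    case null
    show ?case using t(1) by (simp add: M.smult_r_null)
  next
    case (step r y z)
    have c: "y \<in> carrier ?M" "z \<in> carrier ?M" "t \<in> carrier R"
      using step(2) AQ M.ideal_span_closed[OF subset_refl AQ step(3)] t(1) by auto
    have "t \<odot>\<^bsub>?M\<^esub> (r \<odot>\<^bsub>?M\<^esub> y \<oplus>\<^bsub>?M\<^esub> z) = r \<odot>\<^bsub>?M\<^esub> (t \<odot>\<^bsub>?M\<^esub> y) \<oplus>\<^bsub>?M\<^esub> t \<odot>\<^bsub>?M\<^esub> z"
      using c step(1) by (simp add: M.smult_r_distr M.smult_assoc1[symmetric] m_comm)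
    then show ?case using t(2) step(1,2,4) by (simp add: M.smult_r_null)
  qed
  have tR: "t \<in> carrier R" "t \<notin> P" using t(1) by simp_all
  \<comment> \<open>The element \<open>1\<close> of \<open>W\<close> puts \<open>d\<close> itself
    into \<open>V\<close>, so \<open>t d = 0\<close>. As \<open>d\<close> is a nonzerodivisor,
    \<open>t = 0\<close>, which lies in \<open>P\<close>.\<close>
  have "\<tau> d \<otimes>\<^bsub>Q\<^esub> \<one>\<^bsub>Q\<^esub> \<in> V" unfolding V_def by (rule imageI[OF W(2)])
  then have "\<tau> d \<in> V" using dR by simp
  then have "\<tau> d \<in> ideal_span ?M (carrier R) ?A" using V_A by (rule subsetD[rotated])
  then have "\<tau> t \<otimes>\<^bsub>Q\<^esub> \<tau> d = \<zero>\<^bsub>Q\<^esub>" using tz[of "\<tau> d"] by (simp add: simps)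
  then have "\<tau> d \<otimes>\<^bsub>Q\<^esub> \<tau> t = \<zero>\<^bsub>Q\<^esub>" using tR(1) dR by (simp add: h.S.m_comm)
  then have "\<tau> t = \<zero>\<^bsub>Q\<^esub>" by (rule total_fractions_regular[OF d h.hom_closed[OF tR(1)]])
  then have "\<tau> t = \<tau> \<zero>" by simp
  then have "t = \<zero>" by (rule inj_onD[OF to_total_fractions_inj _ tR(1) zero_closed])
  then show False using tR(2) P.zero_closed by simp
qed

theorem (in cring) finite_proj_dim_integral_closure:
  assumes N: "noetherian_ring R"
    and pd: "proj_dim TYPE('p) R (integral_closure_module R) < \<infinity>"
  shows "integral_closure R = to_total_fractions R ` carrier R"
proof (rule ccontr)
  assume contra: "\<not> ?thesis"
  interpret N: noetherian_ring R by fact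
  let ?M = "total_fractions_module R"
  interpret h: ring_hom_cring R Q \<tau> by (rule total_fractions_hom)
  interpret M: module R ?M by (rule module_total_fractions)
  note simps = total_fractions_module_simps
  have "{enat n |n. \<exists>(F :: nat \<Rightarrow> ('a, 'p) module) d e.
      projective_resolution R (integral_closure_module R) F d e \<and>
      (\<forall>i>n. carrier (F i) = {\<zero>\<^bsub>F i\<^esub>})} \<noteq> {}"
    (is "?N \<noteq> {}")
  proof
    assume e: "?N = {}"
    show False using pd unfolding proj_dim_def e by (simp add: top_enat_def)
  qed
  then obtain n and F :: "nat \<Rightarrow> ('a, 'p) module" and d e
    where res: "projective_resolution R (integral_closure_module R) F d e"
      and fin: "\<And>i. i > n \<Longrightarrow> carrier (F i) = {\<zero>\<^bsub>F i\<^esub>}" by auto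
  let ?I = "integral_closure_module R"
  from res have Fs: "\<forall>i. projective_module R (F i)" and ds: "\<forall>i. d i \<in> mod_hom R (F (Suc i)) (F i)"
    and eI: "e \<in> mod_hom R (F 0) ?I" and surjI: "e ` carrier (F 0) = carrier ?I"
    and exI: "a_kernel (F 0) ?I e = d 0 ` carrier (F (Suc 0))"
    and exs: "\<forall>i. a_kernel (F (Suc i)) (F i) (d i) = d (Suc i) ` carrier (F (Suc (Suc i)))"
    unfolding projective_resolution_def by - (elim conjE, assumption)+
  note F = spec[OF Fs] and d = spec[OF ds] and ex = spec[OF exs]
  have F0: "module R (F 0)" using F[of 0] by (simp add: projective_module_def)
  have surj: "e ` carrier (F 0) = integral_closure R"
    using surjI by (simp add: integral_closure_module_def)
  \<comment> \<open>The resolution is continued into the whole total ring of fractions, where the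
    module axioms and the regularity of \<open>b\<close> are established; the integral closure
    becomes the image of \<open>e\<close>.\<close>
  have e: "e \<in> mod_hom R (F 0) ?M"
  proof (rule mod_homI)
    show "e x \<in> carrier ?M" if "x \<in> carrier (F 0)" for x
      using mod_homD(1)[OF eI that] by (simp add: simps integral_closure_module_def integral_closure_def)
    show "e (x \<oplus>\<^bsub>F 0\<^esub> y) = e x \<oplus>\<^bsub>?M\<^esub> e y" if "x \<in> carrier (F 0)" "y \<in> carrier (F 0)" for x y
      using mod_homD(2)[OF eI that] by (simp add: simps integral_closure_module_def)
    show "e (r \<odot>\<^bsub>F 0\<^esub> x) = r \<odot>\<^bsub>?M\<^esub> e x" if "r \<in> carrier R" "x \<in> carrier (F 0)" for r x
      using mod_homD(3)[OF eI that] by (simp add: simps integral_closure_module_def)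
  qed
  have "\<zero>\<^bsub>?M\<^esub> = \<zero>\<^bsub>?I\<^esub>" by (simp add: simps integral_closure_module_def)
  then have "a_kernel (F 0) ?M e = a_kernel (F 0) ?I e" by (simp only: a_kernel_def')
  then have ex0: "a_kernel (F 0) ?M e = d 0 ` carrier (F (Suc 0))" using exI by simp
  \<comment> \<open>Stability of the integral closure under scalars is read off the surjection
    \<open>e\<close>, since the image of a linear map is stable under scalars.\<close>
  have scale: "\<tau> r \<otimes>\<^bsub>Q\<^esub> x \<in> integral_closure R"
    if "r \<in> carrier R" "x \<in> integral_closure R" for r x
  proof -
    from that(2) obtain f where f: "f \<in> carrier (F 0)" "x = e f"
      unfolding surj[symmetric] by (elim imageE)
    have "e (r \<odot>\<^bsub>F 0\<^esub> f) = \<tau> r \<otimes>\<^bsub>Q\<^esub> x" using mod_homD(3)[OF e that(1) f(1)] f(2) by (simp add: simps)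
    moreover have "e (r \<odot>\<^bsub>F 0\<^esub> f) \<in> e ` carrier (F 0)"
      by (rule imageI[OF module.smult_closed[OF F0 that(1) f(1)]])
    ultimately show ?thesis unfolding surj by simp
  qed
  \<comment> \<open>\<open>D x\<close> is the ideal of denominators of \<open>x\<close>, that is,
    the annihilator of the class of \<open>x\<close> modulo \<open>R\<close>. A maximal one is prime
    for the reason known from associated primes: passing from \<open>x\<close> to \<open>s x\<close>
    with \<open>s\<close> outside \<open>D x\<close> cannot enlarge it.\<close>
  define D where "D x = {r \<in> carrier R. \<tau> r \<otimes>\<^bsub>Q\<^esub> x \<in> \<tau> ` carrier R}" for x
  let ?S = "D ` (integral_closure R - \<tau> ` carrier R)"
  have ICQ: "x \<in> carrier Q" if "x \<in> integral_closure R" for x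
    using that by (simp add: integral_closure_def)
  note sub = subringE[OF total_fractions_subring]
  have D_ideal: "ideal (D x) R" if x: "x \<in> carrier Q" for x
  proof (rule idealI_cring)
    show "D x \<subseteq> carrier R" by (auto simp: D_def)
    show "\<zero> \<in> D x" using x sub(2) by (simp add: D_def)
    show "r \<oplus> s \<in> D x" if rs: "r \<in> D x" "s \<in> D x" for r s
    proof -
      have "r \<in> carrier R" "s \<in> carrier R" using rs by (simp_all add: D_def)
      moreover have "\<tau> r \<otimes>\<^bsub>Q\<^esub> x \<oplus>\<^bsub>Q\<^esub> \<tau> s \<otimes>\<^bsub>Q\<^esub> x \<in> \<tau> ` carrier R"
        by (rule sub(7)) (use rs in \<open>simp_all add: D_def\<close>)
      ultimately show ?thesis using x by (simp add: D_def h.S.l_distr)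
    qed
    show "r \<otimes> s \<in> D x" if r: "r \<in> carrier R" and s: "s \<in> D x" for r s
    proof -
      have "s \<in> carrier R" using s by (simp add: D_def)
      moreover have "\<tau> r \<otimes>\<^bsub>Q\<^esub> (\<tau> s \<otimes>\<^bsub>Q\<^esub> x) \<in> \<tau> ` carrier R"
        by (rule sub(6)) (use r s in \<open>simp_all add: D_def\<close>)
      ultimately show ?thesis using r x by (simp add: D_def h.S.m_assoc)
    qed
  qed
  have "?S \<noteq> {}" using contra image_subset_integral_closure by auto
  moreover have "ideal I R" if "I \<in> ?S" for I using that D_ideal ICQ by auto
  ultimately have "\<exists>K\<in>?S. \<forall>I\<in>?S. K \<subseteq> I \<longrightarrow> I = K" by (rule N.exists_maximal_ideal_in)
  then obtain x where x: "x \<in> integral_closure R" "x \<notin> \<tau> ` carrier R"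
    and max: "\<forall>I\<in>?S. D x \<subseteq> I \<longrightarrow> I = D x" by auto
  have xQ: "x \<in> carrier Q" using x(1) by (rule ICQ)
  let ?P = "D x"
  have P: "primeideal ?P R"
  proof (rule primeidealI[OF D_ideal[OF xQ] is_cring])
    have "\<one> \<notin> ?P" using x(2) xQ by (simp add: D_def)
    then show "carrier R \<noteq> ?P" using one_closed by blast
    fix r s assume r: "r \<in> carrier R" and s: "s \<in> carrier R" and rs: "r \<otimes> s \<in> ?P"
    show "r \<in> ?P \<or> s \<in> ?P"
    proof (rule disjCI)
      assume "s \<notin> ?P"
      then have "\<tau> s \<otimes>\<^bsub>Q\<^esub> x \<in> integral_closure R - \<tau> ` carrier R"
        using s scale[OF s x(1)] by (simp add: D_def)
      then have "D (\<tau> s \<otimes>\<^bsub>Q\<^esub> x) \<in> ?S" by blast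
      moreover have "?P \<subseteq> D (\<tau> s \<otimes>\<^bsub>Q\<^esub> x)"
      proof
        fix q assume q: "q \<in> ?P"
        then have qR: "q \<in> carrier R" "\<tau> q \<otimes>\<^bsub>Q\<^esub> x \<in> \<tau> ` carrier R" by (auto simp: D_def)
        then have "\<tau> q \<otimes>\<^bsub>Q\<^esub> (\<tau> s \<otimes>\<^bsub>Q\<^esub> x) = \<tau> s \<otimes>\<^bsub>Q\<^esub> (\<tau> q \<otimes>\<^bsub>Q\<^esub> x)"
          using s xQ by (simp add: h.S.m_lcomm)
        moreover have "\<tau> s \<otimes>\<^bsub>Q\<^esub> (\<tau> q \<otimes>\<^bsub>Q\<^esub> x) \<in> \<tau> ` carrier R"
          using s by (intro sub(6) qR(2) imageI)
        ultimately show "q \<in> D (\<tau> s \<otimes>\<^bsub>Q\<^esub> x)" using qR(1) by (simp add: D_def)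
      qed
      ultimately have eq: "D (\<tau> s \<otimes>\<^bsub>Q\<^esub> x) = ?P" using max by blast
      have "\<tau> r \<otimes>\<^bsub>Q\<^esub> (\<tau> s \<otimes>\<^bsub>Q\<^esub> x) \<in> \<tau> ` carrier R"
        using rs r s xQ by (simp add: D_def h.S.m_assoc)
      then have "r \<in> D (\<tau> s \<otimes>\<^bsub>Q\<^esub> x)" using r by (simp add: D_def)
      then show "r \<in> ?P" using eq by simp
    qed
  qed
  obtain a b where ab: "a \<in> carrier R" "b \<in> nonzerodivisors R" "\<tau> b \<otimes>\<^bsub>Q\<^esub> x = \<tau> a"
    by (rule total_fractions_cases[OF xQ])
  have bR: "b \<in> carrier R" using nonzerodivisorsD(1)[OF ab(2)] .
  \<comment> \<open>Cancelling the regular element \<open>b\<close> identifies the denominator ideal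
    of \<open>a / b\<close> with the colon ideal of bR by \<open>a\<close>, the form in which the
    construction of \<open>J\<close> takes it.\<close>
  have iff: "r \<in> ?P \<longleftrightarrow> (\<exists>y\<in>carrier R. r \<otimes> a = y \<otimes> b)" if r: "r \<in> carrier R" for r
  proof -
    have *: "\<tau> r \<otimes>\<^bsub>Q\<^esub> x = \<tau> y \<longleftrightarrow> r \<otimes> a = y \<otimes> b" if y: "y \<in> carrier R" for y
    proof -
      have "\<tau> b \<otimes>\<^bsub>Q\<^esub> (\<tau> r \<otimes>\<^bsub>Q\<^esub> x) = \<tau> r \<otimes>\<^bsub>Q\<^esub> (\<tau> b \<otimes>\<^bsub>Q\<^esub> x)"
        using r bR xQ by (simp add: h.S.m_lcomm)
      also have "\<dots> = \<tau> (r \<otimes> a)" using r ab by simp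
      finally have 1: "\<tau> b \<otimes>\<^bsub>Q\<^esub> (\<tau> r \<otimes>\<^bsub>Q\<^esub> x) = \<tau> (r \<otimes> a)" .
      have 2: "\<tau> b \<otimes>\<^bsub>Q\<^esub> \<tau> y = \<tau> (y \<otimes> b)" using y bR by (simp add: h.S.m_comm)
      have "\<tau> r \<otimes>\<^bsub>Q\<^esub> x = \<tau> y \<longleftrightarrow> \<tau> b \<otimes>\<^bsub>Q\<^esub> (\<tau> r \<otimes>\<^bsub>Q\<^esub> x) = \<tau> b \<otimes>\<^bsub>Q\<^esub> \<tau> y"
        using total_fractions_cancel[OF ab(2), of "\<tau> r \<otimes>\<^bsub>Q\<^esub> x" "\<tau> y"] r y xQ by auto
      also have "\<dots> \<longleftrightarrow> r \<otimes> a = y \<otimes> b"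
        unfolding 1 2 using r y ab(1) bR by (intro inj_on_eq_iff[OF to_total_fractions_inj]) auto
      finally show ?thesis .
    qed
    have "r \<in> ?P \<longleftrightarrow> (\<exists>y\<in>carrier R. \<tau> r \<otimes>\<^bsub>Q\<^esub> x = \<tau> y)" using r by (auto simp: D_def)
    then show ?thesis using * by simp
  qed
  obtain J where J: "socle_ideal R ?P a b J"
    using N.exists_socle_ideal[OF P ab(1,2) iff] by blast
  interpret J: socle_ideal R ?P a b J by fact
  have reg: "m = \<zero>\<^bsub>?M\<^esub>" if "m \<in> carrier ?M" "b \<odot>\<^bsub>?M\<^esub> m = \<zero>\<^bsub>?M\<^esub>" for m
    using total_fractions_regular[OF ab(2)] that by (simp add: simps)
  have "\<one>\<^bsub>Q\<^esub> \<in> \<tau> ` carrier R" using sub(3) .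
  then have 1: "\<one>\<^bsub>Q\<^esub> \<in> e ` carrier (F 0)" using image_subset_integral_closure surj by auto
  have "a \<odot>\<^bsub>?M\<^esub> \<one>\<^bsub>Q\<^esub> = b \<odot>\<^bsub>?M\<^esub> x" using ab by (simp add: simps)
  also have "\<dots> \<in> ideal_span ?M J (e ` carrier (F 0))"
    using x(1) ICQ by (intro M.ideal_span_gen[OF J.J_sub _ J.b_mem]) (auto simp: surj simps)
  finally have a1: "a \<odot>\<^bsub>?M\<^esub> \<one>\<^bsub>Q\<^esub> \<in> ideal_span ?M J (e ` carrier (F 0))" .
  have "\<exists>s\<in>carrier R - ?P. s \<odot>\<^bsub>?M\<^esub> \<one>\<^bsub>Q\<^esub> \<in> ideal_span ?M ?P (e ` carrier (F 0))"
  proof (rule J.finite_resolution_embeds[OF F d module_total_fractions e ex0 ex _ _ 1 a1])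
    show "carrier (F i) = {\<zero>\<^bsub>F i\<^esub>}" if "i > n" for i using that by (rule fin)
    show "m = \<zero>\<^bsub>?M\<^esub>" if "m \<in> carrier ?M" "b \<odot>\<^bsub>?M\<^esub> m = \<zero>\<^bsub>?M\<^esub>" for m
      using that by (rule reg)
  qed
  then obtain s where s: "s \<in> carrier R - ?P" "s \<odot>\<^bsub>?M\<^esub> \<one>\<^bsub>Q\<^esub> \<in> ideal_span ?M ?P (e ` carrier (F 0))"
    by (elim bexE)
  from s have "\<tau> s \<in> ideal_span ?M ?P (integral_closure R)" by (simp add: simps surj)
  then have "s \<in> ?P" using s(1) by (intro integral_closure_lying_over[OF N P]) auto
  then show False using s(1) by simp
qed


section \<open>Localizations of normal domains\<close>

text \<open>The value of the polynomial \<open>cs\<close> at the fraction \<open>a / b\<close>, multiplied by \<open>b ^ length cs\<close>.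
  It is an element of the base ring, so equations between fractions can be moved from one ring
  of fractions to another.\<close>

primrec homogeneous_eval :: "('a, 'b) ring_scheme \<Rightarrow> 'a list \<Rightarrow> 'a \<Rightarrow> 'a \<Rightarrow> 'a" where
  "homogeneous_eval R [] a b = \<zero>\<^bsub>R\<^esub>"
| "homogeneous_eval R (c # cs) a b =
     b \<otimes>\<^bsub>R\<^esub> (c \<otimes>\<^bsub>R\<^esub> a [^]\<^bsub>R\<^esub> length cs \<oplus>\<^bsub>R\<^esub> homogeneous_eval R cs a b)"

lemma (in cring) homogeneous_eval_closed:
  "set cs \<subseteq> carrier R \<Longrightarrow> a \<in> carrier R \<Longrightarrow> b \<in> carrier R \<Longrightarrow> homogeneous_eval R cs a b \<in> carrier R"
  by (induction cs) auto

lemma (in ring_hom_cring) hom_nat_pow: "x \<in> carrier R \<Longrightarrow> h (x [^] (n::nat)) = h x [^]\<^bsub>S\<^esub> n"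
  by (induction n) auto

lemma (in ring_hom_cring) eval_fraction:
  assumes a: "a \<in> carrier R" "b \<in> carrier R" and x: "x \<in> carrier S" and eq: "h b \<otimes>\<^bsub>S\<^esub> x = h a"
    and cs: "set cs \<subseteq> carrier R"
  shows "h b [^]\<^bsub>S\<^esub> length cs \<otimes>\<^bsub>S\<^esub> S.eval (map h cs) x = h (homogeneous_eval R cs a b)"
  using cs
proof (induction cs)
  case Nil
  show ?case by simp
next
  case (Cons c cs)
  have c: "c \<in> carrier R" "set cs \<subseteq> carrier R" using Cons.prems by auto
  have hc: "h c \<in> carrier S" "h b \<in> carrier S" using c a by auto
  have e: "S.eval (map h cs) x \<in> carrier S" using c x by (intro S.eval_in_carrier) auto
  have H: "homogeneous_eval R cs a b \<in> carrier R" using R.homogeneous_eval_closed c a by blast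
  have "h b [^]\<^bsub>S\<^esub> length cs \<otimes>\<^bsub>S\<^esub> x [^]\<^bsub>S\<^esub> length cs = h a [^]\<^bsub>S\<^esub> length cs"
    using hc x by (simp add: S.nat_pow_distrib[symmetric] eq)
  then have p: "h b [^]\<^bsub>S\<^esub> length cs \<otimes>\<^bsub>S\<^esub> (h c \<otimes>\<^bsub>S\<^esub> x [^]\<^bsub>S\<^esub> length cs) = h c \<otimes>\<^bsub>S\<^esub> h a [^]\<^bsub>S\<^esub> length cs"
    using hc x S.m_lcomm[of "h b [^]\<^bsub>S\<^esub> length cs" "h c" "x [^]\<^bsub>S\<^esub> length cs"] by simp
  have "h b [^]\<^bsub>S\<^esub> length (c # cs) \<otimes>\<^bsub>S\<^esub> S.eval (map h (c # cs)) x =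
      h b \<otimes>\<^bsub>S\<^esub> (h b [^]\<^bsub>S\<^esub> length cs \<otimes>\<^bsub>S\<^esub> (h c \<otimes>\<^bsub>S\<^esub> x [^]\<^bsub>S\<^esub> length cs \<oplus>\<^bsub>S\<^esub> S.eval (map h cs) x))"
    using hc e x S.m_comm[of "h b" "h b [^]\<^bsub>S\<^esub> length cs"] by (simp add: S.m_assoc[symmetric])
  also have "\<dots> = h b \<otimes>\<^bsub>S\<^esub> (h c \<otimes>\<^bsub>S\<^esub> h a [^]\<^bsub>S\<^esub> length cs \<oplus>\<^bsub>S\<^esub> h (homogeneous_eval R cs a b))"
    using hc e x Cons.IH[OF c(2)] by (simp add: S.r_distr[of _ _ "h b [^]\<^bsub>S\<^esub> length cs"] p)
  also have "\<dots> = h (homogeneous_eval R (c # cs) a b)"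
    using c a H by (simp add: hom_nat_pow)
  finally show ?case .
qed

text \<open>The entry of \<open>cs\<close> at position \<open>i\<close>, counted from 0, is
  multiplied by \<open>c^(k+i)\<close>. The offset \<open>k\<close> is there for the induction. The
  factor \<open>c\<close> on the left raises the exponent on the right from
  \<open>k + length cs - 1\<close>, which would need a subtraction.\<close>

lemma (in cring) eval_rescale:
  assumes A: "subring A R" and c: "c \<in> A" and x: "x \<in> carrier R" and cs: "set cs \<subseteq> A"
  shows "\<exists>ds. set ds \<subseteq> A \<and> length ds = length cs \<and>
    c \<otimes> eval ds (c \<otimes> x) = c [^] (k + length cs) \<otimes> eval cs x"
  using cs
proof (induction cs arbitrary: k)
  case Nil
  have "c \<in> carrier R" using c subringE(1)[OF A] by auto
  then show ?case by (intro exI[of _ "[]"]) simp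
next
  case (Cons d cs)
  have AR: "A \<subseteq> carrier R" using subringE(1)[OF A] .
  have cR: "c \<in> carrier R" "d \<in> carrier R" and d: "d \<in> A" "set cs \<subseteq> A" "set cs \<subseteq> carrier R"
    using c Cons.prems AR by auto
  obtain ds where ds: "set ds \<subseteq> A" "length ds = length cs"
    "c \<otimes> eval ds (c \<otimes> x) = c [^] (Suc k + length cs) \<otimes> eval cs x"
    using Cons.IH[OF d(2), of "Suc k"] by blast
  have pow: "c [^] m \<in> A" for m :: nat
    using c subringE(3,6)[OF A] by (induction m) auto
  have e: "eval cs x \<in> carrier R" "eval ds (c \<otimes> x) \<in> carrier R"
    using x cR d(3) ds(1) AR by (auto intro!: eval_in_carrier)
  have p: "c \<otimes> (d \<otimes> c [^] k \<otimes> (c \<otimes> x) [^] length cs) = c [^] (Suc k + length cs) \<otimes> (d \<otimes> x [^] length cs)"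
    using cR x by (simp add: nat_pow_distrib nat_pow_mult[symmetric] m_ac)
  have "c \<otimes> eval (d \<otimes> c [^] k # ds) (c \<otimes> x) =
      c \<otimes> (d \<otimes> c [^] k \<otimes> (c \<otimes> x) [^] length cs) \<oplus> c \<otimes> eval ds (c \<otimes> x)"
    using cR x e by (simp add: ds(2) r_distr)
  also have "\<dots> = c [^] (Suc k + length cs) \<otimes> (d \<otimes> x [^] length cs \<oplus> eval cs x)"
    unfolding p ds(3) using cR x e by (simp add: r_distr del: nat_pow_Suc)
  also have "\<dots> = c [^] (k + length (d # cs)) \<otimes> eval (d # cs) x" by simp
  finally show ?case
    using ds d pow subringE(6)[OF A] by (intro exI[of _ "d \<otimes> c [^] k # ds"]) simp
qed

text \<open>For an equation of degree \<open>n\<close> with leading coefficient \<open>c\<close>,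
  multiplication by \<open>c^(n-1)\<close> gives a monic equation for \<open>c x\<close>. The
  rescaling is carried out with \<open>c^n\<close>, and \<open>reg\<close> removes the spare factor
  \<open>c\<close>.\<close>

lemma (in cring) integral_over_clear_leading_coeff:
  assumes A: "subring A R" and c: "c \<in> A" and x: "x \<in> carrier R" and cs: "set cs \<subseteq> A"
    and root: "eval (c # cs) x = \<zero>"
    and reg: "\<And>z. z \<in> carrier R \<Longrightarrow> c \<otimes> z = \<zero> \<Longrightarrow> z = \<zero>"
  shows "integral_over R A (c \<otimes> x)"
proof -
  have AR: "A \<subseteq> carrier R" using subringE(1)[OF A] .
  have cR: "c \<in> carrier R" "set cs \<subseteq> carrier R" using c cs AR by auto
  obtain ds where ds: "set ds \<subseteq> A" "length ds = length cs"
    "c \<otimes> eval ds (c \<otimes> x) = c [^] (0 + length cs) \<otimes> eval cs x"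
    using eval_rescale[OF A c x cs, of 0] by blast
  have e: "eval cs x \<in> carrier R" "eval ds (c \<otimes> x) \<in> carrier R"
    using x cR ds(1) AR by (auto intro!: eval_in_carrier)
  have "c \<otimes> eval (\<one> # ds) (c \<otimes> x) = c \<otimes> (c \<otimes> x) [^] length cs \<oplus> c \<otimes> eval ds (c \<otimes> x)"
    using cR x e by (simp add: ds(2) r_distr)
  also have "c \<otimes> (c \<otimes> x) [^] length cs = c [^] length cs \<otimes> (c \<otimes> x [^] length cs)"
    using cR x by (simp add: nat_pow_distrib m_ac)
  also have "\<dots> \<oplus> c \<otimes> eval ds (c \<otimes> x) = c [^] length cs \<otimes> eval (c # cs) x"
    unfolding ds(3) using cR x e by (simp add: r_distr)
  also have "\<dots> = \<zero>" unfolding root using cR by simp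
  finally have 0: "c \<otimes> eval (\<one> # ds) (c \<otimes> x) = \<zero>" .
  have "eval (\<one> # ds) (c \<otimes> x) = \<zero>"
    by (rule reg[OF _ 0]) (use cR x e in simp)
  then show ?thesis
    unfolding integral_over_def using ds(1) subringE(3)[OF A]
    by (intro exI[of _ "\<one> # ds"]) auto
qed

lemma (in cring) eval_smult:
  assumes "c \<in> carrier R" "x \<in> carrier R" "set cs \<subseteq> carrier R"
  shows "eval (map (\<lambda>d. c \<otimes> d) cs) x = c \<otimes> eval cs x"
  using assms(3)
proof (induction cs)
  case Nil
  show ?case using assms by simp
next
  case (Cons d cs)
  have "eval cs x \<in> carrier R" using Cons.prems assms by (intro eval_in_carrier) auto
  then show ?case using Cons assms by (simp add: r_distr m_assoc)
qed

lemma (in mult_subset) common_denominator: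
  assumes "set cs \<subseteq> carrier L"
  shows "\<exists>s\<in>S. \<exists>ds. set ds \<subseteq> carrier R \<and>
    map (\<lambda>c. fraction R S s \<one> \<otimes>\<^bsub>L\<^esub> c) cs = map (\<lambda>r. fraction R S r \<one>) ds"
  using assms
proof (induction cs)
  case Nil
  show ?case by (intro bexI[OF _ one_S] exI[of _ "[]"]) simp
next
  case (Cons c cs)
  then obtain s ds where s: "s \<in> S" "set ds \<subseteq> carrier R"
    "map (\<lambda>c. fraction R S s \<one> \<otimes>\<^bsub>L\<^esub> c) cs = map (\<lambda>r. fraction R S r \<one>) ds" by auto
  have "c \<in> carrier L" using Cons.prems by simp
  then obtain a t where c: "a \<in> carrier R" "t \<in> S" "c = fraction R S a t" by (rule fraction_cases)
  interpret L: cring L by (rule cring_localization)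
  have sR: "s \<in> carrier R" "t \<in> carrier R" using s c S_closed by auto
  have "fraction R S (s \<otimes> t) \<one> \<otimes>\<^bsub>L\<^esub> c = fraction R S (s \<otimes> a) \<one>"
    using s c sR by (simp add: fraction_mult one_S) (rule fraction_eqI, auto simp: one_S m_ac)
  moreover have "map (\<lambda>c. fraction R S (s \<otimes> t) \<one> \<otimes>\<^bsub>L\<^esub> c) cs = map (\<lambda>r. fraction R S r \<one>) (map (\<lambda>r. t \<otimes> r) ds)"
  proof -
    have st: "fraction R S (s \<otimes> t) \<one> = fraction R S t \<one> \<otimes>\<^bsub>L\<^esub> fraction R S s \<one>"
      using sR by (simp add: fraction_mult one_S m_comm)
    have "fraction R S (s \<otimes> t) \<one> \<otimes>\<^bsub>L\<^esub> c = fraction R S t \<one> \<otimes>\<^bsub>L\<^esub> (fraction R S s \<one> \<otimes>\<^bsub>L\<^esub> c)"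
      if "c \<in> set cs" for c
      unfolding st using that Cons.prems sR by (intro L.m_assoc) (auto simp: one_S)
    then have "map (\<lambda>c. fraction R S (s \<otimes> t) \<one> \<otimes>\<^bsub>L\<^esub> c) cs =
        map (\<lambda>c. fraction R S t \<one> \<otimes>\<^bsub>L\<^esub> c) (map (\<lambda>c. fraction R S s \<one> \<otimes>\<^bsub>L\<^esub> c) cs)" by simp
    also have "\<dots> = map (\<lambda>r. fraction R S t \<one> \<otimes>\<^bsub>L\<^esub> fraction R S r \<one>) ds" by (simp add: s(3))
    also have "\<dots> = map (\<lambda>r. fraction R S r \<one>) (map (\<lambda>r. t \<otimes> r) ds)"
      using s(2) sR by (auto simp: fraction_mult one_S subset_iff)
    finally show ?thesis .
  qed
  ultimately have "map (\<lambda>c. fraction R S (s \<otimes> t) \<one> \<otimes>\<^bsub>L\<^esub> c) (c # cs) =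
      map (\<lambda>r. fraction R S r \<one>) (s \<otimes> a # map (\<lambda>r. t \<otimes> r) ds)" by simp
  moreover have "set (s \<otimes> a # map (\<lambda>r. t \<otimes> r) ds) \<subseteq> carrier R" using s c sR by auto
  ultimately show ?case using mult_S[OF s(1) c(2)] by blast
qed

lemma (in cring) total_fractions_divide:
  assumes a: "a \<in> carrier R" and b: "b \<in> nonzerodivisors R"
  shows "\<exists>x\<in>carrier Q. \<tau> b \<otimes>\<^bsub>Q\<^esub> x = \<tau> a"
proof -
  interpret N: mult_subset R "nonzerodivisors R" by (rule mult_subset_nonzerodivisors)
  have bR: "b \<in> carrier R" using nonzerodivisorsD(1)[OF b] .
  have "\<tau> b \<otimes>\<^bsub>Q\<^esub> fraction R (nonzerodivisors R) a b = \<tau> a"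
    using a b bR unfolding total_fractions_def to_total_fractions_def
    by (simp add: N.fraction_mult N.one_S) (rule N.fraction_eqI, auto simp: N.one_S)
  moreover have "fraction R (nonzerodivisors R) a b \<in> carrier Q"
    using a b unfolding total_fractions_def by simp
  ultimately show ?thesis by blast
qed

lemma (in domain) nonzerodivisors_domain_iff:
  "b \<in> nonzerodivisors R \<longleftrightarrow> b \<in> carrier R \<and> b \<noteq> \<zero>"
proof
  assume b: "b \<in> nonzerodivisors R"
  have "b \<noteq> \<zero>" using nonzerodivisorsD(2)[OF b one_closed] one_not_zero by auto
  then show "b \<in> carrier R \<and> b \<noteq> \<zero>" using nonzerodivisorsD(1)[OF b] by simp
next
  assume "b \<in> carrier R \<and> b \<noteq> \<zero>"
  then show "b \<in> nonzerodivisors R" using integral by (intro nonzerodivisorsI) auto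
qed

text \<open>The total rings of fractions of \<open>R\<close> and of its localization have different
  types, and no isomorphism between them is built. An integral \<open>y\<close> is written as
  \<open>A / B\<close> with \<open>A\<close> and \<open>B\<close> in \<open>R\<close>. Its equation
  is cleared to an equation in \<open>R\<close>, which also holds for the element
  \<open>x = A / B\<close> over \<open>R\<close>. If \<open>u\<close> is a common denominator of the
  coefficients, then \<open>u x\<close> is integral over \<open>R\<close>, so \<open>u x = r\<close>
  and finally \<open>y = r / u\<close>.\<close>

theorem (in domain) normal_domain_localization:
  assumes IC: "integral_closure R = \<tau> ` carrier R" and P: "primeideal P R"
  shows "normal_domain (localization R (carrier R - P))"
proof -
  interpret P: primeideal P R by fact
  define S where "S = carrier R - P"
  have S0: "\<zero> \<notin> S" using P.zero_closed by (simp add: S_def)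
  have "mult_subset R S"
  proof (rule mult_subset.intro[OF is_cring mult_subset_axioms.intro])
    show "S \<subseteq> carrier R" by (auto simp: S_def)
    show "\<one> \<in> S" using P.one_imp_carrier P.I_notcarr by (auto simp: S_def)
    show "s \<otimes> t \<in> S" if "s \<in> S" "t \<in> S" for s t
      using that P.I_prime[of s t] by (auto simp: S_def)
  qed
  then interpret S: mult_subset R S .
  let ?L = "localization R S"
  define \<phi> where "\<phi> r = fraction R S r \<one>" for r
  have SR: "s \<in> carrier R" "s \<noteq> \<zero>" if "s \<in> S" for s using that S0 by (auto simp: S_def)
  interpret L: cring ?L by (rule S.cring_localization)
  have hom: "ring_hom_cring R ?L \<phi>"
    using S.fraction_one_hom by (simp add: \<phi>_def[abs_def])
  interpret \<phi>: ring_hom_cring R ?L \<phi> by (rule hom)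
  have frac_eq: "fraction R S a s = fraction R S b t \<longleftrightarrow> t \<otimes> a = s \<otimes> b"
    if "a \<in> carrier R" "b \<in> carrier R" "s \<in> S" "t \<in> S" for a b s t
  proof -
    have c: "t \<otimes> a \<in> carrier R" "s \<otimes> b \<in> carrier R" using that SR by simp_all
    have "u \<otimes> (t \<otimes> a) = u \<otimes> (s \<otimes> b) \<longleftrightarrow> t \<otimes> a = s \<otimes> b" if "u \<in> S" for u
      using m_lcancel[OF SR(2)[OF that] SR(1)[OF that] c] .
    then show ?thesis using that S.one_S by (subst S.fraction_eq_iff) auto
  qed
  have inj: "\<phi> r = \<phi> r' \<longleftrightarrow> r = r'" if "r \<in> carrier R" "r' \<in> carrier R" for r r'
    using frac_eq[OF that S.one_S S.one_S] that by (simp add: \<phi>_def)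
  have frac: "\<phi> s \<otimes>\<^bsub>?L\<^esub> fraction R S a s = \<phi> a" if "a \<in> carrier R" "s \<in> S" for a s
    using that SR(1)[OF that(2)] frac_eq
    by (simp add: \<phi>_def S.fraction_mult S.one_S m_comm)
  have domL: "domain ?L"
  proof (rule domain.intro[OF L.is_cring domain_axioms.intro])
    show "\<one>\<^bsub>?L\<^esub> \<noteq> \<zero>\<^bsub>?L\<^esub>" using inj[of \<one> \<zero>] by simp
    fix x y assume xy: "x \<otimes>\<^bsub>?L\<^esub> y = \<zero>\<^bsub>?L\<^esub>" and x: "x \<in> carrier ?L" and y: "y \<in> carrier ?L"
    obtain a s where a: "a \<in> carrier R" "s \<in> S" "x = fraction R S a s" by (rule S.fraction_cases[OF x])
    obtain b t where b: "b \<in> carrier R" "t \<in> S" "y = fraction R S b t" by (rule S.fraction_cases[OF y])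
    have st: "s \<in> carrier R" "t \<in> carrier R" using SR a(2) b(2) by auto
    have "fraction R S (a \<otimes> b) (s \<otimes> t) = fraction R S \<zero> \<one>"
      using xy a b by (simp add: S.fraction_mult S.localization_zero)
    then have "a \<otimes> b = \<zero>" using frac_eq[of "a \<otimes> b" \<zero> "s \<otimes> t" \<one>] a b st S.mult_S S.one_S by simp
    then have "a = \<zero> \<or> b = \<zero>" using integral a(1) b(1) by simp
    then show "x = \<zero>\<^bsub>?L\<^esub> \<or> y = \<zero>\<^bsub>?L\<^esub>"
    proof
      assume "a = \<zero>"
      then have "x = fraction R S \<zero> \<one>"
        unfolding a(3) using frac_eq[of \<zero> \<zero> s \<one>] a(2) st S.one_S by simp
      then show ?thesis by (simp add: S.localization_zero)
    next
      assume "b = \<zero>"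
      then have "y = fraction R S \<zero> \<one>"
        unfolding b(3) using frac_eq[of \<zero> \<zero> t \<one>] b(2) st S.one_S by simp
      then show ?thesis by (simp add: S.localization_zero)
    qed
  qed
  interpret L: domain ?L by (rule domL)
  let ?QL = "total_fractions ?L"
  let ?\<tau>L = "to_total_fractions ?L"
  interpret QL: ring_hom_cring ?L ?QL ?\<tau>L by (rule L.total_fractions_hom)
  interpret Q: ring_hom_cring R Q \<tau> by (rule total_fractions_hom)
  define \<Phi> where "\<Phi> r = ?\<tau>L (\<phi> r)" for r
  have "ring_hom_cring R ?QL \<Phi>"
    by (intro ring_hom_cring.intro ring_hom_cring_axioms.intro is_cring L.cring_total_fractions
        ring_hom_memI) (simp_all add: \<Phi>_def)
  then interpret \<Phi>: ring_hom_cring R ?QL \<Phi> .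
  have nzd: "\<phi> r \<in> nonzerodivisors ?L" if "r \<in> carrier R" "r \<noteq> \<zero>" for r
    using that inj[of r \<zero>] by (simp add: L.nonzerodivisors_domain_iff)
  have cancel: "x = y" if "r \<in> carrier R" "r \<noteq> \<zero>" "x \<in> carrier ?QL" "y \<in> carrier ?QL"
    "\<Phi> r \<otimes>\<^bsub>?QL\<^esub> x = \<Phi> r \<otimes>\<^bsub>?QL\<^esub> y" for r x y
    using L.total_fractions_cancel[OF nzd[OF that(1,2)] that(3,4)] that(5) by (simp add: \<Phi>_def)
  have injP: "r = r'" if "\<Phi> r = \<Phi> r'" "r \<in> carrier R" "r' \<in> carrier R" for r r'
  proof -
    have "\<phi> r = \<phi> r'"
      using inj_onD[OF L.to_total_fractions_inj, of "\<phi> r" "\<phi> r'"] that by (simp add: \<Phi>_def)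
    then show ?thesis using inj that by simp
  qed
  have "y \<in> ?\<tau>L ` carrier ?L" if "y \<in> integral_closure ?L" for y
  proof -
    have y: "y \<in> carrier ?QL" "integral_over ?QL (?\<tau>L ` carrier ?L) y"
      using that by (auto simp: integral_closure_def)
    obtain \<alpha> \<beta> where ab: "\<alpha> \<in> carrier ?L" "\<beta> \<in> nonzerodivisors ?L" "?\<tau>L \<beta> \<otimes>\<^bsub>?QL\<^esub> y = ?\<tau>L \<alpha>"
      by (rule L.total_fractions_cases[OF y(1)])
    have bL: "\<beta> \<in> carrier ?L" "\<beta> \<noteq> \<zero>\<^bsub>?L\<^esub>" using ab(2) by (simp_all add: L.nonzerodivisors_domain_iff)
    obtain a s where a: "a \<in> carrier R" "s \<in> S" "\<alpha> = fraction R S a s"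
      by (rule S.fraction_cases[OF ab(1)])
    obtain b t where b: "b \<in> carrier R" "t \<in> S" "\<beta> = fraction R S b t"
      by (rule S.fraction_cases[OF bL(1)])
    have st: "s \<in> carrier R" "t \<in> carrier R" "s \<noteq> \<zero>" "t \<noteq> \<zero>" using SR a(2) b(2) by auto
    have b0: "b \<noteq> \<zero>"
    proof
      assume "b = \<zero>"
      then have "\<phi> t \<otimes>\<^bsub>?L\<^esub> \<beta> = \<zero>\<^bsub>?L\<^esub>" using frac[OF b(1,2)] b(3) by simp
      moreover have "\<phi> t \<noteq> \<zero>\<^bsub>?L\<^esub>" using inj[OF st(2) zero_closed] st(4) by simp
      ultimately show False using L.integral[of "\<phi> t" \<beta>] bL st(2) by auto
    qed
    \<comment> \<open>\<open>\<alpha>\<close> and \<open>\<beta>\<close> are themselves fractions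
      \<open>a / s\<close> and \<open>b / t\<close>; clearing \<open>s\<close> and \<open>t\<close>
      gives a numerator and a denominator of \<open>y\<close> in \<open>R\<close>.\<close>
    define A B where "A = t \<otimes> a" and "B = s \<otimes> b"
    have AB: "A \<in> carrier R" "B \<in> carrier R" "B \<noteq> \<zero>"
      using a(1) b(1) st b0 integral[of s b] by (auto simp: A_def B_def)
    have "\<phi> B \<otimes>\<^bsub>?L\<^esub> \<alpha> = \<phi> A \<otimes>\<^bsub>?L\<^esub> \<beta>"
    proof -
      have "\<phi> B \<otimes>\<^bsub>?L\<^esub> \<alpha> = \<phi> b \<otimes>\<^bsub>?L\<^esub> (\<phi> s \<otimes>\<^bsub>?L\<^esub> \<alpha>)"
        using st b(1) ab(1) by (simp add: B_def L.m_ac)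
      also have "\<dots> = \<phi> a \<otimes>\<^bsub>?L\<^esub> (\<phi> t \<otimes>\<^bsub>?L\<^esub> \<beta>)"
        using frac[OF a(1,2)] frac[OF b(1,2)] a(1) b(1) by (simp add: a(3) b(3) L.m_comm)
      also have "\<dots> = \<phi> A \<otimes>\<^bsub>?L\<^esub> \<beta>"
        using st a(1) bL by (simp add: A_def L.m_ac)
      finally show ?thesis .
    qed
    then have "?\<tau>L (\<phi> B \<otimes>\<^bsub>?L\<^esub> \<alpha>) = ?\<tau>L (\<phi> A \<otimes>\<^bsub>?L\<^esub> \<beta>)" by simp
    then have "\<Phi> B \<otimes>\<^bsub>?QL\<^esub> (?\<tau>L \<beta> \<otimes>\<^bsub>?QL\<^esub> y) = \<Phi> A \<otimes>\<^bsub>?QL\<^esub> ?\<tau>L \<beta>"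
      using ab AB bL by (simp add: \<Phi>_def)
    then have "?\<tau>L \<beta> \<otimes>\<^bsub>?QL\<^esub> (\<Phi> B \<otimes>\<^bsub>?QL\<^esub> y) = ?\<tau>L \<beta> \<otimes>\<^bsub>?QL\<^esub> \<Phi> A"
      using AB bL y(1) by (simp add: QL.S.m_ac)
    then have By: "\<Phi> B \<otimes>\<^bsub>?QL\<^esub> y = \<Phi> A"
      by (rule L.total_fractions_cancel[OF ab(2), rotated -1]) (use AB y(1) in auto)
    obtain p where p: "set p \<subseteq> ?\<tau>L ` carrier ?L" "p \<noteq> []" "hd p = \<one>\<^bsub>?QL\<^esub>"
      "QL.S.eval p y = \<zero>\<^bsub>?QL\<^esub>" using y(2) by (auto simp: integral_over_def)
    \<comment> \<open>The coefficients are pulled back along the embedding of the localization,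
      whose injectivity also pulls the leading coefficient back to \<open>1\<close>.\<close>
    from p(1) have "p \<in> map ?\<tau>L ` lists (carrier ?L)" unfolding lists_image[symmetric] by blast
    then obtain q where q: "set q \<subseteq> carrier ?L" "p = map ?\<tau>L q" by blast
    then obtain q' where q': "q = \<one>\<^bsub>?L\<^esub> # q'"
    proof (cases q)
      case (Cons c q')
      then have "?\<tau>L c = ?\<tau>L \<one>\<^bsub>?L\<^esub>" using p(3) q(2) by simp
      then have "c = \<one>\<^bsub>?L\<^esub>"
        by (rule inj_onD[OF L.to_total_fractions_inj]) (use q(1) Cons in auto)
      then show ?thesis using Cons that by blast
    qed (use p(2) in simp)
    \<comment> \<open>\<open>u\<close> clears the denominators of the lower coefficients. The
      multiplied polynomial has coefficients in \<open>R\<close>, with leading coefficient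
      \<open>u\<close> instead of \<open>1\<close>.\<close>
    obtain u ds where u: "u \<in> S" "set ds \<subseteq> carrier R"
      "map (\<lambda>c. fraction R S u \<one> \<otimes>\<^bsub>?L\<^esub> c) q' = map (\<lambda>r. fraction R S r \<one>) ds"
      using S.common_denominator[of q'] q(1) q' by auto
    have uR: "u \<in> carrier R" "u \<noteq> \<zero>" using SR[OF u(1)] by auto
    have "map (\<lambda>c. \<Phi> u \<otimes>\<^bsub>?QL\<^esub> c) p = map \<Phi> (u # ds)"
    proof -
      have "map (\<lambda>c. \<Phi> u \<otimes>\<^bsub>?QL\<^esub> c) (map ?\<tau>L q') = map ?\<tau>L (map (\<lambda>c. \<phi> u \<otimes>\<^bsub>?L\<^esub> c) q')"
        using q(1) q' uR by (auto simp: \<Phi>_def)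
      also have "map (\<lambda>c. \<phi> u \<otimes>\<^bsub>?L\<^esub> c) q' = map \<phi> ds" using u(3) by (simp add: \<phi>_def[abs_def])
      finally show ?thesis using q(2) q' uR by (simp add: \<Phi>_def)
    qed
    moreover have pc: "set p \<subseteq> carrier ?QL" using p(1) by auto
    ultimately have "QL.S.eval (map \<Phi> (u # ds)) y = \<Phi> u \<otimes>\<^bsub>?QL\<^esub> QL.S.eval p y"
      using QL.S.eval_smult[OF _ y(1) pc, of "\<Phi> u"] uR by simp
    then have "QL.S.eval (map \<Phi> (u # ds)) y = \<zero>\<^bsub>?QL\<^esub>" using p(4) uR by simp
    moreover have uds: "set (u # ds) \<subseteq> carrier R" using u uR by simp
    \<comment> \<open>The value at \<open>y\<close>, multiplied by a power of \<open>B\<close>, is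
      the image of an element of \<open>R\<close>. By injectivity of \<open>\<Phi>\<close> the
      equation becomes one in \<open>R\<close>, ready to be read at the element \<open>x\<close> of
      the other ring of fractions.\<close>
    ultimately have "\<Phi> (homogeneous_eval R (u # ds) A B) = \<Phi> \<zero>"
      using \<Phi>.eval_fraction[OF AB(1,2) y(1) By uds] AB(2) by simp
    then have H: "homogeneous_eval R (u # ds) A B = \<zero>"
      by (rule injP[OF _ homogeneous_eval_closed[OF uds AB(1,2)] zero_closed])
    have Bn: "B \<in> nonzerodivisors R" using AB by (simp add: nonzerodivisors_domain_iff)
    obtain x where x: "x \<in> carrier Q" "\<tau> B \<otimes>\<^bsub>Q\<^esub> x = \<tau> A"
      using total_fractions_divide[OF AB(1) Bn] by blast
    have ev: "Q.S.eval (map \<tau> (u # ds)) x \<in> carrier Q"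
      using x uds by (intro Q.S.eval_in_carrier) auto
    have "\<tau> (B [^] length (u # ds)) \<otimes>\<^bsub>Q\<^esub> Q.S.eval (map \<tau> (u # ds)) x = \<zero>\<^bsub>Q\<^esub>"
      unfolding Q.hom_nat_pow[OF AB(2)] using Q.eval_fraction[OF AB(1,2) x uds] H by simp
    then have root: "Q.S.eval (map \<tau> (u # ds)) x = \<zero>\<^bsub>Q\<^esub>"
      by (rule total_fractions_regular[OF nonzerodivisors_pow[OF Bn] ev])
    have un: "u \<in> nonzerodivisors R" using uR by (simp add: nonzerodivisors_domain_iff)
    have "integral_over Q (\<tau> ` carrier R) (\<tau> u \<otimes>\<^bsub>Q\<^esub> x)"
    proof (rule Q.S.integral_over_clear_leading_coeff[OF total_fractions_subring _ x(1)])
      show "\<tau> u \<in> \<tau> ` carrier R" using uR by simp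
      show "set (map \<tau> ds) \<subseteq> \<tau> ` carrier R" using u(2) by auto
      show "Q.S.eval (\<tau> u # map \<tau> ds) x = \<zero>\<^bsub>Q\<^esub>" using root by simp
      show "z = \<zero>\<^bsub>Q\<^esub>" if "z \<in> carrier Q" "\<tau> u \<otimes>\<^bsub>Q\<^esub> z = \<zero>\<^bsub>Q\<^esub>" for z
        using that by (rule total_fractions_regular[OF un])
    qed
    then have "\<tau> u \<otimes>\<^bsub>Q\<^esub> x \<in> integral_closure R" using uR x by (simp add: integral_closure_def)
    then obtain r where r: "r \<in> carrier R" "\<tau> u \<otimes>\<^bsub>Q\<^esub> x = \<tau> r" unfolding IC by blast
    \<comment> \<open>The relation \<open>u x = r\<close> is now returned through \<open>R\<close>:
      it reads \<open>u A = B r\<close> there, and \<open>\<Phi>\<close> turns this into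
      \<open>u y = r\<close>.\<close>
    have "\<tau> (u \<otimes> A) = \<tau> u \<otimes>\<^bsub>Q\<^esub> (\<tau> B \<otimes>\<^bsub>Q\<^esub> x)" using uR AB x by simp
    also have "\<dots> = \<tau> (B \<otimes> r)"
      using uR AB x(1) r by (simp add: Q.S.m_lcomm)
    finally have "u \<otimes> A = B \<otimes> r"
      by (rule inj_onD[OF to_total_fractions_inj]) (use uR AB r(1) in auto)
    then have "\<Phi> (u \<otimes> A) = \<Phi> (B \<otimes> r)" by simp
    then have "\<Phi> u \<otimes>\<^bsub>?QL\<^esub> (\<Phi> B \<otimes>\<^bsub>?QL\<^esub> y) = \<Phi> B \<otimes>\<^bsub>?QL\<^esub> \<Phi> r"
      unfolding By using uR AB r(1) by simp
    then have "\<Phi> B \<otimes>\<^bsub>?QL\<^esub> (\<Phi> u \<otimes>\<^bsub>?QL\<^esub> y) = \<Phi> B \<otimes>\<^bsub>?QL\<^esub> \<Phi> r"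
      using uR AB r(1) y(1) by (simp add: QL.S.m_lcomm)
    then have uy: "\<Phi> u \<otimes>\<^bsub>?QL\<^esub> y = \<Phi> r"
      by (rule cancel[OF AB(2,3), rotated -1]) (use uR r(1) y(1) in auto)
    have f: "fraction R S r u \<in> carrier ?L" using r(1) u(1) by simp
    have "\<Phi> u \<otimes>\<^bsub>?QL\<^esub> ?\<tau>L (fraction R S r u) = ?\<tau>L (\<phi> u \<otimes>\<^bsub>?L\<^esub> fraction R S r u)"
      using f uR by (simp add: \<Phi>_def)
    then have "\<Phi> u \<otimes>\<^bsub>?QL\<^esub> ?\<tau>L (fraction R S r u) = \<Phi> r"
      using frac[OF r(1) u(1)] by (simp add: \<Phi>_def)
    then have "\<Phi> u \<otimes>\<^bsub>?QL\<^esub> y = \<Phi> u \<otimes>\<^bsub>?QL\<^esub> ?\<tau>L (fraction R S r u)" using uy by simp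
    then have "y = ?\<tau>L (fraction R S r u)"
      by (rule cancel[OF uR y(1) QL.hom_closed[OF f]])
    then show ?thesis using imageI[OF f, of ?\<tau>L] by simp
  qed
  then have "integral_closure ?L \<subseteq> ?\<tau>L ` carrier ?L" by (rule subsetI)
  then have "integral_closure ?L = ?\<tau>L ` carrier ?L"
    using L.image_subset_integral_closure by (rule subset_antisym)
  then show ?thesis using domL by (simp add: normal_domain_def S_def)
qed


section \<open>Reduced local rings\<close>

lemma (in noetherian_ring) exists_maximalideal:
  assumes I: "ideal I R" "I \<noteq> carrier R"
  shows "\<exists>M. maximalideal M R \<and> I \<subseteq> M"
proof -
  define good where "good J \<longleftrightarrow> ideal J R \<and> I \<subseteq> J \<and> J \<noteq> carrier R" for J
  have "good I" using I by (simp add: good_def)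
  then have "Collect good \<noteq> {}" by blast
  moreover have "ideal J R" if "J \<in> Collect good" for J using that by (simp add: good_def)
  ultimately have "\<exists>K\<in>Collect good. \<forall>I\<in>Collect good. K \<subseteq> I \<longrightarrow> I = K"
    by (rule exists_maximal_ideal_in)
  then obtain M where M: "good M" and max: "\<And>J. good J \<Longrightarrow> M \<subseteq> J \<Longrightarrow> J = M" by auto
  have "maximalideal M R"
  proof (rule maximalidealI)
    show "ideal M R" using M by (simp add: good_def)
    show "carrier R \<noteq> M" using M by (auto simp: good_def)
    show "J = M \<or> J = carrier R" if J: "ideal J R" "M \<subseteq> J" for J
    proof (cases "J = carrier R")
      case False
      then have "good J" using M J by (auto simp: good_def)
      then show ?thesis using max J by blast
    qed simp
  qed
  then show ?thesis using M by (auto simp: good_def)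
qed

lemma max_ideal_maximal:
  assumes "local_ring R"
  shows "maximalideal (max_ideal R) R" "maximalideal M R \<Longrightarrow> M = max_ideal R"
proof -
  have ex: "\<exists>!M. maximalideal M R" using assms by (simp add: local_ring_def)
  from theI'[OF ex] show "maximalideal (max_ideal R) R" by (simp add: max_ideal_def)
  with ex show "maximalideal M R \<Longrightarrow> M = max_ideal R" by blast
qed

lemma local_ring_unit:
  assumes N: "noetherian_ring R" and L: "local_ring R"
    and r: "r \<in> carrier R" "r \<notin> max_ideal R"
  shows "r \<in> Units R"
proof (rule ccontr)
  assume r': "r \<notin> Units R"
  interpret cring R using L by (simp add: local_ring_def)
  interpret noetherian_ring R by fact
  have "PIdl\<^bsub>R\<^esub> r \<noteq> carrier R" using ideal_eq_carrier_iff[OF r(1)] r' by blast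
  then obtain M where M: "maximalideal M R" "PIdl\<^bsub>R\<^esub> r \<subseteq> M"
    using exists_maximalideal[OF cgenideal_ideal[OF r(1)]] by blast
  then have "r \<in> M" using cgenideal_self[OF r(1)] by blast
  then show False using r(2) max_ideal_maximal(2)[OF L M(1)] by simp
qed

lemma local_ring_unit_one_minus:
  assumes N: "noetherian_ring R" and L: "local_ring R" and r: "r \<in> max_ideal R"
  shows "\<one>\<^bsub>R\<^esub> \<ominus>\<^bsub>R\<^esub> r \<in> Units R"
proof -
  interpret cring R using L by (simp add: local_ring_def)
  interpret M: maximalideal "max_ideal R" R by (rule max_ideal_maximal[OF L])
  have rR: "r \<in> carrier R" using r by (rule M.Icarr)
  have "\<one>\<^bsub>R\<^esub> \<ominus>\<^bsub>R\<^esub> r \<notin> max_ideal R"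
  proof
    assume "\<one>\<^bsub>R\<^esub> \<ominus>\<^bsub>R\<^esub> r \<in> max_ideal R"
    then have "(\<one>\<^bsub>R\<^esub> \<ominus>\<^bsub>R\<^esub> r) \<oplus>\<^bsub>R\<^esub> r \<in> max_ideal R" using r by (rule M.a_closed)
    moreover have "(\<one>\<^bsub>R\<^esub> \<ominus>\<^bsub>R\<^esub> r) \<oplus>\<^bsub>R\<^esub> r = \<one>\<^bsub>R\<^esub>" using rR by algebra
    ultimately show False using M.one_imp_carrier M.I_notcarr by simp
  qed
  then show ?thesis using rR by (intro local_ring_unit[OF N L]) auto
qed

section \<open>Powers of ideals and Krull's intersection theorem\<close>

lemma ideals_set_simps:
  "\<one>\<^bsub>ideals_set R\<^esub> = carrier R" "I \<otimes>\<^bsub>ideals_set R\<^esub> J = ideal_prod R I J"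
  by (simp_all add: ideals_set_def)

lemma (in cring) ideal_power_ideal:
  assumes "ideal M R"
  shows "ideal (ideal_power R M n) R"
  by (induction n) (simp_all add: ideals_set_simps oneideal ideal_prod_is_ideal assms)

lemma (in cring) ideal_power_add:
  assumes "ideal M R"
  shows "ideal_power R M (m + n) = ideal_power R M m \<cdot> ideal_power R M n"
proof (induction n)
  case 0
  show ?case by (simp add: ideals_set_simps ideal_prod_one ideal_power_ideal assms)
next
  case (Suc n)
  then show ?case by (simp add: ideals_set_simps ideal_prod_assoc ideal_power_ideal assms)
qed

text \<open>At a maximal counterexample \<open>H\<close>, choose \<open>r\<close> in
  \<open>M\<close> outside \<open>H\<close> and \<open>j\<close> with \<open>r^j\<close> outside
  \<open>H\<close> but \<open>r^(j+1)\<close> inside. The larger ideals \<open>H + r R\<close> and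
  \<open>H + r^j R\<close> each contain a power of \<open>M\<close>, while their product falls back
  into \<open>H\<close>.\<close>

lemma (in noetherian_ring) nil_imp_power_subset:
  assumes C: "cring R" and M: "ideal M R" and J: "ideal J R" "\<And>r. r \<in> M \<Longrightarrow> \<exists>n::nat. r [^] n \<in> J"
  shows "\<exists>N. ideal_power R M N \<subseteq> J"
proof (rule ccontr)
  assume contra: "\<not> ?thesis"
  interpret C: cring R by fact
  interpret M: ideal M R by fact
  define bad where "bad J \<longleftrightarrow> ideal J R \<and> (\<forall>r\<in>M. \<exists>n::nat. r [^] n \<in> J) \<and>
    (\<forall>N. \<not> ideal_power R M N \<subseteq> J)" for J
  have "bad J" using contra J by (simp add: bad_def)
  then have "Collect bad \<noteq> {}" by blast
  moreover have "ideal J R" if "J \<in> Collect bad" for J using that by (simp add: bad_def)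
  ultimately have "\<exists>K\<in>Collect bad. \<forall>I\<in>Collect bad. K \<subseteq> I \<longrightarrow> I = K"
    by (rule exists_maximal_ideal_in)
  then obtain H where H: "bad H" and max: "\<And>I. bad I \<Longrightarrow> H \<subseteq> I \<Longrightarrow> I = H" by auto
  have HI: "ideal H R" and nil: "\<And>r. r \<in> M \<Longrightarrow> \<exists>n::nat. r [^] n \<in> H"
    and not: "\<And>N. \<not> ideal_power R M N \<subseteq> H" using H by (simp_all add: bad_def)
  interpret H: ideal H R by fact
  have grow: "\<exists>N. ideal_power R M N \<subseteq> adjoin R H c" if c: "c \<in> carrier R" "c \<notin> H" for c
  proof (rule ccontr)
    assume "\<not> ?thesis"
    moreover have "\<exists>n::nat. r [^] n \<in> adjoin R H c" if "r \<in> M" for r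
      using nil[OF that] C.subset_adjoin[OF HI c(1)] by blast
    ultimately have "bad (adjoin R H c)" using C.adjoin_ideal[OF HI c(1)] by (simp add: bad_def)
    then show False using max C.subset_adjoin[OF HI c(1)] C.mem_adjoin[OF HI c(1)] c(2) by blast
  qed
  have "ideal_power R M 1 = M"
    using C.ideal_prod_commute[OF oneideal M] ideal_prod_one[OF M] by (simp add: ideals_set_simps)
  then have "\<not> M \<subseteq> H" using not[of 1] by simp
  then obtain r where r: "r \<in> M" "r \<notin> H" by blast
  have rR: "r \<in> carrier R" using r(1) by (rule M.Icarr)
  \<comment> \<open>The least exponent \<open>k\<close> with \<open>r^k \<in> H\<close> is positive,
    since \<open>1 \<in> H\<close> would put \<open>r\<close> into \<open>H\<close>. So
    \<open>j = k - 1\<close> gives \<open>r^j\<close> outside \<open>H\<close>.\<close>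
  define k where "k = (LEAST n::nat. r [^] n \<in> H)"
  have k: "r [^] k \<in> H" unfolding k_def by (rule LeastI_ex[OF nil[OF r(1)]])
  have "k \<noteq> 0"
  proof
    assume "k = 0"
    then have "\<one> \<in> H" using k by simp
    then show False using H.I_l_closed[OF _ rR] r(2) rR by fastforce
  qed
  then obtain j where j: "k = Suc j" by (cases k) auto
  have rj: "r [^] j \<notin> H" using not_less_Least[of j "\<lambda>n. r [^] n \<in> H"] j by (simp add: k_def)
  have rjR: "r [^] j \<in> carrier R" using rR by simp
  obtain m where m: "ideal_power R M m \<subseteq> adjoin R H r" using grow[OF rR r(2)] by blast
  obtain n where n: "ideal_power R M n \<subseteq> adjoin R H (r [^] j)" using grow[OF rjR rj] by blast
  have "x \<in> H" if "x \<in> ideal_power R M m \<cdot> ideal_power R M n" for x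
    using that
  proof induction
    case (prod x y)
    obtain h s where x: "x = h \<oplus> s \<otimes> r" "h \<in> H" "s \<in> carrier R"
      using prod(1) m by (auto simp: adjoin_def)
    obtain g t where y: "y = g \<oplus> t \<otimes> r [^] j" "g \<in> H" "t \<in> carrier R"
      using prod(2) n by (auto simp: adjoin_def)
    have c: "h \<in> carrier R" "g \<in> carrier R" using x y H.Icarr by auto
    have "x \<otimes> y = h \<otimes> y \<oplus> (s \<otimes> r \<otimes> g \<oplus> s \<otimes> t \<otimes> r [^] k)"
      using c x(3) y(3) rR rjR by (simp add: x(1) y(1) j l_distr r_distr C.m_ac a_assoc a_comm a_lcomm)
    also have "\<dots> \<in> H"
      using c x y k rR rjR by (intro H.a_closed H.I_l_closed H.I_r_closed) auto
    finally show ?case .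
  next
    case (sum s1 s2)
    then show ?case by (intro H.a_closed)
  qed
  then show False using not[of "m + n"] C.ideal_power_add[OF M] by auto
qed

text \<open>If \<open>x\<close> is nonzero, let \<open>B\<close> be maximal among the ideals that
  avoid \<open>x\<close>, and \<open>M\<close> the maximal ideal of \<open>R\<close>. Then
  \<open>M x \<subseteq> B\<close> and \<open>(B : x) \<subseteq> M\<close>, the situation of
  \<open>exists_nil_ideal\<close>. The resulting ideal \<open>J\<close> avoids \<open>x\<close> but
  contains a power of \<open>M\<close>, contrary to \<open>x\<close> lying in all powers.\<close>

theorem krull_intersection_local:
  assumes N: "noetherian_ring R" and L: "local_ring R" and x: "x \<in> carrier R"
    and mem: "\<And>n. x \<in> ideal_power R (max_ideal R) n"
  shows "x = \<zero>\<^bsub>R\<^esub>"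
proof (rule ccontr)
  assume x0: "x \<noteq> \<zero>\<^bsub>R\<^esub>"
  interpret cring R using L by (simp add: local_ring_def)
  interpret N: noetherian_ring R by fact
  let ?M = "max_ideal R"
  have max: "maximalideal ?M R" by (rule max_ideal_maximal[OF L])
  interpret M: maximalideal ?M R by (rule max)
  have prime: "primeideal ?M R" by (rule maximalideal_prime[OF max])
  define good where "good J \<longleftrightarrow> ideal J R \<and> x \<notin> J" for J
  have "good {\<zero>\<^bsub>R\<^esub>}" using x0 zeroideal by (simp add: good_def)
  then have "Collect good \<noteq> {}" by blast
  moreover have "ideal J R" if "J \<in> Collect good" for J using that by (simp add: good_def)
  ultimately have "\<exists>K\<in>Collect good. \<forall>I\<in>Collect good. K \<subseteq> I \<longrightarrow> I = K"
    by (rule N.exists_maximal_ideal_in)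
  then obtain B where gB: "good B" and mx: "\<And>J. good J \<Longrightarrow> B \<subseteq> J \<Longrightarrow> J = B" by auto
  have B: "ideal B R" "x \<notin> B" using gB by (simp_all add: good_def)
  interpret B: ideal B R by (rule B(1))
  have unit: "x \<in> B" if u: "u \<in> Units R" "u \<otimes>\<^bsub>R\<^esub> x \<in> B" for u
  proof -
    have "inv\<^bsub>R\<^esub> u \<otimes>\<^bsub>R\<^esub> (u \<otimes>\<^bsub>R\<^esub> x) \<in> B" by (rule B.I_l_closed[OF u(2) Units_inv_closed[OF u(1)]])
    moreover have "inv\<^bsub>R\<^esub> u \<otimes>\<^bsub>R\<^esub> (u \<otimes>\<^bsub>R\<^esub> x) = x"
      using u(1) x by (simp add: m_assoc[symmetric] Units_closed)
    ultimately show ?thesis by simp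
  qed
  \<comment> \<open>If \<open>r x\<close> were outside \<open>B\<close>, maximality would give
    \<open>x = j + y r x\<close> with \<open>j \<in> B\<close>. Then
    \<open>(1 - y r) x \<in> B\<close>, although \<open>1 - y r\<close> is a unit.\<close>
  have soc: "r \<otimes>\<^bsub>R\<^esub> x \<in> B" if r: "r \<in> ?M" for r
  proof (rule ccontr)
    assume *: "r \<otimes>\<^bsub>R\<^esub> x \<notin> B"
    have rR: "r \<in> carrier R" using r by (rule M.Icarr)
    let ?I = "adjoin R B (r \<otimes>\<^bsub>R\<^esub> x)"
    have rx: "r \<otimes>\<^bsub>R\<^esub> x \<in> carrier R" using rR x by simp
    have "\<not> good ?I"
      using mx[of ?I] subset_adjoin[OF B(1) rx] mem_adjoin[OF B(1) rx] * by blast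
    then have "x \<in> ?I" using adjoin_ideal[OF B(1) rx] by (simp add: good_def)
    then obtain j y where jy: "x = j \<oplus>\<^bsub>R\<^esub> y \<otimes>\<^bsub>R\<^esub> (r \<otimes>\<^bsub>R\<^esub> x)" "j \<in> B" "y \<in> carrier R"
      by (auto simp: adjoin_def)
    have jR: "j \<in> carrier R" using jy(2) by (rule B.Icarr)
    have "(\<one>\<^bsub>R\<^esub> \<ominus>\<^bsub>R\<^esub> y \<otimes>\<^bsub>R\<^esub> r) \<otimes>\<^bsub>R\<^esub> x = x \<ominus>\<^bsub>R\<^esub> y \<otimes>\<^bsub>R\<^esub> (r \<otimes>\<^bsub>R\<^esub> x)"
      using x jy(3) rR by algebra
    also have "\<dots> = (j \<oplus>\<^bsub>R\<^esub> y \<otimes>\<^bsub>R\<^esub> (r \<otimes>\<^bsub>R\<^esub> x)) \<ominus>\<^bsub>R\<^esub> y \<otimes>\<^bsub>R\<^esub> (r \<otimes>\<^bsub>R\<^esub> x)"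
      using jy(1) by simp
    also have "\<dots> = j" using jR jy(3) rR x by algebra
    finally have "(\<one>\<^bsub>R\<^esub> \<ominus>\<^bsub>R\<^esub> y \<otimes>\<^bsub>R\<^esub> r) \<otimes>\<^bsub>R\<^esub> x \<in> B" using jy(2) by simp
    moreover have "\<one>\<^bsub>R\<^esub> \<ominus>\<^bsub>R\<^esub> y \<otimes>\<^bsub>R\<^esub> r \<in> Units R"
      by (rule local_ring_unit_one_minus[OF N L M.I_l_closed[OF r jy(3)]])
    ultimately show False using unit B(2) by blast
  qed
  have "colon R B x \<subseteq> ?M"
  proof
    fix r assume "r \<in> colon R B x"
    then have r: "r \<in> carrier R" "r \<otimes>\<^bsub>R\<^esub> x \<in> B" by (simp_all add: colon_def)
    show "r \<in> ?M"
    proof (rule ccontr)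
      assume "r \<notin> ?M"
      then have "r \<in> Units R" by (rule local_ring_unit[OF N L r(1)])
      then show False using unit[OF _ r(2)] B(2) by simp
    qed
  qed
  then obtain J where J: "ideal J R" "B \<subseteq> J" "colon R J x \<subseteq> ?M"
    "\<forall>r\<in>?M. \<exists>n::nat. r [^]\<^bsub>R\<^esub> n \<in> J"
    using N.exists_nil_ideal[OF prime x B(1) ballI[OF soc]] by blast
  obtain n where "ideal_power R ?M n \<subseteq> J"
    using N.nil_imp_power_subset[OF is_cring M.ideal_axioms J(1)] J(4) by blast
  then have "x \<in> J" using mem by blast
  then have "\<one>\<^bsub>R\<^esub> \<in> colon R J x" using x by (simp add: colon_def)
  then show False using J(3) M.one_imp_carrier M.I_notcarr by blast
qed

section \<open>Reducedness, and why the ring is a domain\<close>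

lemma reduced_ring_square:
  assumes "cring R" "reduced_ring R" "x \<in> carrier R" "x \<otimes>\<^bsub>R\<^esub> x = \<zero>\<^bsub>R\<^esub>"
  shows "x = \<zero>\<^bsub>R\<^esub>"
proof -
  interpret cring R by fact
  have "x [^]\<^bsub>R\<^esub> (2::nat) = \<zero>\<^bsub>R\<^esub>" using assms(3,4) by (simp add: numeral_2_eq_2)
  then show ?thesis using assms(2,3) unfolding reduced_ring_def by blast
qed

lemma analytically_unramified_imp_reduced:
  assumes "analytically_unramified R"
  shows "reduced_ring R"
  unfolding reduced_ring_def
proof (intro ballI allI impI)
  have L: "local_ring R" and N: "noetherian_ring R"
    and red: "reduced_ring (adic_completion R (max_ideal R))"
    using assms by (simp_all add: analytically_unramified_def)
  interpret cring R using L by (simp add: local_ring_def)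
  let ?M = "max_ideal R"
  let ?C = "adic_completion R ?M"
  define I where "I n = ideal_power R ?M n" for n
  interpret M: maximalideal ?M R by (rule max_ideal_maximal[OF L])
  have I: "ideal (I n) R" for n unfolding I_def by (rule ideal_power_ideal[OF M.ideal_axioms])
  have dec: "I (Suc n) \<subseteq> I n" for n
    using ideal_prod_inter[OF I[of n] M.ideal_axioms] by (auto simp: I_def ideals_set_simps)
  \<comment> \<open>\<open>c\<close> is the canonical map to the completion. It respects powers, so
    a nilpotent \<open>x\<close> has nilpotent and hence zero image, which places \<open>x\<close>
    in every power of the maximal ideal.\<close>
  define c where "c x = (\<lambda>n. I n +>\<^bsub>R\<^esub> x)" for x
  have c_carrier: "c x \<in> carrier ?C" if "x \<in> carrier R" for x
  proof -
    have "I (Suc n) +>\<^bsub>R\<^esub> x \<subseteq> I n +>\<^bsub>R\<^esub> x" for n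
      using dec[of n] by (auto simp: a_r_coset_def')
    moreover have "I n +>\<^bsub>R\<^esub> x \<in> a_rcosets\<^bsub>R\<^esub> (I n)" for n
      using that ideal.Icarr[OF I] by (intro a_rcosetsI) auto
    ultimately show ?thesis by (simp add: adic_completion_def c_def FactRing_def I_def)
  qed
  have pow: "c x [^]\<^bsub>?C\<^esub> k = c (x [^]\<^bsub>R\<^esub> k)" if x: "x \<in> carrier R" for x and k :: nat
  proof (induction k)
    case 0
    show ?case by (simp add: adic_completion_def c_def FactRing_def I_def)
  next
    case (Suc k)
    have "c (x [^]\<^bsub>R\<^esub> k) \<otimes>\<^bsub>?C\<^esub> c x = c (x [^]\<^bsub>R\<^esub> k \<otimes>\<^bsub>R\<^esub> x)"
      using x ideal.rcoset_mult_add[OF I]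
      by (simp add: adic_completion_def c_def FactRing_def I_def)
    then show ?case using Suc by simp
  qed
  have zero: "\<zero>\<^bsub>?C\<^esub> = I" by (simp add: adic_completion_def FactRing_def I_def fun_eq_iff)
  fix x and n :: nat
  assume x: "x \<in> carrier R" and xn: "x [^]\<^bsub>R\<^esub> n = \<zero>\<^bsub>R\<^esub>"
  have "c \<zero>\<^bsub>R\<^esub> = I"
    using a_rcos_zero[OF I] additive_subgroup.zero_closed[OF ideal.axioms(1)[OF I]]
    by (simp add: c_def fun_eq_iff)
  then have "c x [^]\<^bsub>?C\<^esub> n = \<zero>\<^bsub>?C\<^esub>" using pow[OF x, of n] xn zero by simp
  then have "c x = \<zero>\<^bsub>?C\<^esub>" using red c_carrier[OF x] unfolding reduced_ring_def by blast
  then have "I m +>\<^bsub>R\<^esub> x = I m" for m using zero by (simp add: c_def fun_eq_iff)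
  then have "x \<in> I m" for m using ideal.rcos_const_imp_mem[OF I x] by blast
  then show "x = \<zero>\<^bsub>R\<^esub>" using krull_intersection_local[OF N L x] by (simp add: I_def)
qed

text \<open>In terms of components, \<open>u\<close> lives on every component on which some element
  of \<open>U\<close> lives. It is found by maximizing the double annihilator \<open>D u\<close>: if
  \<open>w\<close> killed \<open>u\<close> but not \<open>v\<close>, then \<open>u + w v\<close>
  would have a strictly larger double annihilator.\<close>

lemma annihilator_attained:
  assumes N: "noetherian_ring R" and C: "cring R" and red: "reduced_ring R" and U: "ideal U R"
  shows "\<exists>u\<in>U. \<forall>w\<in>carrier R. w \<otimes>\<^bsub>R\<^esub> u = \<zero>\<^bsub>R\<^esub> \<longrightarrow> (\<forall>v\<in>U. w \<otimes>\<^bsub>R\<^esub> v = \<zero>\<^bsub>R\<^esub>)"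
proof -
  interpret cring R by fact
  interpret N: noetherian_ring R by fact
  interpret U: ideal U R by fact
  note sq = reduced_ring_square[OF C red]
  define D where "D u = {r \<in> carrier R. \<forall>w\<in>carrier R. w \<otimes>\<^bsub>R\<^esub> u = \<zero>\<^bsub>R\<^esub> \<longrightarrow> w \<otimes>\<^bsub>R\<^esub> r = \<zero>\<^bsub>R\<^esub>}" for u
  have DI: "ideal (D u) R" for u
  proof (rule idealI_cring)
    show "D u \<subseteq> carrier R" by (auto simp: D_def)
    show "\<zero>\<^bsub>R\<^esub> \<in> D u" by (simp add: D_def)
    show "x \<oplus>\<^bsub>R\<^esub> y \<in> D u" if "x \<in> D u" "y \<in> D u" for x y
      using that by (simp add: D_def r_distr)
    show "r \<otimes>\<^bsub>R\<^esub> x \<in> D u" if "r \<in> carrier R" "x \<in> D u" for r x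
    proof -
      have "w \<otimes>\<^bsub>R\<^esub> (r \<otimes>\<^bsub>R\<^esub> x) = r \<otimes>\<^bsub>R\<^esub> (w \<otimes>\<^bsub>R\<^esub> x)" if "w \<in> carrier R" for w
        using that \<open>r \<in> carrier R\<close> \<open>x \<in> D u\<close> by (intro m_lcomm) (simp_all add: D_def)
      then show ?thesis using that by (simp add: D_def)
    qed
  qed
  have "D ` U \<noteq> {}" using U.zero_closed by blast
  moreover have "ideal I R" if "I \<in> D ` U" for I using that DI by blast
  ultimately have "\<exists>K\<in>D ` U. \<forall>I\<in>D ` U. K \<subseteq> I \<longrightarrow> I = K" by (rule N.exists_maximal_ideal_in)
  then obtain u where u: "u \<in> U" and max: "\<forall>I\<in>D ` U. D u \<subseteq> I \<longrightarrow> I = D u" by (elim bexE imageE) simp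
  have uR: "u \<in> carrier R" using u by (rule U.Icarr)
  have "w \<otimes>\<^bsub>R\<^esub> v = \<zero>\<^bsub>R\<^esub>" if w: "w \<in> carrier R" "w \<otimes>\<^bsub>R\<^esub> u = \<zero>\<^bsub>R\<^esub>" and v: "v \<in> U" for w v
  proof -
    have vR: "v \<in> carrier R" using v by (rule U.Icarr)
    \<comment> \<open>Since \<open>w u = 0\<close>, the two summands of \<open>?t\<close> have
      product zero. In a reduced ring anything that kills their sum then kills each of them, so
      \<open>D u \<subseteq> D ?t\<close>.\<close>
    let ?t = "u \<oplus>\<^bsub>R\<^esub> w \<otimes>\<^bsub>R\<^esub> v"
    have t: "?t \<in> U" using u v w by (intro U.a_closed U.I_l_closed)
    have tR: "?t \<in> carrier R" using t by (rule U.Icarr)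
    have "D u \<subseteq> D ?t"
    proof
      fix r assume r: "r \<in> D u"
      have "z \<otimes>\<^bsub>R\<^esub> r = \<zero>\<^bsub>R\<^esub>" if z: "z \<in> carrier R" "z \<otimes>\<^bsub>R\<^esub> ?t = \<zero>\<^bsub>R\<^esub>" for z
      proof -
        have "(z \<otimes>\<^bsub>R\<^esub> u) \<otimes>\<^bsub>R\<^esub> (z \<otimes>\<^bsub>R\<^esub> u) =
            z \<otimes>\<^bsub>R\<^esub> u \<otimes>\<^bsub>R\<^esub> (z \<otimes>\<^bsub>R\<^esub> ?t) \<ominus>\<^bsub>R\<^esub> z \<otimes>\<^bsub>R\<^esub> z \<otimes>\<^bsub>R\<^esub> v \<otimes>\<^bsub>R\<^esub> (w \<otimes>\<^bsub>R\<^esub> u)"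
          using z(1) uR vR w(1) by algebra
        also have "\<dots> = \<zero>\<^bsub>R\<^esub>" unfolding z(2) w(2) using z(1) uR vR by algebra
        finally have "z \<otimes>\<^bsub>R\<^esub> u = \<zero>\<^bsub>R\<^esub>" by (rule sq[rotated]) (use z(1) uR in auto)
        then show ?thesis using r z(1) by (simp add: D_def)
      qed
      then show "r \<in> D ?t" using r by (simp add: D_def)
    qed
    then have "D ?t = D u" using max t by blast
    moreover have "?t \<in> D ?t" using tR by (simp add: D_def)
    ultimately have "?t \<in> D u" by simp
    then have wt: "w \<otimes>\<^bsub>R\<^esub> ?t = \<zero>\<^bsub>R\<^esub>" using w by (simp add: D_def)
    have "(w \<otimes>\<^bsub>R\<^esub> v) \<otimes>\<^bsub>R\<^esub> (w \<otimes>\<^bsub>R\<^esub> v) = v \<otimes>\<^bsub>R\<^esub> (w \<otimes>\<^bsub>R\<^esub> ?t) \<ominus>\<^bsub>R\<^esub> v \<otimes>\<^bsub>R\<^esub> (w \<otimes>\<^bsub>R\<^esub> u)"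
      using w(1) uR vR by algebra
    also have "\<dots> = \<zero>\<^bsub>R\<^esub>" unfolding wt w(2) using vR by algebra
    finally show ?thesis by (rule sq[rotated]) (use w(1) vR in auto)
  qed
  then show ?thesis using u by (intro bexI[of _ u] ballI impI)
qed

text \<open>For \<open>a \<noteq> 0\<close>, an idempotent is built that separates the components on
  which \<open>a\<close> lives from the others. An element \<open>u\<close> that generates the
  annihilator of \<open>a\<close> as far as annihilators can tell is a complement of
  \<open>a\<close>: the sum \<open>a + u\<close> is regular and \<open>a / (a + u)\<close> is the
  idempotent. Taking \<open>u\<close> from \<open>annihilator_attained\<close> avoids minimal
  primes.\<close>

lemma local_integrally_closed_imp_domain:
  assumes N: "noetherian_ring R" and L: "local_ring R" and red: "reduced_ring R"
    and IC: "integral_closure R = to_total_fractions R ` carrier R"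
  shows "domain R"
proof -
  have C: "cring R" using L by (simp add: local_ring_def)
  interpret cring R by fact
  interpret M: maximalideal "max_ideal R" R by (rule max_ideal_maximal[OF L])
  interpret h: ring_hom_cring R Q \<tau> by (rule total_fractions_hom)
  note sq = reduced_ring_square[OF C red]
  have regular: "a \<in> nonzerodivisors R" if a: "a \<in> carrier R" "a \<noteq> \<zero>\<^bsub>R\<^esub>" for a
  proof -
    let ?U = "colon R {\<zero>\<^bsub>R\<^esub>} a"
    obtain u where u: "u \<in> ?U" and
      all: "\<forall>w\<in>carrier R. w \<otimes>\<^bsub>R\<^esub> u = \<zero>\<^bsub>R\<^esub> \<longrightarrow> (\<forall>v\<in>?U. w \<otimes>\<^bsub>R\<^esub> v = \<zero>\<^bsub>R\<^esub>)"
      using annihilator_attained[OF N C red colon_ideal[OF zeroideal a(1)]] by (elim bexE)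
    have ann: "w \<otimes>\<^bsub>R\<^esub> v = \<zero>\<^bsub>R\<^esub>" if "w \<in> carrier R" "w \<otimes>\<^bsub>R\<^esub> u = \<zero>\<^bsub>R\<^esub>" "v \<in> ?U" for w v
      using bspec[OF bspec[OF all that(1), THEN mp, OF that(2)] that(3)] .
    have uR: "u \<in> carrier R" "u \<otimes>\<^bsub>R\<^esub> a = \<zero>\<^bsub>R\<^esub>" using u by (simp_all add: colon_def)
    let ?b = "a \<oplus>\<^bsub>R\<^esub> u"
    have bR: "?b \<in> carrier R" using a(1) uR(1) by simp
    \<comment> \<open>If \<open>?b\<close> kills \<open>z\<close>, then \<open>u a = 0\<close> and
      reducedness give \<open>z a = 0\<close>, and so \<open>z u = 0\<close>. By the choice of
      \<open>u\<close>, \<open>z\<close> kills everything that annihilates \<open>a\<close>, in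
      particular itself.\<close>
    have b: "?b \<in> nonzerodivisors R"
    proof (rule nonzerodivisorsI[OF bR])
      fix z assume z: "z \<in> carrier R" and bz: "?b \<otimes>\<^bsub>R\<^esub> z = \<zero>\<^bsub>R\<^esub>"
      have "(z \<otimes>\<^bsub>R\<^esub> a) \<otimes>\<^bsub>R\<^esub> (z \<otimes>\<^bsub>R\<^esub> a) = z \<otimes>\<^bsub>R\<^esub> a \<otimes>\<^bsub>R\<^esub> (?b \<otimes>\<^bsub>R\<^esub> z) \<ominus>\<^bsub>R\<^esub> z \<otimes>\<^bsub>R\<^esub> z \<otimes>\<^bsub>R\<^esub> (u \<otimes>\<^bsub>R\<^esub> a)"
        using z a(1) uR(1) by algebra
      also have "\<dots> = \<zero>\<^bsub>R\<^esub>" unfolding bz uR(2) using z a(1) by algebra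
      finally have za: "z \<otimes>\<^bsub>R\<^esub> a = \<zero>\<^bsub>R\<^esub>" by (rule sq[rotated]) (use z a(1) in auto)
      have "z \<otimes>\<^bsub>R\<^esub> u = ?b \<otimes>\<^bsub>R\<^esub> z \<ominus>\<^bsub>R\<^esub> z \<otimes>\<^bsub>R\<^esub> a" using z a(1) uR(1) by algebra
      also have "\<dots> = \<zero>\<^bsub>R\<^esub>" unfolding bz za by algebra
      finally have "z \<otimes>\<^bsub>R\<^esub> u = \<zero>\<^bsub>R\<^esub>" .
      moreover have "z \<in> ?U" using z za by (simp add: colon_def)
      ultimately have "z \<otimes>\<^bsub>R\<^esub> z = \<zero>\<^bsub>R\<^esub>" by (rule ann[OF z])
      then show "z = \<zero>\<^bsub>R\<^esub>" by (rule sq[OF z])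
    qed
    \<comment> \<open>\<open>a / (a + u)\<close> is idempotent.\<close>
    have ab: "?b \<otimes>\<^bsub>R\<^esub> a = a \<otimes>\<^bsub>R\<^esub> a"
    proof -
      have "?b \<otimes>\<^bsub>R\<^esub> a = a \<otimes>\<^bsub>R\<^esub> a \<oplus>\<^bsub>R\<^esub> u \<otimes>\<^bsub>R\<^esub> a" using a(1) uR(1) by algebra
      then show ?thesis using a(1) by (simp add: uR(2))
    qed
    obtain x where x: "x \<in> carrier Q" "\<tau> ?b \<otimes>\<^bsub>Q\<^esub> x = \<tau> a"
      using total_fractions_divide[OF a(1) b] by blast
    have tb: "\<tau> ?b \<in> carrier Q" by (rule h.hom_closed[OF bR])
    have xx: "x \<otimes>\<^bsub>Q\<^esub> x = x"
    proof (rule total_fractions_cancel[OF b _ x(1)])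
      show "x \<otimes>\<^bsub>Q\<^esub> x \<in> carrier Q" using x(1) by simp
      show "\<tau> ?b \<otimes>\<^bsub>Q\<^esub> (x \<otimes>\<^bsub>Q\<^esub> x) = \<tau> ?b \<otimes>\<^bsub>Q\<^esub> x"
      proof (rule total_fractions_cancel[OF b])
        show "\<tau> ?b \<otimes>\<^bsub>Q\<^esub> (x \<otimes>\<^bsub>Q\<^esub> x) \<in> carrier Q" "\<tau> ?b \<otimes>\<^bsub>Q\<^esub> x \<in> carrier Q"
          using tb x(1) by (simp_all del: h.hom_add)
        have "\<tau> ?b \<otimes>\<^bsub>Q\<^esub> (\<tau> ?b \<otimes>\<^bsub>Q\<^esub> (x \<otimes>\<^bsub>Q\<^esub> x)) = (\<tau> ?b \<otimes>\<^bsub>Q\<^esub> x) \<otimes>\<^bsub>Q\<^esub> (\<tau> ?b \<otimes>\<^bsub>Q\<^esub> x)"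
          using tb x(1) by (simp add: h.S.m_ac del: h.hom_add)
        also have "\<dots> = \<tau> (a \<otimes>\<^bsub>R\<^esub> a)" unfolding x(2) using a(1) by simp
        also have "\<dots> = \<tau> ?b \<otimes>\<^bsub>Q\<^esub> \<tau> a" unfolding ab[symmetric] by (rule h.hom_mult[OF bR a(1)])
        finally show "\<tau> ?b \<otimes>\<^bsub>Q\<^esub> (\<tau> ?b \<otimes>\<^bsub>Q\<^esub> (x \<otimes>\<^bsub>Q\<^esub> x)) = \<tau> ?b \<otimes>\<^bsub>Q\<^esub> (\<tau> ?b \<otimes>\<^bsub>Q\<^esub> x)"
          unfolding x(2) .
      qed
    qed
    note sub = subringE[OF total_fractions_subring]
    \<comment> \<open>The coefficient list is that of X^2 - X, with the leading coefficient
      first.\<close>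
    have "h.S.eval [\<one>\<^bsub>Q\<^esub>, \<ominus>\<^bsub>Q\<^esub> \<one>\<^bsub>Q\<^esub>, \<zero>\<^bsub>Q\<^esub>] x = \<zero>\<^bsub>Q\<^esub>"
      using x(1) xx by (simp add: h.S.l_minus h.S.r_neg)
    then have "integral_over Q (\<tau> ` carrier R) x"
      unfolding integral_over_def using sub(2,3) sub(5)[OF sub(3)]
      by (intro exI[of _ "[\<one>\<^bsub>Q\<^esub>, \<ominus>\<^bsub>Q\<^esub> \<one>\<^bsub>Q\<^esub>, \<zero>\<^bsub>Q\<^esub>]"]) simp
    then have "x \<in> integral_closure R" using x(1) by (simp add: integral_closure_def)
    then obtain r where r: "r \<in> carrier R" "x = \<tau> r" unfolding IC by blast
    have inj: "s = t" if "\<tau> s = \<tau> t" "s \<in> carrier R" "t \<in> carrier R" for s t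
      using inj_onD[OF to_total_fractions_inj that] .
    have br: "?b \<otimes>\<^bsub>R\<^esub> r = a"
      by (rule inj) (use x(2) r bR a(1) in \<open>simp_all del: h.hom_add\<close>)
    have rr: "r \<otimes>\<^bsub>R\<^esub> r = r"
      by (rule inj) (use xx r in simp_all)
    \<comment> \<open>One of \<open>r\<close> and \<open>1 - r\<close> is a unit, so the idempotent
      \<open>r\<close> is \<open>1\<close> or \<open>0\<close>. The first case makes
      \<open>a\<close> equal to the regular element \<open>a + u\<close>; the second makes
      \<open>a\<close> zero.\<close>
    have "r \<notin> max_ideal R \<or> \<one>\<^bsub>R\<^esub> \<ominus>\<^bsub>R\<^esub> r \<in> Units R"
      using local_ring_unit_one_minus[OF N L] by blast
    then show ?thesis
    proof
      assume "r \<notin> max_ideal R"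
      then have rU: "r \<in> Units R" by (rule local_ring_unit[OF N L r(1)])
      then have "inv\<^bsub>R\<^esub> r \<otimes>\<^bsub>R\<^esub> (r \<otimes>\<^bsub>R\<^esub> r) = inv\<^bsub>R\<^esub> r \<otimes>\<^bsub>R\<^esub> r" by (simp only: rr)
      then have "r = \<one>\<^bsub>R\<^esub>" using rU r(1) by (simp add: m_assoc[symmetric])
      then have "?b = a" using br bR by simp
      then show ?thesis using b by simp
    next
      assume U1: "\<one>\<^bsub>R\<^esub> \<ominus>\<^bsub>R\<^esub> r \<in> Units R"
      let ?e = "\<one>\<^bsub>R\<^esub> \<ominus>\<^bsub>R\<^esub> r"
      have "?e \<otimes>\<^bsub>R\<^esub> r = r \<ominus>\<^bsub>R\<^esub> r \<otimes>\<^bsub>R\<^esub> r" using r(1) by algebra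
      also have "\<dots> = \<zero>\<^bsub>R\<^esub>" unfolding rr using r(1) by algebra
      finally have "?e \<otimes>\<^bsub>R\<^esub> r = ?e \<otimes>\<^bsub>R\<^esub> \<zero>\<^bsub>R\<^esub>" using r(1) by simp
      then have "r = \<zero>\<^bsub>R\<^esub>" using Units_l_cancel[OF U1 r(1) zero_closed] by simp
      then have "a = \<zero>\<^bsub>R\<^esub>" using br bR by simp
      then show ?thesis using a(2) by simp
    qed
  qed
  show ?thesis
  proof (rule domain.intro[OF C domain_axioms.intro])
    show "\<one>\<^bsub>R\<^esub> \<noteq> \<zero>\<^bsub>R\<^esub>"
    proof
      assume "\<one>\<^bsub>R\<^esub> = \<zero>\<^bsub>R\<^esub>"
      then have "\<one>\<^bsub>R\<^esub> \<in> max_ideal R" using M.zero_closed by simp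
      then show False using M.one_imp_carrier M.I_notcarr by blast
    qed
    fix a b assume ab: "a \<otimes>\<^bsub>R\<^esub> b = \<zero>\<^bsub>R\<^esub>" "a \<in> carrier R" "b \<in> carrier R"
    show "a = \<zero>\<^bsub>R\<^esub> \<or> b = \<zero>\<^bsub>R\<^esub>"
    proof (cases "a = \<zero>\<^bsub>R\<^esub>")
      case False
      then show ?thesis using nonzerodivisorsD(2)[OF regular[OF ab(2) False] ab(3,1)] by simp
    qed simp
  qed
qed

theorem proposition6p15:
  fixes R :: "('a, 'b) ring_scheme"
  assumes "noetherian_ring R" and "local_ring R"
    and "analytically_unramified R"
    and "proj_dim TYPE('p) R (integral_closure_module R) < \<infinity>"
  shows "normal_ring R"
proof -
  have C: "cring R" using assms(2) by (simp add: local_ring_def)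
  have IC: "integral_closure R = to_total_fractions R ` carrier R"
    by (rule cring.finite_proj_dim_integral_closure[OF C assms(1,4)])
  have "domain R"
    by (rule local_integrally_closed_imp_domain[OF assms(1,2)
          analytically_unramified_imp_reduced[OF assms(3)] IC])
  from domain.normal_domain_localization[OF this IC] C
  show ?thesis by (simp add: normal_ring_def)
qed

end
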